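(* Let $\mathcal{N}$ be a nest on a Hilbert space $H$. Then the hypocompact radical of the nest algebra $\mathrm{Alg}\,\mathcal{N}$ is the ideal $\mathcal{K}(\mathcal{N})+\mathrm{Rad}(\mathcal{N})$; that is, $$\mathcal{R}_{hc}(\mathrm{Alg}\,\mathcal{N})=\mathcal{K}(\mathcal{N})+\mathrm{Rad}(\mathcal{N}).$$
   Context: Hilbert spaces and Banach algebras are over $\mathbb{C}$; $\mathcal{B}(H)$ is the algebra of bounded linear operators on $H$. Ideals are two-sided, and all ideals are considered to be closed. A nest $\mathcal{N}$ on $H$ is a family of closed subspaces of $H$, totally ordered by inclusion, containing $\{0\}$ and $H$, and closed under (arbitrary) intersection and closed linear span. The nest algebra is $\mathrm{Alg}\,\mathcal{N}=\{T\in\mathcal{B}(H): T(N)\subseteq N \text{ for all } N\in\mathcal{N}\}$, a Banach algebra in the operator norm. $\mathcal{K}(\mathcal{N})$ denotes the ideal of all compact operators belonging to $\mathrm{Alg}\,\mathcal{N}$. $\mathrm{Rad}(\mathcal{N})$ denotes the Jacobson radical of $\mathrm{Alg}\,\mathcal{N}$. The sum is $\mathcal{K}(\mathcal{N})+\mathrm{Rad}(\mathcal{N})=\{k+r: k\in\mathcal{K}(\mathcal{N}),\ r\in\mathrm{Rad}(\mathcal{N})\}$. An element $a$ of a Banach algebra $\mathcal{A}$ is compact if the map $M_{a,a}:\mathcal{A}\to\mathcal{A}$, $x\mapsto axa$, is a compact operator. A Banach algebra $\mathcal{A}$ is hypocompact if every nonzero quotient $\mathcal{A}/\mathcal{J}$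 by a closed ideal $\mathcal{J}$ contains a nonzero compact element (of $\mathcal{A}/\mathcal{J}$). It is known (Shulman–Turovskii) that every Banach algebra $\mathcal{A}$ has a largest hypocompact closed ideal (i.e. a closed ideal which is hypocompact as a Banach algebra and contains every other such ideal); it is denoted $\mathcal{R}_{hc}(\mathcal{A})$ and called the hypocompact radical of $\mathcal{A}$. *)

theory Defs
  imports "HOL-Analysis.Analysis"
begin

section \<open>Complex Hilbert spaces\<close>

text \<open>
  A complex Hilbert space is presented on top of its underlying real Hilbert space: the real inner
  product of the class \<^class>\<open>real_inner\<close> is the real part of the complex one.  The complex inner
  product is linear in the first argument; positivity follows from that of the real inner product.
\<close>

class scaleC =
  fixes scaleC :: "complex \<Rightarrow> 'a \<Rightarrow> 'a" (infixr "*\<^sub>C" 75)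

class complex_hilbert_space = real_inner + complete_space + scaleC +
  fixes cinner :: "'a \<Rightarrow> 'a \<Rightarrow> complex"
  assumes scaleC_add_right: "c *\<^sub>C (x + y) = c *\<^sub>C x + c *\<^sub>C y"
    and scaleC_add_left: "(c + d) *\<^sub>C x = c *\<^sub>C x + d *\<^sub>C x"
    and scaleC_scaleC: "c *\<^sub>C (d *\<^sub>C x) = (c * d) *\<^sub>C x"
    and scaleC_of_real: "complex_of_real r *\<^sub>C x = r *\<^sub>R x"
    and cinner_add_left: "cinner (x + y) z = cinner x z + cinner y z"
    and cinner_scaleC_left: "cinner (c *\<^sub>C x) y = c * cinner x y"
    and cinner_commute: "cinner x y = cnj (cinner y x)"
    and Re_cinner: "Re (cinner x y) = inner x y"
begin

subclass banach ..

end

global_interpretation complex_vector: vector_space "scaleC :: complex \<Rightarrow> 'h \<Rightarrow> 'h::complex_hilbert_space"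
  defines csubspace = complex_vector.subspace
    and cspan = complex_vector.span
proof
  fix c d :: complex and x y :: 'h
  show "c *\<^sub>C (x + y) = c *\<^sub>C x + c *\<^sub>C y" by (rule scaleC_add_right)
  show "(c + d) *\<^sub>C x = c *\<^sub>C x + d *\<^sub>C x" by (rule scaleC_add_left)
  show "c *\<^sub>C (d *\<^sub>C x) = (c * d) *\<^sub>C x" by (rule scaleC_scaleC)
  show "1 *\<^sub>C x = x" using scaleC_of_real[of 1 x] by simp
qed

lemma cinner_self: "cinner x x = complex_of_real ((norm x)\<^sup>2)"
proof -
  have "Im (cinner x x) = 0"
    using arg_cong[OF cinner_commute[of x x], of Im] by simp
  then show ?thesis
    by (simp add: complex_eq_iff Re_cinner power2_norm_eq_inner)
qed

lemma norm_scaleC: "norm (c *\<^sub>C x) = cmod c * norm x"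
  for x :: "'h::complex_hilbert_space"
proof -
  have "cinner (c *\<^sub>C x) (c *\<^sub>C x) = (c * cnj c) * cinner x x"
    by (metis cinner_commute cinner_scaleC_left complex_cnj_mult mult.assoc mult.commute)
  then have "complex_of_real ((norm (c *\<^sub>C x))\<^sup>2) = complex_of_real ((cmod c * norm x)\<^sup>2)"
    by (simp only: cinner_self complex_norm_square[symmetric] of_real_mult[symmetric] power_mult_distrib)
  then show ?thesis
    by (simp only: of_real_eq_iff) (simp add: power2_eq_iff_nonneg)
qed

lemma bounded_linear_scaleC: "bounded_linear (\<lambda>x::'h::complex_hilbert_space. c *\<^sub>C x)"
proof (rule bounded_linear_intro[where K = "cmod c"])
  fix x y :: 'h and r :: real
  show "c *\<^sub>C (x + y) = c *\<^sub>C x + c *\<^sub>C y" by (rule scaleC_add_right)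
  show "c *\<^sub>C (r *\<^sub>R x) = r *\<^sub>R (c *\<^sub>C x)"
    by (simp add: scaleC_of_real[symmetric] scaleC_scaleC mult.commute)
  show "norm (c *\<^sub>C x) \<le> norm x * cmod c" by (simp add: norm_scaleC)
qed

instantiation complex :: complex_hilbert_space
begin

definition scaleC_complex :: "complex \<Rightarrow> complex \<Rightarrow> complex" where
  "scaleC_complex c x = c * x"

definition cinner_complex :: "complex \<Rightarrow> complex \<Rightarrow> complex" where
  "cinner_complex x y = x * cnj y"

instance
  by standard
    (auto simp: scaleC_complex_def cinner_complex_def algebra_simps scaleR_conv_of_real inner_complex_def)

end


section \<open>Banach algebras and their ideals\<close>

text \<open>
  Algebras live on carrier sets, and need not be unital, so that closed ideals and quotients by
  closed ideals are again Banach algebras in the same sense.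
\<close>

record 'a normed_alg =
  acarrier :: "'a set"
  azero :: 'a
  aplus :: "'a \<Rightarrow> 'a \<Rightarrow> 'a"
  amult :: "'a \<Rightarrow> 'a \<Rightarrow> 'a"
  ascale :: "complex \<Rightarrow> 'a \<Rightarrow> 'a"
  anorm :: "'a \<Rightarrow> real"

definition aminus :: "'a normed_alg \<Rightarrow> 'a \<Rightarrow> 'a \<Rightarrow> 'a" where
  "aminus A x y = aplus A x (ascale A (-1) y)"

text \<open>
  The value outside the carrier is immaterial; it is fixed because \<^locale>\<open>Metric_space\<close> requires
  distances to be nonnegative and symmetric on the whole type.
\<close>

definition adist :: "'a normed_alg \<Rightarrow> 'a \<Rightarrow> 'a \<Rightarrow> real" where
  "adist A x y = (if x \<in> acarrier A \<and> y \<in> acarrier A then anorm A (aminus A x y) else 0)"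

definition atopology :: "'a normed_alg \<Rightarrow> 'a topology" where
  "atopology A = Metric_space.mtopology (acarrier A) (adist A)"

locale banach_algebra =
  fixes A :: "'a normed_alg"
  assumes zero_closed: "azero A \<in> acarrier A"
    and plus_closed: "\<lbrakk>x \<in> acarrier A; y \<in> acarrier A\<rbrakk> \<Longrightarrow> aplus A x y \<in> acarrier A"
    and mult_closed: "\<lbrakk>x \<in> acarrier A; y \<in> acarrier A\<rbrakk> \<Longrightarrow> amult A x y \<in> acarrier A"
    and scale_closed: "x \<in> acarrier A \<Longrightarrow> ascale A c x \<in> acarrier A"
    and plus_assoc: "\<lbrakk>x \<in> acarrier A; y \<in> acarrier A; z \<in> acarrier A\<rbrakk>
      \<Longrightarrow> aplus A (aplus A x y) z = aplus A x (aplus A y z)"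
    and plus_commute: "\<lbrakk>x \<in> acarrier A; y \<in> acarrier A\<rbrakk> \<Longrightarrow> aplus A x y = aplus A y x"
    and plus_zero: "x \<in> acarrier A \<Longrightarrow> aplus A x (azero A) = x"
    and minus_self: "x \<in> acarrier A \<Longrightarrow> aminus A x x = azero A"
    and scale_plus: "\<lbrakk>x \<in> acarrier A; y \<in> acarrier A\<rbrakk>
      \<Longrightarrow> ascale A c (aplus A x y) = aplus A (ascale A c x) (ascale A c y)"
    and plus_scale: "x \<in> acarrier A
      \<Longrightarrow> ascale A (c + d) x = aplus A (ascale A c x) (ascale A d x)"
    and scale_scale: "x \<in> acarrier A \<Longrightarrow> ascale A c (ascale A d x) = ascale A (c * d) x"
    and scale_one: "x \<in> acarrier A \<Longrightarrow> ascale A 1 x = x"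
    and mult_assoc: "\<lbrakk>x \<in> acarrier A; y \<in> acarrier A; z \<in> acarrier A\<rbrakk>
      \<Longrightarrow> amult A (amult A x y) z = amult A x (amult A y z)"
    and mult_plus: "\<lbrakk>x \<in> acarrier A; y \<in> acarrier A; z \<in> acarrier A\<rbrakk>
      \<Longrightarrow> amult A x (aplus A y z) = aplus A (amult A x y) (amult A x z)"
    and plus_mult: "\<lbrakk>x \<in> acarrier A; y \<in> acarrier A; z \<in> acarrier A\<rbrakk>
      \<Longrightarrow> amult A (aplus A x y) z = aplus A (amult A x z) (amult A y z)"
    and scale_mult: "\<lbrakk>x \<in> acarrier A; y \<in> acarrier A\<rbrakk>
      \<Longrightarrow> amult A (ascale A c x) y = ascale A c (amult A x y)"
    and mult_scale: "\<lbrakk>x \<in> acarrier A; y \<in> acarrier A\<rbrakk>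
      \<Longrightarrow> amult A x (ascale A c y) = ascale A c (amult A x y)"
    and norm_nonneg: "x \<in> acarrier A \<Longrightarrow> 0 \<le> anorm A x"
    and norm_eq_zero: "x \<in> acarrier A \<Longrightarrow> anorm A x = 0 \<longleftrightarrow> x = azero A"
    and norm_plus: "\<lbrakk>x \<in> acarrier A; y \<in> acarrier A\<rbrakk>
      \<Longrightarrow> anorm A (aplus A x y) \<le> anorm A x + anorm A y"
    and norm_scale: "x \<in> acarrier A \<Longrightarrow> anorm A (ascale A c x) = cmod c * anorm A x"
    and norm_mult: "\<lbrakk>x \<in> acarrier A; y \<in> acarrier A\<rbrakk>
      \<Longrightarrow> anorm A (amult A x y) \<le> anorm A x * anorm A y"
    and complete: "Metric_space.mcomplete (acarrier A) (adist A)"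

definition alg_subspace :: "'a normed_alg \<Rightarrow> 'a set \<Rightarrow> bool" where
  "alg_subspace A J \<longleftrightarrow> J \<subseteq> acarrier A \<and> azero A \<in> J \<and>
     (\<forall>x\<in>J. \<forall>y\<in>J. aplus A x y \<in> J) \<and> (\<forall>c. \<forall>x\<in>J. ascale A c x \<in> J)"

definition left_ideal :: "'a normed_alg \<Rightarrow> 'a set \<Rightarrow> bool" where
  "left_ideal A J \<longleftrightarrow> alg_subspace A J \<and> (\<forall>a\<in>acarrier A. \<forall>x\<in>J. amult A a x \<in> J)"

definition closed_ideal :: "'a normed_alg \<Rightarrow> 'a set \<Rightarrow> bool" where
  "closed_ideal A J \<longleftrightarrow> alg_subspace A J \<and>
     (\<forall>a\<in>acarrier A. \<forall>x\<in>J. amult A a x \<in> J \<and> amult A x a \<in> J) \<and> closedin (atopology A) J"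

definition alg_restrict :: "'a normed_alg \<Rightarrow> 'a set \<Rightarrow> 'a normed_alg" where
  "alg_restrict A J = A\<lparr>acarrier := J\<rparr>"

definition alg_coset :: "'a normed_alg \<Rightarrow> 'a set \<Rightarrow> 'a \<Rightarrow> 'a set" where
  "alg_coset A J a = aplus A a ` J"

text \<open>
  The operations on cosets are written as unions over all representatives; when \<open>J\<close> is an ideal,
  all the cosets in each of these unions coincide.
\<close>

definition alg_quotient :: "'a normed_alg \<Rightarrow> 'a set \<Rightarrow> 'a set normed_alg" where
  "alg_quotient A J = \<lparr>
     acarrier = alg_coset A J ` acarrier A,
     azero = alg_coset A J (azero A),
     aplus = (\<lambda>C D. \<Union>x\<in>C. \<Union>y\<in>D. alg_coset A J (aplus A x y)),
     amult = (\<lambda>C D. \<Union>x\<in>C. \<Union>y\<in>D. alg_coset A J (amult A x y)),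
     ascale = (\<lambda>c C. \<Union>x\<in>C. alg_coset A J (ascale A c x)),
     anorm = (\<lambda>C. INF x\<in>C. anorm A x)\<rparr>"

text \<open>
  The Jacobson radical is the intersection of the maximal modular left ideals.  In a unital algebra
  every left ideal is modular (take \<open>u\<close> to be the unit), so that this is the intersection of the
  maximal left ideals.
\<close>

definition modular_left_ideal :: "'a normed_alg \<Rightarrow> 'a set \<Rightarrow> bool" where
  "modular_left_ideal A L \<longleftrightarrow> left_ideal A L \<and>
     (\<exists>u\<in>acarrier A. \<forall>x\<in>acarrier A. aminus A x (amult A x u) \<in> L)"

definition maximal_modular_left_ideal :: "'a normed_alg \<Rightarrow> 'a set \<Rightarrow> bool" where
  "maximal_modular_left_ideal A L \<longleftrightarrow> modular_left_ideal A L \<and> L \<noteq> acarrier A \<and>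
     (\<forall>L'. left_ideal A L' \<and> L \<subseteq> L' \<longrightarrow> L' = L \<or> L' = acarrier A)"

definition jacobson_radical :: "'a normed_alg \<Rightarrow> 'a set" where
  "jacobson_radical A = {a \<in> acarrier A. \<forall>L. maximal_modular_left_ideal A L \<longrightarrow> a \<in> L}"


section \<open>Compact elements and the hypocompact radical\<close>

definition compact_map :: "'a normed_alg \<Rightarrow> ('a \<Rightarrow> 'a) \<Rightarrow> bool" where
  "compact_map A f \<longleftrightarrow>
     compactin (atopology A) (atopology A closure_of (f ` {x \<in> acarrier A. anorm A x \<le> 1}))"

definition compact_element :: "'a normed_alg \<Rightarrow> 'a \<Rightarrow> bool" where
  "compact_element A a \<longleftrightarrow> a \<in> acarrier A \<and> compact_map A (\<lambda>x. amult A (amult A a x) a)"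

definition hypocompact :: "'a normed_alg \<Rightarrow> bool" where
  "hypocompact A \<longleftrightarrow> (\<forall>J. closed_ideal A J \<and> J \<noteq> acarrier A \<longrightarrow>
     (\<exists>a. compact_element (alg_quotient A J) a \<and> a \<noteq> azero (alg_quotient A J)))"

definition is_hypocompact_radical :: "'a normed_alg \<Rightarrow> 'a set \<Rightarrow> bool" where
  "is_hypocompact_radical A R \<longleftrightarrow> closed_ideal A R \<and> hypocompact (alg_restrict A R) \<and>
     (\<forall>J. closed_ideal A J \<and> hypocompact (alg_restrict A J) \<longrightarrow> J \<subseteq> R)"

definition hypocompact_radical :: "'a normed_alg \<Rightarrow> 'a set" where
  "hypocompact_radical A = (THE R. is_hypocompact_radical A R)"

lemma hypocompact_radical_eq:
  "is_hypocompact_radical A R \<Longrightarrow> hypocompact_radical A = R"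
  unfolding hypocompact_radical_def
  by (rule the_equality) (auto simp: is_hypocompact_radical_def)


section \<open>Nest algebras\<close>

definition is_nest :: "'h::complex_hilbert_space set set \<Rightarrow> bool" where
  "is_nest \<N> \<longleftrightarrow>
     (\<forall>M\<in>\<N>. csubspace M \<and> closed M) \<and>
     (\<forall>M\<in>\<N>. \<forall>M'\<in>\<N>. M \<subseteq> M' \<or> M' \<subseteq> M) \<and>
     {0} \<in> \<N> \<and> UNIV \<in> \<N> \<and>
     (\<forall>\<F>\<subseteq>\<N>. \<Inter>\<F> \<in> \<N>) \<and>
     (\<forall>\<F>\<subseteq>\<N>. closure (cspan (\<Union>\<F>)) \<in> \<N>)"

text \<open>
  The elements of the type \<^typ>\<open>'h \<Rightarrow>\<^sub>L 'h\<close> are the bounded real-linear operators; the complex-linear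
  ones among them form the algebra of bounded operators.
\<close>

definition bounded_operators :: "('h::complex_hilbert_space \<Rightarrow>\<^sub>L 'h) set" where
  "bounded_operators = {T. Vector_Spaces.linear scaleC scaleC (blinfun_apply T)}"

definition nest_algebra ::
    "'h::complex_hilbert_space set set \<Rightarrow> ('h \<Rightarrow>\<^sub>L 'h) normed_alg" where
  "nest_algebra \<N> = \<lparr>
     acarrier = {T \<in> bounded_operators. \<forall>M\<in>\<N>. blinfun_apply T ` M \<subseteq> M},
     azero = 0,
     aplus = (+),
     amult = (o\<^sub>L),
     ascale = (\<lambda>c T. Blinfun (\<lambda>x. c *\<^sub>C blinfun_apply T x)),
     anorm = norm\<rparr>"

definition compact_operator :: "('h::complex_hilbert_space \<Rightarrow>\<^sub>L 'h) \<Rightarrow> bool" where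
  "compact_operator T \<longleftrightarrow> compact (closure (blinfun_apply T ` cball 0 1))"

definition nest_compacts :: "'h::complex_hilbert_space set set \<Rightarrow> ('h \<Rightarrow>\<^sub>L 'h) set" where
  "nest_compacts \<N> = {T \<in> acarrier (nest_algebra \<N>). compact_operator T}"

lemma blinfun_apply_ascale:
  "blinfun_apply (ascale (nest_algebra \<N>) c T) x = c *\<^sub>C blinfun_apply T x"
proof -
  have "bounded_linear (\<lambda>x. c *\<^sub>C blinfun_apply T x)"
    using bounded_linear_compose[OF bounded_linear_scaleC blinfun.bounded_linear_right] .
  then show ?thesis
    by (simp add: nest_algebra_def bounded_linear_Blinfun_apply)
qed

lemma linear_scaleC_iff:
  "Vector_Spaces.linear scaleC scaleC f \<longleftrightarrow>
     (\<forall>x y. f (x + y) = f x + f y) \<and> (\<forall>c x. f (c *\<^sub>C x) = c *\<^sub>C f x)"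
  for f :: "'h::complex_hilbert_space \<Rightarrow> 'h"
  unfolding Vector_Spaces.linear_def module_hom_def module_hom_axioms_def
  using complex_vector.vector_space_axioms complex_vector.module_axioms by auto

lemma bounded_operators_iff:
  "T \<in> bounded_operators \<longleftrightarrow> (\<forall>c x. blinfun_apply T (c *\<^sub>C x) = c *\<^sub>C blinfun_apply T x)"
  unfolding bounded_operators_def by (simp add: linear_scaleC_iff blinfun.add_right)

lemma aminus_nest_algebra: "aminus (nest_algebra \<N>) S T = S - T"
proof (rule blinfun_eqI)
  fix x
  have "(-1) *\<^sub>C blinfun_apply T x = - blinfun_apply T x"
    using scaleC_of_real[of "-1" "blinfun_apply T x"] by simp
  then have "blinfun_apply (ascale (nest_algebra \<N>) (-1) T) x = - blinfun_apply T x"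
    by (simp only: blinfun_apply_ascale)
  then show "blinfun_apply (aminus (nest_algebra \<N>) S T) x = blinfun_apply (S - T) x"
    by (simp add: aminus_def nest_algebra_def blinfun.add_left blinfun.diff_left)
qed

lemma norm_ascale: "norm (ascale (nest_algebra \<N>) c T) = cmod c * norm T"
proof (rule antisym)
  show "norm (ascale (nest_algebra \<N>) c T) \<le> cmod c * norm T"
    by (rule norm_blinfun_bound)
      (auto simp: blinfun_apply_ascale norm_scaleC mult.assoc intro!: mult_left_mono norm_blinfun)
  show "cmod c * norm T \<le> norm (ascale (nest_algebra \<N>) c T)"
  proof (cases "c = 0")
    case False
    have "norm T \<le> norm (ascale (nest_algebra \<N>) c T) / cmod c"
    proof (rule norm_blinfun_bound)
      fix x
      have "cmod c * norm (blinfun_apply T x) \<le> norm (ascale (nest_algebra \<N>) c T) * norm x"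
        using norm_blinfun[of "ascale (nest_algebra \<N>) c T" x]
        by (simp add: blinfun_apply_ascale norm_scaleC)
      then show "norm (blinfun_apply T x) \<le> norm (ascale (nest_algebra \<N>) c T) / cmod c * norm x"
        using False by (simp add: field_simps)
    qed simp
    then show ?thesis using False by (simp add: field_simps)
  qed simp
qed

lemma closed_nest_algebra:
  assumes "is_nest \<N>"
  shows "closed (acarrier (nest_algebra \<N>))"
proof -
  have 1: "closed {T :: 'a \<Rightarrow>\<^sub>L 'a. blinfun_apply T (c *\<^sub>C x) = c *\<^sub>C blinfun_apply T x}" for c x
    by (intro closed_Collect_eq continuous_intros
        bounded_linear.continuous_on[OF bounded_linear_scaleC])
  have 2: "closed {T :: 'a \<Rightarrow>\<^sub>L 'a. blinfun_apply T x \<in> M}" if "M \<in> \<N>" for x M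
  proof -
    have "closed M" using assms that by (auto simp: is_nest_def)
    then have "closed ((\<lambda>T :: 'a \<Rightarrow>\<^sub>L 'a. blinfun_apply T x) -` M)"
      by (intro closed_vimage continuous_intros)
    then show ?thesis by (simp add: vimage_def)
  qed
  have "acarrier (nest_algebra \<N>) =
      (\<Inter>c. \<Inter>x. {T. blinfun_apply T (c *\<^sub>C x) = c *\<^sub>C blinfun_apply T x}) \<inter>
      (\<Inter>M\<in>\<N>. \<Inter>x\<in>M. {T. blinfun_apply T x \<in> M})"
    by (auto simp: nest_algebra_def bounded_operators_iff image_subset_iff)
  then show ?thesis using 1 2 by (auto intro!: closed_Int closed_INT)
qed

lemma banach_algebra_nest_algebra:
  assumes nest: "is_nest \<N>"
  shows "banach_algebra (nest_algebra \<N>)"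
proof -
  let ?A = "nest_algebra \<N>"
  have sub: "0 \<in> M" "x + y \<in> M" "c *\<^sub>C x \<in> M" if "M \<in> \<N>" "x \<in> M" "y \<in> M" for M x y c
    using nest that by (auto simp: is_nest_def complex_vector.subspace_def)
  have zero: "0 \<in> M" if "M \<in> \<N>" for M
    using nest that by (auto simp: is_nest_def complex_vector.subspace_def)
  have carrier: "T \<in> acarrier ?A \<longleftrightarrow>
      (\<forall>c x. blinfun_apply T (c *\<^sub>C x) = c *\<^sub>C blinfun_apply T x) \<and>
      (\<forall>M\<in>\<N>. \<forall>x\<in>M. blinfun_apply T x \<in> M)" for T
    by (auto simp: nest_algebra_def bounded_operators_iff image_subset_iff)
  have ops: "azero ?A = 0" "aplus ?A = (+)" "amult ?A = (o\<^sub>L)" "anorm ?A = norm"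
    by (simp_all add: nest_algebra_def)
  have dist: "adist ?A S T = dist S T" if "S \<in> acarrier ?A" "T \<in> acarrier ?A" for S T
    using that by (simp add: adist_def aminus_nest_algebra ops dist_norm)
  interpret Metric_space "acarrier ?A" "adist ?A"
  proof
    fix S T U
    show "0 \<le> adist ?A S T" "adist ?A S T = adist ?A T S"
      by (auto simp: adist_def aminus_nest_algebra ops norm_minus_commute)
    show "adist ?A S T = 0 \<longleftrightarrow> S = T" if "S \<in> acarrier ?A" "T \<in> acarrier ?A"
      using that by (simp add: dist)
    show "adist ?A S U \<le> adist ?A S T + adist ?A T U"
      if "S \<in> acarrier ?A" "T \<in> acarrier ?A" "U \<in> acarrier ?A"
      using that by (simp add: dist dist_triangle)
  qed
  have complete: "mcomplete"
    unfolding mcomplete_def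
  proof (intro allI impI)
    fix \<sigma> assume \<sigma>: "MCauchy \<sigma>"
    then have in_A: "\<sigma> n \<in> acarrier ?A" for n by (auto simp: MCauchy_def)
    have "Cauchy \<sigma>"
      using \<sigma> by (auto simp: MCauchy_def Cauchy_def dist in_A)
    then obtain T where T: "\<sigma> \<longlonglongrightarrow> T"
      using Cauchy_convergent convergent_def by blast
    have "T \<in> acarrier ?A"
      using closed_sequentially[OF closed_nest_algebra[OF nest]] in_A T by blast
    then have "limitin mtopology \<sigma> T sequentially"
      using T by (auto simp: limit_metric_sequentially lim_sequentially dist in_A)
    then show "\<exists>x. limitin mtopology \<sigma> x sequentially" by blast
  qed
  show ?thesis
  proof
    show "anorm ?A (ascale ?A c x) = cmod c * anorm ?A x" for c x
      by (simp add: ops norm_ascale)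
    show "anorm ?A (amult ?A x y) \<le> anorm ?A x * anorm ?A y" for x y
      by (simp add: ops norm_blinfun_compose)
  qed (auto simp: carrier ops sub zero aminus_nest_algebra blinfun_apply_ascale complete
      blinfun.add_left blinfun.add_right scaleC_add_right scaleC_add_left scaleC_scaleC
      mult.commute norm_triangle_ineq intro!: blinfun_eqI)
qed

end

(*
  By Ringrose's theorem the radical consists of the operators whose diagonal blocks can be made
  arbitrarily small along a finite subnest.  Such an operator is, up to a small error, a sum of corners
  s = P T (1 - P) with P in the nest, and s b s = 0 for all b in the algebra.  Hence in a proper quotient
  of compacts + radical either some compact operator (Vala: x |-> k x k is compact) or some corner
  survives, and both are compact elements.

  Conversely, a compactness argument on the nest shows that an operator a outside compacts + radical
  acts as a diagonal operator, bounded below, between orthonormal sequences x and y which either live in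
  one atom or converge to one point of the nest.  The algebra then contains operators shifting a (x k)
  back to a neighbour of x k for k in any prescribed index set.  Infinitely many disjoint index sets give
  a bounded sequence z in any ideal containing a for which the elements a z a stay apart modulo
  compacts + radical, so that a is not a compact element.  The same shifts, together with an explicit
  eigenvector, yield the nontrivial half of Ringrose's theorem.
*)

theory Submission
  imports Defs
begin

text \<open>The vectors \<open>x n\<close> and \<open>y n\<close> come from one block of the nest,
  and nothing places \<open>x n\<close> below \<open>y n\<close> inside it, so the algebra need not
  contain the rank-one operator taking \<open>y n\<close> to \<open>x n\<close>. Passing to a
  neighbouring index removes the ambiguity; this is why \<open>a\<close> is inverted up to a shift
  and not diagonally. Convergence of both sequences to one point of the nest makes the matrix
  entries of every element of the sum tend to zero: a compact operator kills them by weak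
  convergence, and a radical operator because a single block of a finite subnest contains the tails
  of both sequences. An ideal \<open>J\<close> is tested in its quotient by the intersection with
  the sum, so the bounded sequence must lie in \<open>J\<close> itself. Each term therefore has
  \<open>a\<close> as a factor between two shifts, and the index moves by two steps instead of one.
  A sum of two closed subspaces need not be closed. Here closedness comes from a splitting with norm
  control: a compact operator close to the radical is corrected by its own corners, which are both
  compact and radical.\<close>

section \<open>Complex inner product and Cauchy-Schwarz inequality\<close>

lemma cinner_add_right: "cinner x (y + z) = cinner x y + cinner x z"
  by (metis cinner_add_left cinner_commute complex_cnj_add)

lemma cinner_scaleC_right: "cinner x (c *\<^sub>C y) = cnj c * cinner x y"
  by (metis cinner_commute cinner_scaleC_left complex_cnj_mult)

lemma cinner_scaleR_left: "cinner (r *\<^sub>R x) y = r *\<^sub>R cinner x y"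
  by (metis cinner_scaleC_left scaleC_of_real scaleR_conv_of_real)

lemma cinner_scaleR_right: "cinner x (r *\<^sub>R y) = r *\<^sub>R cinner x y"
  by (metis cinner_scaleR_left cinner_commute complex_cnj_scaleR)

text \<open>Multiplying \<open>x\<close> by a unimodular \<open>c\<close> makes the product real and
  nonnegative, which reduces the claim to the Cauchy-Schwarz inequality of the real inner
  product.\<close>

lemma norm_cinner_le: "cmod (cinner x y) \<le> norm x * norm y"
  for x y :: "'h::complex_hilbert_space"
proof (cases "cinner x y = 0")
  case False
  define c where "c = cnj (cinner x y) / cmod (cinner x y)"
  have c: "cmod c = 1" using False by (simp add: c_def norm_divide)
  have "c * cinner x y = cmod (cinner x y)"
    using False by (simp add: c_def mult.commute complex_norm_square[symmetric] power2_eq_square)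
  then have "cmod (cinner x y) = Re (cinner (c *\<^sub>C x) y)"
    by (simp add: cinner_scaleC_left)
  also have "\<dots> = inner (c *\<^sub>C x) y" by (rule Re_cinner)
  also have "\<dots> \<le> norm (c *\<^sub>C x) * norm y" by (rule norm_cauchy_schwarz)
  finally show ?thesis by (simp add: norm_scaleC c)
qed simp

interpretation cinner: bounded_bilinear "cinner :: 'h::complex_hilbert_space \<Rightarrow> 'h \<Rightarrow> complex"
  by standard
    (auto simp: cinner_add_left cinner_add_right cinner_scaleR_left cinner_scaleR_right
      intro!: exI[of _ 1] norm_cinner_le)

lemma cinner_self_eq_0_iff: "cinner x x = 0 \<longleftrightarrow> x = 0"
  by (simp add: cinner_self)

lemma norm_eq_1_iff_cinner: "norm x = 1 \<longleftrightarrow> cinner x x = 1"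
  for x :: "'h::complex_hilbert_space"
proof -
  have "cinner x x = 1 \<longleftrightarrow> (norm x)\<^sup>2 = 1" by (metis cinner_self of_real_eq_1_iff)
  then show ?thesis using norm_ge_zero[of x] by (auto simp: power2_eq_1_iff)
qed

lemma cinner_eq_0_sym: "cinner x y = 0 \<longleftrightarrow> cinner y x = 0"
  by (metis cinner_commute complex_cnj_zero)

lemma cinner_continuous_left: "continuous_on S (\<lambda>x. cinner x y)"
  by (intro continuous_on_id continuous_on_const cinner.continuous_on)

lemma norm_Pythagoras:
  assumes "cinner x y = 0"
  shows "(norm (x + y))\<^sup>2 = (norm x)\<^sup>2 + (norm y)\<^sup>2"
  using arg_cong[OF assms, of Re] by (simp add: Re_cinner power2_norm_eq_inner inner_add inner_commute)

lemma scaleC_one [simp]: "1 *\<^sub>C x = (x::'h::complex_hilbert_space)"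
  using scaleC_of_real[of 1 x] by simp

lemma scaleC_minus_one: "(-1) *\<^sub>C x = - (x::'h::complex_hilbert_space)"
  using scaleC_of_real[of "-1" x] by simp

section \<open>Closed complex subspaces, orthogonal complements and projections\<close>

definition closed_csubspace :: "'h::complex_hilbert_space set \<Rightarrow> bool" where
  "closed_csubspace M \<longleftrightarrow> csubspace M \<and> closed M"

lemma closed_csubspaceD:
  assumes "closed_csubspace M"
  shows "closed M" "0 \<in> M" "\<And>x y. x \<in> M \<Longrightarrow> y \<in> M \<Longrightarrow> x + y \<in> M"
    "\<And>c x. x \<in> M \<Longrightarrow> c *\<^sub>C x \<in> M" "\<And>r x. x \<in> M \<Longrightarrow> r *\<^sub>R x \<in> M" "\<And>x. x \<in> M \<Longrightarrow> - x \<in> M"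
    "\<And>x y. x \<in> M \<Longrightarrow> y \<in> M \<Longrightarrow> x - y \<in> M"
proof -
  have M: "csubspace M" "closed M" using assms by (auto simp: closed_csubspace_def)
  show "closed M" "0 \<in> M" "\<And>x y. x \<in> M \<Longrightarrow> y \<in> M \<Longrightarrow> x + y \<in> M"
    and sc: "\<And>c x. x \<in> M \<Longrightarrow> c *\<^sub>C x \<in> M" and "\<And>x y. x \<in> M \<Longrightarrow> y \<in> M \<Longrightarrow> x - y \<in> M"
    using M by (auto simp: complex_vector.subspace_def complex_vector.subspace_diff)
  show "r *\<^sub>R x \<in> M" if "x \<in> M" for r x using sc[OF that, of "complex_of_real r"] by (simp add: scaleC_of_real)
  show "- x \<in> M" if "x \<in> M" for x using sc[OF that, of "-1"] by (simp only: scaleC_minus_one)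
qed

lemma closed_csubspaceI:
  assumes "closed M" "0 \<in> M" "\<And>x y. x \<in> M \<Longrightarrow> y \<in> M \<Longrightarrow> x + y \<in> M"
    "\<And>c x. x \<in> M \<Longrightarrow> c *\<^sub>C x \<in> M"
  shows "closed_csubspace M"
  using assms unfolding closed_csubspace_def complex_vector.subspace_def by auto

lemma closed_csubspace_UNIV: "closed_csubspace UNIV"
  and closed_csubspace_0: "closed_csubspace {0}"
  by (rule closed_csubspaceI; simp)+

lemma closed_csubspace_Int:
  "closed_csubspace M \<Longrightarrow> closed_csubspace N \<Longrightarrow> closed_csubspace (M \<inter> N)"
  by (rule closed_csubspaceI) (auto simp: closed_csubspaceD)

definition ocomp :: "'h::complex_hilbert_space set \<Rightarrow> 'h set" where
  "ocomp G = {x. \<forall>g\<in>G. cinner x g = 0}"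

lemma ocompD: "x \<in> ocomp G \<Longrightarrow> g \<in> G \<Longrightarrow> cinner x g = 0"
  and ocompD': "x \<in> ocomp G \<Longrightarrow> g \<in> G \<Longrightarrow> cinner g x = 0"
  by (auto simp: ocomp_def cinner_eq_0_sym[of g x])

lemma ocomp_antimono: "F \<subseteq> G \<Longrightarrow> ocomp G \<subseteq> ocomp F"
  by (auto simp: ocomp_def)

lemma ocomp_insert: "ocomp (insert g G) = ocomp {g} \<inter> ocomp G"
  and ocomp_empty [simp]: "ocomp {} = UNIV"
  by (auto simp: ocomp_def)

lemma closed_csubspace_ocomp: "closed_csubspace (ocomp G)"
proof (rule closed_csubspaceI)
  have "ocomp G = (\<Inter>g\<in>G. {x. cinner x g = 0})" by (auto simp: ocomp_def)
  also have "closed \<dots>"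
    by (intro closed_INT ballI closed_Collect_eq cinner_continuous_left continuous_on_const)
  finally show "closed (ocomp G)" .
qed (auto simp: ocomp_def cinner_add_left cinner_scaleC_left cinner.zero_left)

lemma ocomp_Int_self: "x \<in> M \<Longrightarrow> x \<in> ocomp M \<Longrightarrow> x = 0"
  using ocompD cinner_self_eq_0_iff by blast

text \<open>The real inner product sees only the real part of the complex one; testing against
  \<open>\<i> *\<^sub>C z\<close>, which also lies in \<open>M\<close>, yields the imaginary
  part.\<close>

lemma ocompI_inner:
  assumes "closed_csubspace M" "\<And>z. z \<in> M \<Longrightarrow> inner x z = 0"
  shows "x \<in> ocomp M"
  unfolding ocomp_def
proof (intro CollectI ballI)
  fix z assume z: "z \<in> M"
  have "Re (cinner x (\<i> *\<^sub>C z)) = 0"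
    using assms z by (simp add: Re_cinner closed_csubspaceD)
  then have "Im (cinner x z) = 0" by (simp add: cinner_scaleC_right)
  moreover have "Re (cinner x z) = 0" using assms z by (simp add: Re_cinner)
  ultimately show "cinner x z = 0" by (simp add: complex_eq_iff)
qed

lemma projection_exists:
  fixes x :: "'h::complex_hilbert_space"
  assumes M: "closed_csubspace M"
  shows "\<exists>y\<in>M. x - y \<in> ocomp M"
proof -
  let ?D = "INF y\<in>M. (norm (x - y))\<^sup>2"
  have ne: "M \<noteq> {}" using closed_csubspaceD(2)[OF M] by auto
  have bdd: "bdd_below ((\<lambda>y. (norm (x - y))\<^sup>2) ` M)" by (rule bdd_belowI[of _ 0]) auto
  have D: "?D \<le> (norm (x - y))\<^sup>2" if "y \<in> M" for y
    using cINF_lower[OF bdd that] .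
  have "\<exists>y\<in>M. (norm (x - y))\<^sup>2 < ?D + inverse (real (Suc n))" for n
    using cINF_less_iff[OF ne bdd, of "?D + inverse (real (Suc n))"] by auto
  then obtain y where y: "\<And>n. y n \<in> M" "\<And>n. (norm (x - y n))\<^sup>2 < ?D + inverse (real (Suc n))"
    by metis
  \<comment> \<open>Parallelogram law: the midpoint of \<open>u\<close> and \<open>v\<close> lies in
    \<open>M\<close>, so its squared distance to \<open>x\<close> is at least
    \<open>?D\<close>.\<close>
  have par: "(norm (u - v))\<^sup>2 + 4 * ?D \<le> 2 * (norm (x - u))\<^sup>2 + 2 * (norm (x - v))\<^sup>2"
    if "u \<in> M" "v \<in> M" for u v
  proof -
    have "?D \<le> (norm (x - (1/2) *\<^sub>R (u + v)))\<^sup>2"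
      using that M by (intro D closed_csubspaceD)
    moreover have "(norm (u - v))\<^sup>2 + 4 * (norm (x - (1/2) *\<^sub>R (u + v)))\<^sup>2
        = 2 * (norm (x - u))\<^sup>2 + 2 * (norm (x - v))\<^sup>2"
      by (simp add: power2_norm_eq_inner inner_diff inner_add inner_commute algebra_simps)
    ultimately show ?thesis by linarith
  qed
  have "Cauchy y"
  proof (rule CauchyI)
    fix e :: real assume "e > 0"
    then obtain N where N: "inverse (real (Suc N)) < e\<^sup>2 / 4"
      using reals_Archimedean[of "e\<^sup>2/4"] by auto
    have "norm (y m - y n) < e" if "m \<ge> N" "n \<ge> N" for m n
    proof -
      have "inverse (real (Suc m)) \<le> inverse (real (Suc N))" "inverse (real (Suc n)) \<le> inverse (real (Suc N))"
        using that by (auto intro!: le_imp_inverse_le)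
      then have "(norm (y m - y n))\<^sup>2 < e\<^sup>2"
        using par[OF y(1)[of m] y(1)[of n]] y(2)[of m] y(2)[of n] N by argo
      then show ?thesis using \<open>e > 0\<close> by (simp add: power2_less_imp_less)
    qed
    then show "\<exists>N. \<forall>m\<ge>N. \<forall>n\<ge>N. norm (y m - y n) < e" by blast
  qed
  then obtain z where z: "y \<longlonglongrightarrow> z" using Cauchy_convergent convergent_def by blast
  have zM: "z \<in> M" using closed_sequentially[OF closed_csubspaceD(1)[OF M]] y z by blast
  have "(\<lambda>n. (norm (x - y n))\<^sup>2) \<longlonglongrightarrow> (norm (x - z))\<^sup>2"
    by (intro tendsto_intros z)
  moreover have "(\<lambda>n. ?D + inverse (real (Suc n))) \<longlonglongrightarrow> ?D + 0"
    by (intro tendsto_add tendsto_const LIMSEQ_inverse_real_of_nat)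
  ultimately have "(norm (x - z))\<^sup>2 \<le> ?D + 0"
    by (rule LIMSEQ_le) (use y(2) less_imp_le in blast)
  then have zD: "(norm (x - z))\<^sup>2 \<le> ?D" by simp
  have "inner (x - z) w = 0" if w: "w \<in> M" for w
  proof (cases "w = 0")
    case False
    \<comment> \<open>\<open>z + t *\<^sub>R w\<close> is the point nearest to \<open>x\<close> on
      the real line through \<open>z\<close> in direction \<open>w\<close>.\<close>
    define t where "t = inner (x - z) w / inner w w"
    have "(norm (x - z))\<^sup>2 \<le> (norm (x - (z + t *\<^sub>R w)))\<^sup>2"
      using order_trans[OF zD D[of "z + t *\<^sub>R w"]] zM w closed_csubspaceD[OF M] by blast
    also have "\<dots> = (norm (x - z))\<^sup>2 - 2 * t * inner (x - z) w + t * t * inner w w"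
      by (simp add: power2_norm_eq_inner inner_diff inner_add inner_commute algebra_simps)
    also have "\<dots> = (norm (x - z))\<^sup>2 - (inner (x - z) w)\<^sup>2 / inner w w"
      using False by (simp add: t_def power2_eq_square)
    finally have "(inner (x - z) w)\<^sup>2 / inner w w \<le> 0" by simp
    moreover have "inner w w > 0" using False by simp
    ultimately have "(inner (x - z) w)\<^sup>2 \<le> 0" by (simp add: divide_le_0_iff)
    then show ?thesis by simp
  qed simp
  then show ?thesis using ocompI_inner[OF M] zM by blast
qed

definition cproj :: "'h::complex_hilbert_space set \<Rightarrow> 'h \<Rightarrow>\<^sub>L 'h" where
  "cproj M = Blinfun (\<lambda>x. THE y. y \<in> M \<and> x - y \<in> ocomp M)"

lemma projection_unique:
  assumes M: "closed_csubspace M" and "y \<in> M" "x - y \<in> ocomp M" "z \<in> M" "x - z \<in> ocomp M"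
  shows "y = z"
proof -
  have "(x - z) - (x - y) \<in> ocomp M"
    using assms closed_csubspaceD(7)[OF closed_csubspace_ocomp] by blast
  then have "y - z \<in> ocomp M" by simp
  moreover have "y - z \<in> M" using assms by (simp add: closed_csubspaceD)
  ultimately show ?thesis using ocomp_Int_self by fastforce
qed

lemma
  fixes M :: "'h::complex_hilbert_space set"
  assumes M: "closed_csubspace M"
  shows cproj_in: "cproj M x \<in> M"
    and cproj_diff: "x - cproj M x \<in> ocomp M"
proof -
  let ?p = "\<lambda>x. THE y. y \<in> M \<and> x - y \<in> ocomp M"
  have p: "?p x \<in> M \<and> x - ?p x \<in> ocomp M" for x
  proof (rule theI')
    obtain y where y: "y \<in> M" "x - y \<in> ocomp M" using projection_exists[OF M] by blast
    then show "\<exists>!y. y \<in> M \<and> x - y \<in> ocomp M"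
      by (intro ex1I[of _ y]) (auto intro: projection_unique[OF M])
  qed
  have u: "?p x = y" if "y \<in> M" "x - y \<in> ocomp M" for x y
    using p[of x] that projection_unique[OF M] by blast
  note O = closed_csubspaceD[OF closed_csubspace_ocomp]
  have "bounded_linear ?p"
  proof (rule bounded_linear_intro[where K = 1])
    fix x y :: 'h and r :: real
    have "(x - ?p x) + (y - ?p y) \<in> ocomp M" using p O(3) by blast
    then show "?p (x + y) = ?p x + ?p y"
      using p[of x] p[of y] by (intro u) (auto simp: closed_csubspaceD[OF M] algebra_simps)
    have "r *\<^sub>R (x - ?p x) \<in> ocomp M" using p O(5) by blast
    then show "?p (r *\<^sub>R x) = r *\<^sub>R ?p x"
      using p[of x] by (intro u) (auto simp: closed_csubspaceD[OF M] algebra_simps)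
    have "(norm (?p x + (x - ?p x)))\<^sup>2 = (norm (?p x))\<^sup>2 + (norm (x - ?p x))\<^sup>2"
      using p[of x] by (intro norm_Pythagoras) (auto intro: ocompD')
    then have "(norm (?p x))\<^sup>2 \<le> (norm x)\<^sup>2" by simp
    then show "norm (?p x) \<le> norm x * 1" by simp
  qed
  then have "cproj M x = ?p x" for x by (simp add: cproj_def bounded_linear_Blinfun_apply)
  then show "cproj M x \<in> M" "x - cproj M x \<in> ocomp M" using p[of x] by auto
qed

lemma cproj_eqI:
  assumes "closed_csubspace M" "y \<in> M" "x - y \<in> ocomp M"
  shows "cproj M x = y"
  using projection_unique[OF assms(1) cproj_in cproj_diff] assms by blast

lemma cproj_id: "closed_csubspace M \<Longrightarrow> x \<in> M \<Longrightarrow> cproj M x = x"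
  by (rule cproj_eqI) (auto simp: ocomp_def cinner.zero_left)

lemma cproj_ocomp: "closed_csubspace M \<Longrightarrow> x \<in> ocomp M \<Longrightarrow> cproj M x = 0"
  by (rule cproj_eqI) (auto simp: closed_csubspaceD)

lemma cproj_scaleC:
  assumes M: "closed_csubspace M"
  shows "cproj M (c *\<^sub>C x) = c *\<^sub>C cproj M x"
proof (rule cproj_eqI[OF M])
  have "c *\<^sub>C (x - cproj M x) \<in> ocomp M"
    using cproj_diff[OF M] closed_csubspaceD(4)[OF closed_csubspace_ocomp] by blast
  then show "c *\<^sub>C x - c *\<^sub>C cproj M x \<in> ocomp M"
    by (simp add: complex_vector.scale_right_diff_distrib)
qed (simp add: M cproj_in closed_csubspaceD)

lemma norm_cproj_sq:
  assumes M: "closed_csubspace M"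
  shows "(norm x)\<^sup>2 = (norm (cproj M x))\<^sup>2 + (norm (x - cproj M x))\<^sup>2"
  using norm_Pythagoras[of "cproj M x" "x - cproj M x"] ocompD'[OF cproj_diff cproj_in, OF M M] by simp

lemma norm_cproj_le:
  assumes M: "closed_csubspace M"
  shows "norm (cproj M x) \<le> norm x"
proof -
  have "(norm (cproj M x))\<^sup>2 \<le> (norm x)\<^sup>2" using norm_cproj_sq[OF M, of x] by simp
  then show ?thesis by simp
qed

lemma norm_diff_cproj_le:
  assumes M: "closed_csubspace M" and y: "y \<in> M"
  shows "norm (x - cproj M x) \<le> norm (x - y)"
proof -
  have 1: "cproj M (x - y) = cproj M x - y"
    using cproj_id[OF M y] by (simp add: blinfun.diff_right)
  have "(norm (x - y - cproj M (x - y)))\<^sup>2 \<le> (norm (x - y))\<^sup>2"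
    using norm_cproj_sq[OF M, of "x - y"] by simp
  then show ?thesis by (simp add: 1)
qed

lemma cinner_cproj_left:
  assumes M: "closed_csubspace M" and "y \<in> M"
  shows "cinner (cproj M x) y = cinner x y"
  using ocompD[OF cproj_diff[OF M] assms(2)] by (simp add: cinner.diff_left)

lemma cinner_cproj:
  assumes M: "closed_csubspace M"
  shows "cinner (cproj M x) y = cinner x (cproj M y)"
  using cinner_cproj_left[OF M cproj_in[OF M], of x y]
    ocompD'[OF cproj_diff cproj_in, OF M M, of x y]
  by (simp add: cinner.diff_right)

lemma ocomp_ocomp:
  assumes M: "closed_csubspace M"
  shows "ocomp (ocomp M) = M"
proof
  show "M \<subseteq> ocomp (ocomp M)" using cinner_eq_0_sym by (auto simp: ocomp_def)
  show "ocomp (ocomp M) \<subseteq> M"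
  proof
    fix x assume x: "x \<in> ocomp (ocomp M)"
    have "cproj M x \<in> ocomp (ocomp M)" using cproj_in[OF M] \<open>M \<subseteq> _\<close> by blast
    then have "x - cproj M x \<in> ocomp (ocomp M)"
      using x closed_csubspaceD(7)[OF closed_csubspace_ocomp] by blast
    then have "x - cproj M x = 0" using cproj_diff[OF M] ocomp_Int_self by blast
    then show "x \<in> M" using cproj_in[OF M, of x] by simp
  qed
qed

text \<open>Riesz representation: a nonzero vector orthogonal to the kernel of the functional
  represents it up to a scalar. The vector \<open>w\<close> is the adjoint of \<open>T\<close>
  applied to \<open>y\<close>; with it, orthogonality of \<open>T x\<close> to \<open>y\<close>
  becomes an orthogonality condition on \<open>x\<close>.\<close>

lemma adjoint_vector:
  fixes T :: "'h::complex_hilbert_space \<Rightarrow>\<^sub>L 'h"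
  assumes T: "T \<in> bounded_operators"
  shows "\<exists>w. \<forall>x. cinner (T x) y = cinner x w"
proof -
  let ?f = "\<lambda>x. cinner (T x) y"
  have lin: "?f (u + v) = ?f u + ?f v" "?f (c *\<^sub>C u) = c * ?f u" for u v c
    using T by (auto simp: bounded_operators_iff blinfun.add_right cinner_add_left cinner_scaleC_left)
  let ?K = "{x. ?f x = 0}"
  have K: "closed_csubspace ?K"
  proof (rule closed_csubspaceI)
    show "closed ?K"
      by (intro closed_Collect_eq cinner.continuous_on blinfun.continuous_on continuous_intros)
  qed (auto simp: lin cinner.zero_left)
  show ?thesis
  proof (cases "\<exists>x. ?f x \<noteq> 0")
    case True
    then obtain x0 where x0: "?f x0 \<noteq> 0" by blast
    define u where "u = x0 - cproj ?K x0"
    have "?f (cproj ?K x0) = 0" using cproj_in[OF K, of x0] by simp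
    then have fu: "?f u \<noteq> 0"
      using x0 by (simp add: u_def blinfun.diff_right cinner.diff_left)
    then have uu: "cinner u u \<noteq> 0" by (auto simp: cinner_self_eq_0_iff cinner.zero_left)
    have "?f x = cinner x (cnj (?f u / cinner u u) *\<^sub>C u)" for x
    proof -
      have "x + (- ?f x / ?f u) *\<^sub>C u \<in> ?K" using fu by (simp only: mem_Collect_eq lin) simp
      then have "cinner (x + (- ?f x / ?f u) *\<^sub>C u) u = 0"
        using ocompD'[OF cproj_diff[OF K, of x0]] by (simp add: u_def)
      then show ?thesis using fu uu
        by (simp add: cinner_add_left cinner.diff_left cinner_scaleC_left cinner_scaleC_right field_simps)
    qed
    then show ?thesis by blast
  next
    case False
    then show ?thesis by (intro exI[of _ 0]) (auto simp: cinner.zero_right)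
  qed
qed

section \<open>Complex-linear operators and rank-one operators\<close>

lemma bounded_operators_add: "S \<in> bounded_operators \<Longrightarrow> T \<in> bounded_operators \<Longrightarrow> S + T \<in> bounded_operators"
  and bounded_operators_diff: "S \<in> bounded_operators \<Longrightarrow> T \<in> bounded_operators \<Longrightarrow> S - T \<in> bounded_operators"
  and bounded_operators_comp: "S \<in> bounded_operators \<Longrightarrow> T \<in> bounded_operators \<Longrightarrow> S o\<^sub>L T \<in> bounded_operators"
  by (auto simp: bounded_operators_iff blinfun.add_left blinfun.diff_left scaleC_add_right
      complex_vector.scale_right_diff_distrib)

lemma bounded_operators_cproj: "closed_csubspace M \<Longrightarrow> cproj M \<in> bounded_operators"
  by (simp add: bounded_operators_iff cproj_scaleC)

definition rank_one :: "'h::complex_hilbert_space \<Rightarrow> 'h \<Rightarrow> 'h \<Rightarrow>\<^sub>L 'h" where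
  "rank_one x y = Blinfun (\<lambda>v. cinner v y *\<^sub>C x)"

lemma rank_one_apply [simp]: "rank_one x y v = cinner v y *\<^sub>C x"
proof -
  have "bounded_linear (\<lambda>v. cinner v y *\<^sub>C x)"
  proof (rule bounded_linear_intro[where K = "norm y * norm x"])
    fix v w and r :: real
    show "cinner (v + w) y *\<^sub>C x = cinner v y *\<^sub>C x + cinner w y *\<^sub>C x"
      by (simp add: cinner_add_left scaleC_add_left)
    show "cinner (r *\<^sub>R v) y *\<^sub>C x = r *\<^sub>R cinner v y *\<^sub>C x"
      by (simp add: scaleC_of_real[symmetric] cinner_scaleC_left scaleC_scaleC)
    show "norm (cinner v y *\<^sub>C x) \<le> norm v * (norm y * norm x)"
      using mult_right_mono[OF norm_cinner_le[of v y] norm_ge_zero[of x]]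
      by (simp add: norm_scaleC mult.assoc)
  qed
  then show ?thesis by (simp add: rank_one_def bounded_linear_Blinfun_apply)
qed

lemma bounded_operators_rank_one: "rank_one x y \<in> bounded_operators"
  by (simp add: bounded_operators_iff cinner_scaleC_left scaleC_scaleC)

section \<open>Compact operators\<close>

lemma compact_closure_iff_totally_bounded:
  fixes S :: "'a::complete_space set"
  shows "compact (closure S) \<longleftrightarrow> (\<forall>e>0. \<exists>F. finite F \<and> S \<subseteq> (\<Union>x\<in>F. ball x e))"
proof
  assume "compact (closure S)"
  then show "\<forall>e>0. \<exists>F. finite F \<and> S \<subseteq> (\<Union>x\<in>F. ball x e)"
    unfolding compact_eq_totally_bounded using closure_subset by (meson subset_trans)
next
  assume S: "\<forall>e>0. \<exists>F. finite F \<and> S \<subseteq> (\<Union>x\<in>F. ball x e)"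
  show "compact (closure S)"
    unfolding compact_eq_totally_bounded
  proof (intro conjI allI impI)
    show "complete (closure S)" by (simp add: complete_eq_closed)
    fix e :: real assume e: "e > 0"
    then obtain F where F: "finite F" "S \<subseteq> (\<Union>x\<in>F. ball x (e/2))" using S half_gt_zero by blast
    have "S \<subseteq> (\<Union>x\<in>F. cball x (e/2))" using F(2) ball_subset_cball by blast
    moreover have "closed (\<Union>x\<in>F. cball x (e/2))" using F(1) by (intro closed_UN) auto
    ultimately have "closure S \<subseteq> (\<Union>x\<in>F. cball x (e/2))" by (rule closure_minimal)
    also have "\<dots> \<subseteq> (\<Union>x\<in>F. ball x e)" using e by (intro UN_mono) auto
    finally show "\<exists>F. finite F \<and> closure S \<subseteq> (\<Union>x\<in>F. ball x e)" using F(1) by blast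
  qed
qed

lemma compact_operator_iff_net:
  "compact_operator T \<longleftrightarrow> (\<forall>e>0. \<exists>F. finite F \<and> (\<forall>x. norm x \<le> 1 \<longrightarrow> (\<exists>g\<in>F. norm (T x - g) < e)))"
  unfolding compact_operator_def compact_closure_iff_totally_bounded
  by (simp add: image_subset_iff ball_def dist_norm norm_minus_commute Bex_def cball_def)

lemma compact_operatorI:
  assumes "compact C" "\<And>x. norm x \<le> 1 \<Longrightarrow> blinfun_apply T x \<in> C"
  shows "compact_operator T"
proof -
  have "closure (T ` cball 0 1) \<subseteq> C"
    using assms by (intro closure_minimal compact_imp_closed) auto
  then have "closure (T ` cball 0 1) = C \<inter> closure (T ` cball 0 1)" by blast
  then show ?thesis
    unfolding compact_operator_def using compact_Int_closed[OF assms(1) closed_closure] by metis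
qed

lemma compact_operator_0: "compact_operator 0"
  by (rule compact_operatorI[of "{0}"]) auto

lemma compact_operator_add:
  assumes "compact_operator S" "compact_operator T"
  shows "compact_operator (S + T)"
  unfolding compact_operator_iff_net
proof (intro allI impI)
  fix e :: real assume "e > 0"
  then obtain F G where F: "finite F" "\<And>x. norm x \<le> 1 \<Longrightarrow> \<exists>g\<in>F. norm (S x - g) < e/2"
    and G: "finite G" "\<And>x. norm x \<le> 1 \<Longrightarrow> \<exists>g\<in>G. norm (T x - g) < e/2"
    using assms half_gt_zero unfolding compact_operator_iff_net by metis
  have "\<exists>h\<in>(\<lambda>(f, g). f + g) ` (F \<times> G). norm ((S + T) x - h) < e" if "norm x \<le> 1" for x
  proof -
    obtain f g where fg: "f \<in> F" "norm (S x - f) < e/2" "g \<in> G" "norm (T x - g) < e/2"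
      using F(2) G(2) \<open>norm x \<le> 1\<close> by blast
    have "norm ((S + T) x - (f + g)) \<le> norm (S x - f) + norm (T x - g)"
      using norm_triangle_ineq[of "S x - f" "T x - g"] by (simp add: blinfun.add_left algebra_simps)
    then show ?thesis using fg by (intro bexI[of _ "f + g"]) auto
  qed
  then show "\<exists>H. finite H \<and> (\<forall>x. norm x \<le> 1 \<longrightarrow> (\<exists>h\<in>H. norm ((S + T) x - h) < e))"
    using F(1) G(1) by (intro exI[of _ "(\<lambda>(f, g). f + g) ` (F \<times> G)"]) auto
qed

lemma compact_operator_comp_left:
  assumes "compact_operator T"
  shows "compact_operator (S o\<^sub>L T)"
  unfolding compact_operator_iff_net
proof (intro allI impI)
  fix e :: real assume e: "e > 0"
  have pos: "norm S + 1 > 0" by (simp add: add_nonneg_pos)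
  then have "e / (norm S + 1) > 0" using e by simp
  then obtain F where F: "finite F" "\<And>x. norm x \<le> 1 \<Longrightarrow> \<exists>g\<in>F. norm (T x - g) < e / (norm S + 1)"
    using assms unfolding compact_operator_iff_net by metis
  have "\<exists>h\<in>S ` F. norm ((S o\<^sub>L T) x - h) < e" if x: "norm x \<le> 1" for x
  proof -
    obtain g where g: "g \<in> F" "norm (T x - g) < e / (norm S + 1)" using F(2) x by blast
    have "norm (S (T x - g)) \<le> norm S * norm (T x - g)" by (rule norm_blinfun)
    also have "\<dots> \<le> (norm S + 1) * norm (T x - g)" by (simp add: mult_right_mono)
    also have "\<dots> < e" using g(2) pos by (simp add: field_simps)
    finally show ?thesis using g(1) by (auto simp: blinfun.diff_right intro!: bexI[of _ g])
  qed
  then show "\<exists>H. finite H \<and> (\<forall>x. norm x \<le> 1 \<longrightarrow> (\<exists>h\<in>H. norm ((S o\<^sub>L T) x - h) < e))"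
    using F(1) by (intro exI[of _ "S ` F"]) auto
qed

lemma compact_operator_comp_right:
  assumes "compact_operator T"
  shows "compact_operator (T o\<^sub>L S)"
  unfolding compact_operator_iff_net
proof (intro allI impI)
  fix e :: real assume e: "e > 0"
  define r where "r = norm S + 1"
  have r: "r > 0" by (simp add: r_def add_nonneg_pos)
  then have "e / r > 0" using e by simp
  then obtain F where F: "finite F" "\<And>x. norm x \<le> 1 \<Longrightarrow> \<exists>g\<in>F. norm (T x - g) < e / r"
    using assms unfolding compact_operator_iff_net by metis
  have "\<exists>h\<in>scaleR r ` F. norm ((T o\<^sub>L S) x - h) < e" if x: "norm x \<le> 1" for x
  proof -
    have "norm (S x) \<le> norm S * 1"
      using order_trans[OF norm_blinfun mult_left_mono[OF x norm_ge_zero]] .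
    also have "\<dots> \<le> r" by (simp add: r_def)
    finally have "norm ((1/r) *\<^sub>R S x) \<le> 1" using r by simp
    then obtain g where g: "g \<in> F" "norm (T ((1/r) *\<^sub>R S x) - g) < e / r" using F(2) by blast
    have "(T o\<^sub>L S) x - r *\<^sub>R g = r *\<^sub>R (T ((1/r) *\<^sub>R S x) - g)"
      using r by (simp add: blinfun.scaleR_right scaleR_diff_right)
    then have "norm ((T o\<^sub>L S) x - r *\<^sub>R g) = r * norm (T ((1/r) *\<^sub>R S x) - g)" using r by simp
    also have "\<dots> < e" using g(2) r by (simp add: field_simps)
    finally have "norm ((T o\<^sub>L S) x - r *\<^sub>R g) < e" .
    then show ?thesis using g(1) by auto
  qed
  then show "\<exists>H. finite H \<and> (\<forall>x. norm x \<le> 1 \<longrightarrow> (\<exists>h\<in>H. norm ((T o\<^sub>L S) x - h) < e))"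
    using F(1) by (intro exI[of _ "scaleR r ` F"]) auto
qed

lemma compact_operator_diff:
  assumes "compact_operator S" "compact_operator T"
  shows "compact_operator (S - T)"
proof -
  have "S - T = S + (- id_blinfun o\<^sub>L T)"
    by (rule blinfun_eqI) (simp add: blinfun.add_left blinfun.diff_left blinfun.minus_left)
  then show ?thesis by (simp only: compact_operator_add compact_operator_comp_left assms)
qed

lemma closed_compact_operators: "closed {T. compact_operator T}"
  unfolding closed_sequential_limits
proof (intro allI impI, elim conjE, simp)
  fix X :: "nat \<Rightarrow> 'a \<Rightarrow>\<^sub>L 'a" and T assume X: "\<forall>n. compact_operator (X n)" "X \<longlonglongrightarrow> T"
  show "compact_operator T"
    unfolding compact_operator_iff_net
  proof (intro allI impI)
    fix e :: real assume "e > 0"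
    then have e: "e/2 > 0" by simp
    obtain n where n: "norm (X n - T) < e/2"
      using LIMSEQ_D[OF X(2) e] by blast
    obtain F where F: "finite F" "\<And>x. norm x \<le> 1 \<Longrightarrow> \<exists>g\<in>F. norm (X n x - g) < e/2"
      using X(1) e unfolding compact_operator_iff_net by metis
    have "\<exists>g\<in>F. norm (T x - g) < e" if x: "norm x \<le> 1" for x
    proof -
      obtain g where g: "g \<in> F" "norm (X n x - g) < e/2" using F(2) x by blast
      have "norm ((X n - T) x) \<le> norm (X n - T) * 1"
        using order_trans[OF norm_blinfun mult_left_mono[OF x norm_ge_zero]] .
      then have "norm (X n x - T x) < e/2" using n by (simp add: blinfun.diff_left)
      then have "norm (T x - g) < e"
        using g(2) norm_triangle_ineq4[of "X n x - g" "X n x - T x"] by simp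
      then show ?thesis using g(1) by blast
    qed
    then show "\<exists>F. finite F \<and> (\<forall>x. norm x \<le> 1 \<longrightarrow> (\<exists>g\<in>F. norm (T x - g) < e))"
      using F(1) by blast
  qed
qed

lemma compact_operator_rank_one: "compact_operator (rank_one x y)"
proof (rule compact_operatorI)
  have "bounded_linear (\<lambda>z. z *\<^sub>C x)"
  proof (rule bounded_linear_intro[where K = "norm x"])
    show "(r *\<^sub>R z) *\<^sub>C x = r *\<^sub>R z *\<^sub>C x" for r z
      unfolding scaleR_conv_of_real[of r z] by (metis scaleC_scaleC scaleC_of_real)
  qed (auto simp: scaleC_add_left norm_scaleC)
  then show "compact ((\<lambda>z. z *\<^sub>C x) ` cball 0 (norm y))"
    by (intro compact_continuous_image bounded_linear.continuous_on[OF _ continuous_on_id]) auto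
  show "rank_one x y v \<in> (\<lambda>z. z *\<^sub>C x) ` cball 0 (norm y)" if "norm v \<le> 1" for v
    using order_trans[OF norm_cinner_le[of v y] mult_right_mono[OF that norm_ge_zero[of y]]]
    by (intro image_eqI[of _ _ "cinner v y"]) auto
qed

lemma norm_blinfun_bound_unit:
  assumes "0 \<le> b" "\<And>x. norm x \<le> 1 \<Longrightarrow> norm (blinfun_apply T x) \<le> b"
  shows "norm T \<le> b"
proof (rule norm_blinfun_bound[OF assms(1)])
  fix x
  show "norm (T x) \<le> b * norm x"
  proof (cases "x = 0")
    case False
    then have "norm (T ((1 / norm x) *\<^sub>R x)) \<le> b" by (intro assms(2)) auto
    then show ?thesis using False by (simp add: blinfun.scaleR_right field_simps)
  qed simp
qed

text \<open>Up to a small error \<open>k x k\<close> is determined by a finite table: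
  \<open>F\<close> is a net for the image of the unit ball under \<open>k\<close>, and for each
  \<open>g\<close> in \<open>F\<close> one records a point of a second finite net near
  \<open>k (x g)\<close>. There are finitely many tables, and operators with the same table have
  close images.\<close>

lemma compact_multiplication:
  fixes k :: "'h::complex_hilbert_space \<Rightarrow>\<^sub>L 'h"
  assumes k: "compact_operator k"
  shows "compact (closure ((\<lambda>x. k o\<^sub>L x o\<^sub>L k) ` cball 0 r))"
  unfolding compact_closure_iff_totally_bounded
proof (intro allI impI)
  fix e :: real assume e: "e > 0"
  define R where "R = \<bar>r\<bar> + 1"
  have R: "R > 0" by (simp add: R_def)
  \<comment> \<open>Chosen so that the final error bound \<open>2 * d * (norm k * R + 1)\<close>
    equals \<open>e / 2\<close>.\<close>
  define d where "d = e / (4 * (norm k * R + 1))"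
  have pos: "norm k * R + 1 > 0" using R by (simp add: add_nonneg_pos)
  have d: "d > 0" using e pos by (simp add: d_def)
  obtain F where F: "finite F" "\<And>x. norm x \<le> 1 \<Longrightarrow> \<exists>g\<in>F. norm (k x - g) < d"
    using k d unfolding compact_operator_iff_net by metis
  define m where "m = Max (insert 0 (norm ` F))"
  have m: "norm g \<le> m" if "g \<in> F" for g using F(1) that by (simp add: m_def)
  have "0 \<le> m" using F(1) by (simp add: m_def)
  \<comment> \<open>\<open>s\<close> bounds the norm of every \<open>x g\<close>, so the second net
    has to cover the image of the ball of radius \<open>s\<close>.\<close>
  define s where "s = R * (1 + m)"
  have s: "s > 0" using R \<open>0 \<le> m\<close> by (simp add: s_def)
  have "compact_operator (k o\<^sub>L s *\<^sub>R id_blinfun)"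
    using k by (rule compact_operator_comp_right)
  then obtain G where G: "finite G"
    "\<And>x. norm x \<le> 1 \<Longrightarrow> \<exists>g\<in>G. norm ((k o\<^sub>L s *\<^sub>R id_blinfun) x - g) < d"
    using d unfolding compact_operator_iff_net by metis
  have net: "\<exists>h\<in>G. norm (k (x g) - h) < d" if "norm x \<le> R" "g \<in> F" for g and x :: "'h \<Rightarrow>\<^sub>L 'h"
  proof -
    have "norm (x g) \<le> s"
      using that m[OF that(2)] \<open>0 \<le> m\<close> R unfolding s_def
      by (intro order_trans[OF norm_blinfun] mult_mono) auto
    then have "norm ((1 / s) *\<^sub>R x g) \<le> 1" using s by simp
    then obtain h where h: "h \<in> G" "norm ((k o\<^sub>L s *\<^sub>R id_blinfun) ((1 / s) *\<^sub>R x g) - h) < d"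
      using G(2) by blast
    have "(k o\<^sub>L s *\<^sub>R id_blinfun) ((1 / s) *\<^sub>R x g) = k (x g)"
      using s by (simp add: blinfun.scaleR_left blinfun.scaleR_right)
    then show ?thesis using h by auto
  qed
  define \<phi> where "\<phi> x = restrict (\<lambda>g. SOME h. h \<in> G \<and> norm (k (x g) - h) < d) F" for x :: "'h \<Rightarrow>\<^sub>L 'h"
  have \<phi>: "\<phi> x g \<in> G \<and> norm (k (x g) - \<phi> x g) < d" if "norm x \<le> R" "g \<in> F" for x g
    using someI_ex[of "\<lambda>h. h \<in> G \<and> norm (k (x g) - h) < d"] net[OF that] that(2)
    by (auto simp: \<phi>_def)
  have "\<phi> ` cball 0 R \<subseteq> F \<rightarrow>\<^sub>E G"
  proof (intro image_subsetI PiE_I)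
    show "\<phi> x g \<in> G" if "x \<in> cball 0 R" "g \<in> F" for x g using \<phi> that by auto
    show "\<phi> x g = undefined" if "g \<notin> F" for x g using that by (simp add: \<phi>_def)
  qed
  then have "finite (\<phi> ` cball 0 R)"
    using finite_PiE[OF F(1)] G(1) finite_subset by meson
  then obtain X where X: "finite X" "X \<subseteq> cball 0 R" "\<phi> ` cball 0 R = \<phi> ` X"
    by (metis finite_subset_image order_refl)
  have close: "norm ((k o\<^sub>L x o\<^sub>L k) - (k o\<^sub>L x' o\<^sub>L k)) < e"
    if x: "norm x \<le> R" "norm x' \<le> R" and eq: "\<phi> x = \<phi> x'" for x x'
  proof -
    have "norm ((k o\<^sub>L x o\<^sub>L k) - (k o\<^sub>L x' o\<^sub>L k)) \<le> 2 * d * (norm k * R + 1)"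
    proof (rule norm_blinfun_bound_unit)
      show "0 \<le> 2 * d * (norm k * R + 1)" using d pos by simp
      fix v :: 'h assume v: "norm v \<le> 1"
      obtain g where g: "g \<in> F" "norm (k v - g) < d" using F(2) v by blast
      have 1: "norm (k (x g) - k (x' g)) < 2 * d"
        using \<phi>[OF x(1) g(1)] \<phi>[OF x(2) g(1)] eq
          norm_triangle_ineq4[of "k (x g) - \<phi> x g" "k (x' g) - \<phi> x' g"] by simp
      have "norm ((k o\<^sub>L (x - x')) (k v - g)) \<le> norm (k o\<^sub>L (x - x')) * norm (k v - g)"
        by (rule norm_blinfun)
      also have "\<dots> \<le> (norm k * (2 * R)) * d"
        using g(2) x norm_triangle_ineq4[of x x'] R
        by (intro mult_mono order_trans[OF norm_blinfun_compose]) auto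
      finally have 2: "norm (k (x (k v)) - k (x' (k v)) - (k (x g) - k (x' g))) \<le> norm k * (2 * R) * d"
        by (simp add: blinfun.diff_left blinfun.diff_right algebra_simps)
      have "norm (k (x (k v)) - k (x' (k v))) \<le> norm k * (2 * R) * d + 2 * d"
        using 1 2 norm_triangle_ineq[of "k (x (k v)) - k (x' (k v)) - (k (x g) - k (x' g))" "k (x g) - k (x' g)"]
        by simp
      then show "norm (((k o\<^sub>L x o\<^sub>L k) - (k o\<^sub>L x' o\<^sub>L k)) v) \<le> 2 * d * (norm k * R + 1)"
        by (simp add: blinfun.diff_left algebra_simps)
    qed
    also have "2 * (e / (4 * q)) * q = e / 2" if "q > 0" for q using that by simp
    note this[OF pos, folded d_def]
    finally show ?thesis using e by simp
  qed
  show "\<exists>Y. finite Y \<and> (\<lambda>x. k o\<^sub>L x o\<^sub>L k) ` cball 0 r \<subseteq> (\<Union>y\<in>Y. ball y e)"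
  proof (intro exI[of _ "(\<lambda>x. k o\<^sub>L x o\<^sub>L k) ` X"] conjI image_subsetI)
    fix x :: "'h \<Rightarrow>\<^sub>L 'h" assume "x \<in> cball 0 r"
    then have x: "norm x \<le> R" by (simp add: R_def)
    then have "\<phi> x \<in> \<phi> ` cball 0 R" by auto
    then have "\<phi> x \<in> \<phi> ` X" using X(3) by simp
    then obtain x' where x': "x' \<in> X" "\<phi> x = \<phi> x'" by auto
    then have "norm x' \<le> R" using X(2) by auto
    from close[OF this x] x' show "k o\<^sub>L x o\<^sub>L k \<in> (\<Union>y\<in>(\<lambda>x. k o\<^sub>L x o\<^sub>L k) ` X. ball y e)"
      by (auto simp: dist_norm)
  qed (use X(1) in simp)
qed

section \<open>Chains of closed subspaces and orthonormal sequences\<close>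

lemma closed_csubspace_closure:
  assumes S: "csubspace S"
  shows "closed_csubspace (closure S)"
proof (rule closed_csubspaceI)
  show "0 \<in> closure S" using S closure_subset by (auto simp: complex_vector.subspace_def)
  show "x + y \<in> closure S" if xy: "x \<in> closure S" "y \<in> closure S" for x y
  proof -
    obtain a b where "\<forall>n::nat. a n \<in> S" "a \<longlonglongrightarrow> x" "\<forall>n. b n \<in> S" "b \<longlonglongrightarrow> y"
      using xy closure_sequential by metis
    then show ?thesis using S
      by (auto simp: closure_sequential complex_vector.subspace_def
          intro!: exI[of _ "\<lambda>n. a n + b n"] tendsto_add)
  qed
  show "c *\<^sub>C x \<in> closure S" if x: "x \<in> closure S" for c x
  proof -
    obtain a where "\<forall>n::nat. a n \<in> S" "a \<longlonglongrightarrow> x"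
      using x closure_sequential by metis
    then show ?thesis using S
      by (auto simp: closure_sequential complex_vector.subspace_def
          intro!: exI[of _ "\<lambda>n. c *\<^sub>C a n"] bounded_linear.tendsto[OF bounded_linear_scaleC])
  qed
qed simp

lemma cproj_cproj:
  assumes "closed_csubspace M" "closed_csubspace N" "M \<subseteq> N"
  shows "cproj M (cproj N x) = cproj M x"
proof (rule cproj_eqI[OF assms(1)])
  have "x - cproj N x \<in> ocomp M"
    using cproj_diff[OF assms(2)] ocomp_antimono[OF assms(3)] by blast
  then have "(x - cproj M x) - (x - cproj N x) \<in> ocomp M"
    using cproj_diff[OF assms(1)] closed_csubspaceD(7)[OF closed_csubspace_ocomp] by blast
  then show "cproj N x - cproj M x \<in> ocomp M" by simp
qed (simp add: assms cproj_in)

lemma norm_cproj_mono: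
  assumes "closed_csubspace M" "closed_csubspace N" "M \<subseteq> N"
  shows "norm (cproj M x) \<le> norm (cproj N x)"
  using norm_cproj_le[OF assms(1), of "cproj N x"] cproj_cproj[OF assms] by simp

definition subspace_chain :: "'h::complex_hilbert_space set set \<Rightarrow> bool" where
  "subspace_chain \<T> \<longleftrightarrow> \<T> \<noteq> {} \<and> (\<forall>T\<in>\<T>. closed_csubspace T) \<and> (\<forall>S\<in>\<T>. \<forall>T\<in>\<T>. S \<subseteq> T \<or> T \<subseteq> S)"

text \<open>The complements of the chain members form a chain, so their union \<open>?S\<close> is a
  subspace. What is orthogonal to \<open>?S\<close> lies in every member and hence vanishes; thus
  \<open>?S\<close> is dense, and \<open>g\<close> is close to a vector that a single projection
  kills.\<close>

lemma chain_cproj_small: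
  assumes ch: "subspace_chain \<T>" and Int: "\<Inter>\<T> = {0}" and e: "e > 0"
  shows "\<exists>T\<in>\<T>. norm (cproj T g) < e"
proof -
  let ?S = "\<Union>T\<in>\<T>. ocomp T"
  have T: "closed_csubspace T" if "T \<in> \<T>" for T using ch that by (auto simp: subspace_chain_def)
  have tot: "S \<subseteq> T \<or> T \<subseteq> S" if "S \<in> \<T>" "T \<in> \<T>" for S T
    using ch that unfolding subspace_chain_def by blast
  have "csubspace ?S"
    unfolding complex_vector.subspace_def
  proof (intro conjI ballI allI)
    show "0 \<in> ?S" using ch closed_csubspaceD(2)[OF closed_csubspace_ocomp]
      by (fastforce simp: subspace_chain_def)
    show "c *\<^sub>C x \<in> ?S" if "x \<in> ?S" for c x
      using that closed_csubspaceD(4)[OF closed_csubspace_ocomp] by blast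
    fix x y assume "x \<in> ?S" "y \<in> ?S"
    then obtain S T where ST: "S \<in> \<T>" "T \<in> \<T>" "x \<in> ocomp S" "y \<in> ocomp T" by blast
    then have "(x \<in> ocomp S \<and> y \<in> ocomp S) \<or> (x \<in> ocomp T \<and> y \<in> ocomp T)"
      using tot[OF ST(1,2)] ocomp_antimono[of S T] ocomp_antimono[of T S] by blast
    then show "x + y \<in> ?S"
      using closed_csubspaceD(3)[OF closed_csubspace_ocomp] ST by blast
  qed
  then have C: "closed_csubspace (closure ?S)" by (rule closed_csubspace_closure)
  have "g - cproj (closure ?S) g \<in> T" if "T \<in> \<T>" for T
  proof -
    have "ocomp T \<subseteq> closure ?S" using that closure_subset[of ?S] by blast
    then have "g - cproj (closure ?S) g \<in> ocomp (ocomp T)"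
      using cproj_diff[OF C] ocomp_antimono by blast
    then show ?thesis using ocomp_ocomp[OF T[OF that]] by simp
  qed
  then have "g - cproj (closure ?S) g = 0" using Int by blast
  then have "g \<in> closure ?S" using cproj_in[OF C, of g] by simp
  then obtain v where "v \<in> ?S" "dist v g < e" using e closure_approachable by blast
  then obtain T where vT: "T \<in> \<T>" "v \<in> ocomp T" "norm (g - v) < e"
    by (auto simp: dist_norm norm_minus_commute)
  have "norm (cproj T g) = norm (cproj T (g - v))"
    using cproj_ocomp[OF T] vT by (simp add: blinfun.diff_right)
  also have "\<dots> < e" using norm_cproj_le[OF T[OF vT(1)], of "g - v"] vT(3) by linarith
  finally show ?thesis using vT(1) by blast
qed

lemma norm_apply_le_of_unit:
  assumes "\<And>x. norm x \<le> 1 \<Longrightarrow> norm (blinfun_apply T x) \<le> b"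
  shows "norm (blinfun_apply T x) \<le> b * norm x"
proof -
  have "0 \<le> b" using assms[of 0] by simp
  then have "norm T \<le> b" using assms by (intro norm_blinfun_bound_unit) auto
  then show ?thesis using norm_blinfun[of T x] by (meson mult_right_mono norm_ge_zero order_trans)
qed

text \<open>A finite net for the image of the unit ball leaves only finitely many vectors to make
  small. One member serves them all, because the projections shrink norms further as one descends
  the chain.\<close>

lemma chain_compact_small:
  assumes ch: "subspace_chain \<T>" and Int: "\<Inter>\<T> = {0}" and e: "e > 0" and k: "compact_operator k"
  shows "\<exists>T\<in>\<T>. \<forall>x. norm (cproj T (k x)) \<le> e * norm x"
proof -
  have T: "closed_csubspace T" if "T \<in> \<T>" for T using ch that by (auto simp: subspace_chain_def)
  obtain F where F: "finite F" "\<And>x. norm x \<le> 1 \<Longrightarrow> \<exists>g\<in>F. norm (k x - g) < e/2"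
    using k e half_gt_zero unfolding compact_operator_iff_net by metis
  have "\<exists>T\<in>\<T>. \<forall>g\<in>F. norm (cproj T g) < e/2" using F(1)
  proof induction
    case empty
    then show ?case using ch by (auto simp: subspace_chain_def)
  next
    case (insert g F)
    then obtain S where S: "S \<in> \<T>" "\<forall>g\<in>F. norm (cproj S g) < e/2" by blast
    obtain S' where S': "S' \<in> \<T>" "norm (cproj S' g) < e/2"
      using chain_cproj_small[OF ch Int] e half_gt_zero by blast
    consider "S \<subseteq> S'" | "S' \<subseteq> S" using ch S(1) S'(1) unfolding subspace_chain_def by blast
    then show ?case
    proof cases
      case 1
      then have "norm (cproj S g) < e/2"
        using norm_cproj_mono[OF T T, of S S' g] S(1) S' by simp
      then show ?thesis using S by blast
    next
      case 2
      then have "norm (cproj S' h) < e/2" if "h \<in> F" for h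
        using norm_cproj_mono[OF T T, of S' S h] S S'(1) that by fastforce
      then show ?thesis using S' by blast
    qed
  qed
  then obtain S where S: "S \<in> \<T>" "\<forall>g\<in>F. norm (cproj S g) < e/2" by blast
  have "norm ((cproj S o\<^sub>L k) x) \<le> e * norm x" for x
  proof (rule norm_apply_le_of_unit)
    fix x :: 'a assume "norm x \<le> 1"
    then obtain g where g: "g \<in> F" "norm (k x - g) < e/2" using F(2) by blast
    have "norm (cproj S (k x - g)) < e/2"
      using norm_cproj_le[OF T[OF S(1)], of "k x - g"] g(2) by simp
    then have "norm (cproj S (k x - g) + cproj S g) < e/2 + e/2"
      using S(2) g(1) by (intro norm_triangle_lt) fastforce
    then show "norm ((cproj S o\<^sub>L k) x) \<le> e" by (simp add: blinfun.diff_right)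
  qed
  then show ?thesis using S(1) by auto
qed

text \<open>One extra orthogonality condition removes at most one dimension from \<open>V\<close>,
  namely the line through the projection of \<open>g\<close>.\<close>

lemma cproj_minus_cproj_Int_ocomp:
  assumes V: "closed_csubspace V"
  shows "\<exists>h. cproj V - cproj (V \<inter> ocomp {g}) = rank_one h h"
proof -
  have F: "closed_csubspace (V \<inter> ocomp {g})"
    by (intro closed_csubspace_Int V closed_csubspace_ocomp)
  define g' where "g' = cproj V g"
  have g': "g' \<in> V" by (simp add: g'_def cproj_in[OF V])
  have g'2: "cinner x g = cinner x g'" if "x \<in> V" for x
    using cinner_cproj[OF V, of x g] cproj_id[OF V that] by (simp add: g'_def)
  define h where "h = (1 / norm g') *\<^sub>R g'"
  have h: "h \<in> V" using g' V by (simp add: h_def closed_csubspaceD)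
  have "cproj (V \<inter> ocomp {g}) x = cproj V x - cinner x h *\<^sub>C h" for x
  proof (rule cproj_eqI[OF F])
    have "cinner (cproj V x - cinner x h *\<^sub>C h) g = cinner (cproj V x) g' - cinner x h * cinner h g'"
      using g'2[OF cproj_in[OF V]] g'2[OF h] by (simp add: cinner.diff_left cinner_scaleC_left)
    also have "cinner (cproj V x) g' = cinner x g'" by (rule cinner_cproj_left[OF V g'])
    also have "cinner x g' - cinner x h * cinner h g' = 0"
      by (cases "g' = 0")
        (simp_all add: cinner.zero_right h_def cinner.scaleR_left cinner.scaleR_right cinner_self
          power2_eq_square scaleR_conv_of_real field_simps)
    finally show "cproj V x - cinner x h *\<^sub>C h \<in> V \<inter> ocomp {g}"
      using V h by (simp add: ocomp_def cproj_in closed_csubspaceD)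
    have "h \<in> ocomp (V \<inter> ocomp {g})"
      unfolding ocomp_def h_def
    proof (intro CollectI ballI)
      fix z assume "z \<in> V \<inter> {x. \<forall>g\<in>{g}. cinner x g = 0}"
      then have "cinner z g' = 0" using g'2[of z] by simp
      then have "cinner g' z = 0" using cinner_eq_0_sym by blast
      then show "cinner ((1 / norm g') *\<^sub>R g') z = 0" by (simp add: cinner.scaleR_left)
    qed
    moreover have "x - cproj V x \<in> ocomp (V \<inter> ocomp {g})"
      using cproj_diff[OF V] ocomp_antimono[of "V \<inter> ocomp {g}" V] by blast
    ultimately have "(x - cproj V x) + cinner x h *\<^sub>C h \<in> ocomp (V \<inter> ocomp {g})"
      using closed_csubspaceD(3,4)[OF closed_csubspace_ocomp] by blast
    then show "x - (cproj V x - cinner x h *\<^sub>C h) \<in> ocomp (V \<inter> ocomp {g})"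
      by (simp add: algebra_simps)
  qed
  then have "cproj V - cproj (V \<inter> ocomp {g}) = rank_one h h"
    by (intro blinfun_eqI) (simp add: blinfun.diff_left)
  then show ?thesis by blast
qed

lemma compact_cproj_minus_cproj_Int_ocomp:
  assumes "finite G" and V: "closed_csubspace V"
  shows "compact_operator (cproj V - cproj (V \<inter> ocomp G))"
  using assms(1)
proof induction
  case empty
  then show ?case by (simp add: compact_operator_0)
next
  case (insert g G)
  let ?W = "V \<inter> ocomp G"
  have "closed_csubspace ?W" by (intro closed_csubspace_Int V closed_csubspace_ocomp)
  then obtain h where h: "cproj ?W - cproj (?W \<inter> ocomp {g}) = rank_one h h"
    using cproj_minus_cproj_Int_ocomp by blast
  have "?W \<inter> ocomp {g} = V \<inter> ocomp (insert g G)" by (auto simp: ocomp_insert[of g G])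
  then have "cproj V - cproj (V \<inter> ocomp (insert g G)) = (cproj V - cproj ?W) + rank_one h h"
    by (simp add: h[symmetric])
  then show ?case
    by (simp only: compact_operator_add[OF insert.IH compact_operator_rank_one])
qed

text \<open>The price of avoiding finitely many vectors: restricting a compression to their
  orthogonal complement changes it by a compact operator only. All selections of orthonormal
  sequences rest on this.\<close>

lemma compact_compression_diff:
  assumes "finite G" and V: "closed_csubspace V"
  defines "F \<equiv> V \<inter> ocomp G"
  shows "compact_operator ((cproj V o\<^sub>L b o\<^sub>L cproj V) - (cproj F o\<^sub>L b o\<^sub>L cproj F))"
proof -
  have "(cproj V o\<^sub>L b o\<^sub>L cproj V) - (cproj F o\<^sub>L b o\<^sub>L cproj F)
      = ((cproj V - cproj F) o\<^sub>L (b o\<^sub>L cproj V)) + ((cproj F o\<^sub>L b) o\<^sub>L (cproj V - cproj F))"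
    by (rule blinfun_eqI) (simp add: blinfun.add_left blinfun.diff_left blinfun.diff_right)
  moreover have "compact_operator (cproj V - cproj F)"
    unfolding F_def by (rule compact_cproj_minus_cproj_Int_ocomp[OF assms(1,2)])
  ultimately show ?thesis
    by (simp only: compact_operator_add compact_operator_comp_left compact_operator_comp_right)
qed

text \<open>Induction over the conditions. If some \<open>d0\<close> in the current subspace has
  product 1 with \<open>g\<close>, an approximant \<open>d\<close> of \<open>x\<close> is corrected
  by \<open>cinner d g *\<^sub>C d0\<close>; this is small because
  \<open>cinner d g = cinner (d - x) g\<close>. If there is no such \<open>d0\<close>, the new
  condition already holds throughout.\<close>

lemma dense_Int_ocomp:
  assumes "finite G" and D: "csubspace D"
    and dense: "\<And>x e. x \<in> V \<Longrightarrow> e > 0 \<Longrightarrow> \<exists>d\<in>D. norm (x - d) < e"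
    and "x \<in> V \<inter> ocomp G" "e > 0"
  shows "\<exists>d\<in>D \<inter> ocomp G. norm (x - d) < e"
  using assms(1,4,5)
proof (induction arbitrary: x e)
  case empty
  then show ?case using dense by auto
next
  case (insert g G)
  let ?D = "D \<inter> ocomp G"
  have D': "x + y \<in> ?D" "c *\<^sub>C x \<in> ?D" "x - y \<in> ?D" if "x \<in> ?D" "y \<in> ?D" for x y c
    using that D closed_csubspaceD(3,4,7)[OF closed_csubspace_ocomp]
    by (auto simp: complex_vector.subspace_def complex_vector.subspace_diff)
  have x: "x \<in> V \<inter> ocomp G" "cinner x g = 0"
    using insert.prems by (auto simp: ocomp_insert[of g G] ocomp_def)
  show ?case
  proof (cases "\<forall>d\<in>?D. cinner d g = 0")
    case True
    then show ?thesis using insert.IH[OF x(1) \<open>e > 0\<close>]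
      by (auto simp: ocomp_insert[of g G] ocomp_def)
  next
    case False
    then obtain d1 where d1: "d1 \<in> ?D" "cinner d1 g \<noteq> 0" by blast
    define d0 where "d0 = (1 / cinner d1 g) *\<^sub>C d1"
    have d0: "d0 \<in> ?D" "cinner d0 g = 1" using d1 D'(2)[OF d1(1) d1(1)]
      by (auto simp: d0_def cinner_scaleC_left)
    define q where "q = 1 + norm g * norm d0"
    have q: "q > 0" by (simp add: q_def add_pos_nonneg)
    then obtain d where d: "d \<in> ?D" "norm (x - d) < e / q"
      using insert.IH[OF x(1), of "e / q"] insert.prems by auto
    have "norm (x - (d - cinner d g *\<^sub>C d0)) = norm ((x - d) - cinner (x - d) g *\<^sub>C d0)"
      by (simp add: cinner.diff_left x(2) complex_vector.scale_minus_left algebra_simps)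
    also have "\<dots> \<le> norm (x - d) + (norm (x - d) * norm g) * norm d0"
      by (rule order_trans[OF norm_triangle_ineq4])
        (auto simp: norm_scaleC intro!: mult_right_mono norm_cinner_le)
    also have "\<dots> = norm (x - d) * q" by (simp add: q_def algebra_simps)
    also have "\<dots> < e" using d(2) q by (simp add: field_simps)
    finally have "norm (x - (d - cinner d g *\<^sub>C d0)) < e" .
    moreover have "d - cinner d g *\<^sub>C d0 \<in> ?D" using d(1) d0(1) D' by blast
    moreover have "cinner (d - cinner d g *\<^sub>C d0) g = 0"
      by (simp add: cinner.diff_left cinner_scaleC_left d0)
    ultimately show ?thesis by (auto simp: ocomp_insert[of g G] ocomp_def)
  qed
qed

text \<open>Suppose \<open>a\<close> stays below \<open>\<eta>\<close> on every
  \<open>T \<inter> ocomp T' \<inter> ocomp G\<close>. By density it is then bounded by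
  \<open>\<eta>\<close> on \<open>T \<inter> ocomp G\<close>, and the compression to
  \<open>T\<close> differs from that by a compact operator, whose norm drops below
  \<open>(\<epsilon> - \<eta>) / 2\<close> further down the chain. There the total bound is
  \<open>(\<epsilon> + \<eta>) / 2\<close>, against the lower bound
  \<open>\<epsilon>\<close>.\<close>

lemma chain_select:
  assumes ch: "subspace_chain \<T>" and Int: "\<Inter>\<T> = {0}"
    and big: "\<And>T. T \<in> \<T> \<Longrightarrow> \<exists>x\<in>T. \<exists>y\<in>T. cmod (cinner (blinfun_apply a x) y) > \<epsilon> * norm x * norm y"
    and \<eta>: "0 \<le> \<eta>" "\<eta> < \<epsilon>" and T: "T \<in> \<T>" and G: "finite G"
  shows "\<exists>T'\<in>\<T>. T' \<subseteq> T \<and> (\<exists>x\<in>T \<inter> ocomp T' \<inter> ocomp G. \<exists>y\<in>T \<inter> ocomp T' \<inter> ocomp G.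
    norm x = 1 \<and> norm y = 1 \<and> cmod (cinner (a x) y) \<ge> \<eta>)"
proof (rule ccontr)
  assume neg: "\<not> ?thesis"
  have neg': "cmod (cinner (a u) v) < \<eta>"
    if "T' \<in> \<T>" "T' \<subseteq> T" "u \<in> T \<inter> ocomp T' \<inter> ocomp G" "v \<in> T \<inter> ocomp T' \<inter> ocomp G" "norm u = 1" "norm v = 1"
    for T' u v
  proof (rule ccontr)
    assume "\<not> cmod (cinner (a u) v) < \<eta>"
    then have "cmod (cinner (a u) v) \<ge> \<eta>" by simp
    then show False using neg that by blast
  qed
  have cl: "closed_csubspace T" if "T \<in> \<T>" for T using ch that by (auto simp: subspace_chain_def)
  have tot: "S \<subseteq> S' \<or> S' \<subseteq> S" if "S \<in> \<T>" "S' \<in> \<T>" for S S'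
    using ch that unfolding subspace_chain_def by blast
  have W: "closed_csubspace (T \<inter> ocomp S)" for S
    by (intro closed_csubspace_Int cl T closed_csubspace_ocomp)
  \<comment> \<open>A union of nested subspaces, dense in \<open>T\<close> because the projections
    of a fixed vector onto members of the chain become small.\<close>
  define D where "D = (\<Union>T'\<in>{S\<in>\<T>. S \<subseteq> T}. T \<inter> ocomp T')"
  have join: "\<exists>T'\<in>\<T>. T' \<subseteq> T \<and> x \<in> T \<inter> ocomp T' \<and> y \<in> T \<inter> ocomp T'" if xy: "x \<in> D" "y \<in> D" for x y
  proof -
    obtain S S' where S: "S \<in> \<T>" "S \<subseteq> T" "x \<in> T \<inter> ocomp S" "S' \<in> \<T>" "S' \<subseteq> T" "y \<in> T \<inter> ocomp S'"
      using xy by (auto simp: D_def)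
    then show ?thesis using tot[OF S(1,4)] ocomp_antimono by blast
  qed
  have D: "csubspace D"
    unfolding complex_vector.subspace_def
  proof (intro conjI ballI allI)
    show "0 \<in> D" using T closed_csubspaceD(2)[OF W] by (auto simp: D_def)
    show "c *\<^sub>C x \<in> D" if "x \<in> D" for c x
      using that closed_csubspaceD(4)[OF W] by (auto simp: D_def)
    show "x + y \<in> D" if "x \<in> D" "y \<in> D" for x y
      using join[OF that] closed_csubspaceD(3)[OF W] unfolding D_def by blast
  qed
  have dense: "\<exists>d\<in>D. norm (x - d) < e" if x: "x \<in> T" and e: "e > 0" for x e
  proof -
    obtain S where S: "S \<in> \<T>" "norm (cproj S x) < e" using chain_cproj_small[OF ch Int e] by blast
    show ?thesis
    proof (cases "S \<subseteq> T")
      case True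
      have "x - cproj S x \<in> D"
        using S(1) True x cproj_in[OF cl[OF S(1)], of x] cproj_diff[OF cl[OF S(1)]] closed_csubspaceD(7)[OF cl[OF T]]
        by (auto simp: D_def)
      then show ?thesis using S(2) by (intro bexI[of _ "x - cproj S x"]) auto
    next
      case False
      then have "cproj S x = x" using tot[OF S(1) T] x by (intro cproj_id cl S) auto
      then show ?thesis using S(2) complex_vector.subspace_0[OF D] by (intro bexI[of _ 0]) auto
    qed
  qed
  have bd: "cmod (cinner (a x) y) \<le> \<eta> * norm x * norm y" if x: "x \<in> D \<inter> ocomp G" and y: "y \<in> D \<inter> ocomp G" for x y
  proof (cases "x = 0 \<or> y = 0")
    case True
    then show ?thesis by (auto simp: cinner.zero_left cinner.zero_right)
  next
    case False
    obtain T' where T': "T' \<in> \<T>" "T' \<subseteq> T" "x \<in> T \<inter> ocomp T'" "y \<in> T \<inter> ocomp T'"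
      using join x y by blast
    define u where "u = (1 / norm x) *\<^sub>R x"
    define v where "v = (1 / norm y) *\<^sub>R y"
    have "u \<in> T \<inter> ocomp T' \<inter> ocomp G" "v \<in> T \<inter> ocomp T' \<inter> ocomp G" "norm u = 1" "norm v = 1"
      using T' x y closed_csubspaceD(5)[OF W] closed_csubspaceD(5)[OF closed_csubspace_ocomp] False
      unfolding u_def v_def by auto
    then have "cmod (cinner (a u) v) < \<eta>" using neg' T'(1,2) by blast
    then show ?thesis using False
      by (simp add: u_def v_def blinfun.scaleR_right cinner.scaleR_left cinner.scaleR_right field_simps)
  qed
  let ?F = "T \<inter> ocomp G"
  have F: "closed_csubspace ?F" by (rule W)
  have bdF: "cmod (cinner (a x) y) \<le> \<eta> * norm x * norm y" if x: "x \<in> ?F" and y: "y \<in> ?F" for x y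
  proof -
    have "\<exists>d\<in>D \<inter> ocomp G. norm (x - d) < inverse (real (Suc n))" for n
      by (rule dense_Int_ocomp[OF G D dense x]) auto
    then obtain p where p: "\<And>n. p n \<in> D \<inter> ocomp G" "\<And>n. norm (x - p n) < inverse (real (Suc n))" by metis
    have "\<exists>d\<in>D \<inter> ocomp G. norm (y - d) < inverse (real (Suc n))" for n
      by (rule dense_Int_ocomp[OF G D dense y]) auto
    then obtain q where q: "\<And>n. q n \<in> D \<inter> ocomp G" "\<And>n. norm (y - q n) < inverse (real (Suc n))" by metis
    have lim: "r \<longlonglongrightarrow> z" if "\<And>n. norm (z - r n) < inverse (real (Suc n))" for r and z :: 'a
    proof (rule LIM_zero_cancel, rule Lim_null_comparison[OF _ LIMSEQ_inverse_real_of_nat])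
      show "\<forall>\<^sub>F n in sequentially. norm (r n - z) \<le> inverse (real (Suc n))"
        using that by (auto simp: norm_minus_commute intro!: always_eventually less_imp_le)
    qed
    have "(\<lambda>n. cmod (cinner (a (p n)) (q n))) \<longlonglongrightarrow> cmod (cinner (a x) y)"
      by (intro tendsto_norm cinner.tendsto blinfun.tendsto tendsto_const lim p q)
    moreover have "(\<lambda>n. \<eta> * norm (p n) * norm (q n)) \<longlonglongrightarrow> \<eta> * norm x * norm y"
      by (intro tendsto_intros lim p q)
    ultimately show ?thesis by (rule LIMSEQ_le) (use bd[OF p(1) q(1)] in blast)
  qed
  let ?f = "(cproj T o\<^sub>L a o\<^sub>L cproj T) - (cproj ?F o\<^sub>L a o\<^sub>L cproj ?F)"
  have "compact_operator ?f" by (rule compact_compression_diff[OF G cl[OF T]])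
  moreover have "(\<epsilon> - \<eta>) / 2 > 0" using \<eta> by simp
  ultimately obtain S0 where S0: "S0 \<in> \<T>" "\<forall>x. norm (cproj S0 (?f x)) \<le> (\<epsilon> - \<eta>) / 2 * norm x"
    using chain_compact_small[OF ch Int] by blast
  \<comment> \<open>The smaller of the two: the compact part is small on \<open>S\<close>, and
    vectors of \<open>S\<close> lie in \<open>T\<close>, where the comparison of compressions
    applies.\<close>
  define S where "S = (if S0 \<subseteq> T then S0 else T)"
  have S: "S \<in> \<T>" "S \<subseteq> T" "S \<subseteq> S0" using S0(1) T tot[OF S0(1) T] by (auto simp: S_def)
  obtain x y where xy: "x \<in> S" "y \<in> S" "cmod (cinner (a x) y) > \<epsilon> * norm x * norm y"
    using big[OF S(1)] by blast
  have xT: "x \<in> T" "y \<in> T" "y \<in> S0" using xy S by auto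
  have "cinner (a x) y = cinner (cproj T (a (cproj T x))) y"
    using cinner_cproj_left[OF cl[OF T] xT(2)] cproj_id[OF cl[OF T] xT(1)] by simp
  also have "\<dots> = cinner (?f x) y + cinner (cproj ?F (a (cproj ?F x))) y"
    by (simp add: blinfun.diff_left cinner.diff_left)
  also have "cinner (?f x) y = cinner (cproj S0 (?f x)) y"
    by (rule cinner_cproj_left[OF cl[OF S0(1)] xT(3), symmetric])
  also have "cinner (cproj ?F (a (cproj ?F x))) y = cinner (a (cproj ?F x)) (cproj ?F y)"
    by (rule cinner_cproj[OF F])
  finally have "cmod (cinner (a x) y)
      \<le> cmod (cinner (cproj S0 (?f x)) y) + cmod (cinner (a (cproj ?F x)) (cproj ?F y))"
    using norm_triangle_ineq by metis
  also have "\<dots> \<le> ((\<epsilon> - \<eta>) / 2 * norm x) * norm y + \<eta> * norm x * norm y"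
  proof (rule add_mono)
    show "cmod (cinner (cproj S0 (?f x)) y) \<le> ((\<epsilon> - \<eta>) / 2 * norm x) * norm y"
      using S0(2) by (intro order_trans[OF norm_cinner_le] mult_right_mono) auto
    have "cmod (cinner (a (cproj ?F x)) (cproj ?F y)) \<le> \<eta> * norm (cproj ?F x) * norm (cproj ?F y)"
      by (intro bdF cproj_in F)
    also have "\<dots> \<le> \<eta> * norm x * norm y"
      using \<eta>(1) norm_cproj_le[OF F] by (intro mult_mono) auto
    finally show "cmod (cinner (a (cproj ?F x)) (cproj ?F y)) \<le> \<eta> * norm x * norm y" .
  qed
  also have "\<dots> = (\<epsilon> + \<eta>) / 2 * (norm x * norm y)" by (simp add: field_simps)
  also have "\<dots> \<le> \<epsilon> * (norm x * norm y)" using \<eta> by (intro mult_right_mono) auto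
  finally show False using xy(3) by (simp add: mult.assoc)
qed

text \<open>The state carries a finite set \<open>G\<close> with \<open>x\<close>, \<open>y\<close>,
  \<open>a x\<close> and the adjoint image of \<open>y\<close> for every earlier pair. A new pair
  orthogonal to \<open>G\<close> satisfies all off-diagonal relations in both orders. The relation
  \<open>ok\<close> records the position of the pair in the nest; the type \<open>'t\<close> is free
  because an atom offers no chain to descend.\<close>

lemma select_sequence:
  fixes a :: "'h::complex_hilbert_space \<Rightarrow>\<^sub>L 'h" and T0 :: 't
  assumes a: "a \<in> bounded_operators" and T0: "T0 \<in> \<T>"
    and step: "\<And>T G. T \<in> \<T> \<Longrightarrow> finite G \<Longrightarrow> \<exists>T'\<in>\<T>. \<exists>x\<in>ocomp G. \<exists>y\<in>ocomp G.
      norm x = 1 \<and> norm y = 1 \<and> cmod (cinner (a x) y) \<ge> \<eta> \<and> ok T T' x y"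
  obtains T x y where "\<And>n::nat. T n \<in> \<T>" "\<And>n. ok (T n) (T (Suc n)) (x n) (y n)"
    "\<And>n. norm (x n) = 1" "\<And>n. norm (y n) = 1" "\<And>n. cmod (cinner (a (x n)) (y n)) \<ge> \<eta>"
    "\<And>m n. m \<noteq> n \<Longrightarrow> cinner (x m) (x n) = 0" "\<And>m n. m \<noteq> n \<Longrightarrow> cinner (y m) (y n) = 0"
    "\<And>m n. m \<noteq> n \<Longrightarrow> cinner (a (x m)) (y n) = 0"
proof -
  obtain adj where adj: "\<And>u w. cinner (a u) w = cinner u (adj w)"
    using adjoint_vector[OF a] by metis
  let ?Q = "\<lambda>s s'. case (s, s') of ((T, G, _), (T', G', x, y)) \<Rightarrow>
    x \<in> ocomp G \<and> y \<in> ocomp G \<and> norm x = 1 \<and> norm y = 1 \<and> cmod (cinner (a x) y) \<ge> \<eta> \<and> ok T T' x y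
    \<and> G' = G \<union> {x, y, a x, adj y}"
  have "\<exists>f. \<forall>n::nat. (fst (f n) \<in> \<T> \<and> finite (fst (snd (f n)))) \<and> ?Q (f n) (f (Suc n))"
  proof (rule dependent_nat_choice)
    show "\<exists>s. fst s \<in> \<T> \<and> finite (fst (snd s))"
      using T0 by (auto intro!: exI[of _ "(T0, {}, _)"])
    fix s :: "'t \<times> 'h set \<times> 'h \<times> 'h" and n :: nat
    assume "fst s \<in> \<T> \<and> finite (fst (snd s))"
    then obtain T' x y where "T' \<in> \<T>" "x \<in> ocomp (fst (snd s))" "y \<in> ocomp (fst (snd s))"
      "norm x = 1" "norm y = 1" "cmod (cinner (a x) y) \<ge> \<eta>" "ok (fst s) T' x y" "finite (fst (snd s))"
      using step by blast
    then show "\<exists>s'. (fst s' \<in> \<T> \<and> finite (fst (snd s'))) \<and> ?Q s s'"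
      by (intro exI[of _ "(T', fst (snd s) \<union> {x, y, a x, adj y}, x, y)"])
        (auto split: prod.split)
  qed
  then obtain f where f0: "\<forall>n::nat. (fst (f n) \<in> \<T> \<and> finite (fst (snd (f n)))) \<and> ?Q (f n) (f (Suc n))" ..
  have f: "fst (f n) \<in> \<T>" "?Q (f n) (f (Suc n))" for n
    by (rule f0[rule_format, of n, THEN conjunct1, THEN conjunct1], rule f0[rule_format, of n, THEN conjunct2])
  define T where "T n = fst (f n)" for n
  define G where "G n = fst (snd (f n))" for n
  \<comment> \<open>The pair chosen in step \<open>n\<close> is stored in state
    \<open>Suc n\<close>; the vectors in the initial state are arbitrary.\<close>
  define x where "x n = fst (snd (snd (f (Suc n))))" for n
  define y where "y n = snd (snd (snd (f (Suc n))))" for n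
  have q: "x n \<in> ocomp (G n)" "y n \<in> ocomp (G n)" "norm (x n) = 1" "norm (y n) = 1"
    "cmod (cinner (a (x n)) (y n)) \<ge> \<eta>" "ok (T n) (T (Suc n)) (x n) (y n)"
    "G (Suc n) = G n \<union> {x n, y n, a (x n), adj (y n)}" for n
    using f(2)[of n] by (auto simp: T_def G_def x_def y_def split: prod.splits)
  have "G m \<subseteq> G n" if "m \<le> n" for m n
    using that by (rule lift_Suc_mono_le[rotated]) (auto simp: q(7))
  then have later: "{x m, y m, a (x m), adj (y m)} \<subseteq> G n" if "m < n" for m n
    using q(7)[of m] that by (metis Suc_leI Un_subset_iff order_trans sup_ge2)
  have orth: "cinner (x n) (x m) = 0 \<and> cinner (x m) (x n) = 0 \<and> cinner (y n) (y m) = 0 \<and> cinner (y m) (y n) = 0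
      \<and> cinner (a (x n)) (y m) = 0 \<and> cinner (a (x m)) (y n) = 0" if "m < n" for m n
    using later[OF that] ocompD[OF q(1)[of n]] ocompD[OF q(2)[of n]] ocompD'[OF q(1)[of n]] ocompD'[OF q(2)[of n]]
    by (auto simp: adj[of "x n"])
  show ?thesis
  proof (rule that[of T x y])
    show "T n \<in> \<T>" for n using f(1) by (simp add: T_def)
  qed (use q orth in \<open>auto simp: nat_neq_iff\<close>)
qed

section \<open>Bessel inequality and operators given by orthonormal series\<close>

lemma norm_sum_orthogonal:
  fixes t :: "'i \<Rightarrow> 'h::complex_hilbert_space"
  assumes "finite F" "\<And>m n. m \<in> F \<Longrightarrow> n \<in> F \<Longrightarrow> m \<noteq> n \<Longrightarrow> cinner (t m) (t n) = 0"
  shows "(norm (\<Sum>k\<in>F. t k))\<^sup>2 = (\<Sum>k\<in>F. (norm (t k))\<^sup>2)"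
  using assms
proof induction
  case (insert i F)
  have "cinner (t i) (\<Sum>k\<in>F. t k) = 0"
    using insert.hyps insert.prems by (auto simp: cinner.sum_right intro!: sum.neutral)
  then show ?case using insert norm_Pythagoras by (simp add: norm_Pythagoras)
qed simp

lemma Bessel_inequality:
  fixes y :: "'i \<Rightarrow> 'h::complex_hilbert_space"
  assumes "finite F" "\<And>k. k \<in> F \<Longrightarrow> norm (y k) = 1"
    "\<And>m n. m \<in> F \<Longrightarrow> n \<in> F \<Longrightarrow> m \<noteq> n \<Longrightarrow> cinner (y m) (y n) = 0"
  shows "(\<Sum>k\<in>F. (cmod (cinner v (y k)))\<^sup>2) \<le> (norm v)\<^sup>2"
proof -
  let ?p = "\<Sum>k\<in>F. cinner v (y k) *\<^sub>C y k"
  have py: "cinner ?p (y m) = cinner v (y m)" if "m \<in> F" for m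
  proof -
    have "cinner ?p (y m) = (\<Sum>k\<in>F. if k = m then cinner v (y m) else 0)"
      unfolding cinner.sum_left
      using assms(2,3) that by (intro sum.cong) (auto simp: cinner_scaleC_left norm_eq_1_iff_cinner[symmetric])
    then show ?thesis using assms(1) that by simp
  qed
  have "cinner ?p (v - ?p) = 0"
    using py cinner_eq_0_sym[of _ "v - ?p"]
    by (auto simp: cinner.sum_left cinner_scaleC_left cinner_eq_0_sym[of _ "v - ?p"] cinner.diff_left intro!: sum.neutral)
  then have "(norm v)\<^sup>2 = (norm ?p)\<^sup>2 + (norm (v - ?p))\<^sup>2" using norm_Pythagoras[of ?p "v - ?p"] by simp
  moreover have "(norm ?p)\<^sup>2 = (\<Sum>k\<in>F. (norm (cinner v (y k) *\<^sub>C y k))\<^sup>2)"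
    using assms by (intro norm_sum_orthogonal) (auto simp: cinner_scaleC_left cinner_scaleC_right)
  moreover have "\<dots> = (\<Sum>k\<in>F. (cmod (cinner v (y k)))\<^sup>2)"
    using assms(2) by (intro sum.cong) (auto simp: norm_scaleC)
  ultimately show ?thesis by simp
qed

text \<open>The terms of the series are orthogonal because the \<open>g k\<close> are. Pythagoras
  followed by Bessel's inequality for \<open>y\<close> controls every finite partial sum, which
  gives both convergence and the norm bound.\<close>

lemma orthonormal_series_operator:
  fixes y g :: "nat \<Rightarrow> 'h::complex_hilbert_space"
  assumes y: "\<And>k. norm (y k) = 1" "\<And>m n. m \<noteq> n \<Longrightarrow> cinner (y m) (y n) = 0"
    and g: "\<And>k. norm (g k) \<le> C" "\<And>m n. m \<noteq> n \<Longrightarrow> cinner (g m) (g n) = 0"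
  obtains S where "S \<in> bounded_operators" "norm S \<le> C"
    "\<And>v. (\<lambda>k. cinner v (y k) *\<^sub>C g k) sums blinfun_apply S v"
proof -
  have C: "C \<ge> 0" using g(1)[of 0] norm_ge_zero order_trans by blast
  let ?t = "\<lambda>v k. cinner v (y k) *\<^sub>C g k"
  have tb: "(norm (\<Sum>k\<in>F. ?t v k))\<^sup>2 \<le> C\<^sup>2 * (\<Sum>k\<in>F. (cmod (cinner v (y k)))\<^sup>2)" if "finite F" for v F
  proof -
    have "(norm (\<Sum>k\<in>F. ?t v k))\<^sup>2 = (\<Sum>k\<in>F. (norm (?t v k))\<^sup>2)"
      using that g(2) by (intro norm_sum_orthogonal) (auto simp: cinner_scaleC_left cinner_scaleC_right)
    also have "\<dots> \<le> (\<Sum>k\<in>F. C\<^sup>2 * (cmod (cinner v (y k)))\<^sup>2)"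
      using g(1) by (intro sum_mono) (auto simp: norm_scaleC power_mult_distrib mult.commute intro!: mult_right_mono power_mono)
    finally show ?thesis by (simp add: sum_distrib_left)
  qed
  have bessel: "(\<Sum>k\<in>F. (cmod (cinner v (y k)))\<^sup>2) \<le> (norm v)\<^sup>2" if "finite F" for v F
    using that y by (intro Bessel_inequality) auto
  have sumb: "norm (\<Sum>k\<in>F. ?t v k) \<le> C * norm v" if "finite F" for v F
  proof -
    have "(norm (\<Sum>k\<in>F. ?t v k))\<^sup>2 \<le> (C * norm v)\<^sup>2"
      using order_trans[OF tb[OF that] mult_left_mono[OF bessel[OF that]]] by (simp add: power_mult_distrib)
    then show ?thesis using C by (simp add: abs_le_square_iff[symmetric])
  qed
  have smb: "summable (?t v)" for v
    unfolding summable_Cauchy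
  proof (intro allI impI)
    fix e :: real assume e: "e > 0"
    have "summable (\<lambda>k. (cmod (cinner v (y k)))\<^sup>2)"
      using bessel[of _ v] by (intro summableI_nonneg_bounded[where x = "(norm v)\<^sup>2"]) auto
    \<comment> \<open>\<open>C + 1\<close> instead of \<open>C\<close>, since \<open>C\<close> may
      be zero.\<close>
    moreover have "(e / (C + 1))\<^sup>2 > 0" using e C by simp
    ultimately obtain N where N: "\<And>m n. m \<ge> N \<Longrightarrow> norm (\<Sum>k=m..<n. (cmod (cinner v (y k)))\<^sup>2) < (e / (C + 1))\<^sup>2"
      unfolding summable_Cauchy by metis
    have "norm (sum (?t v) {m..<n}) < e" if "m \<ge> N" for m n
    proof -
      have "(norm (sum (?t v) {m..<n}))\<^sup>2 \<le> C\<^sup>2 * (\<Sum>k=m..<n. (cmod (cinner v (y k)))\<^sup>2)"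
        by (rule tb) simp
      also have "\<dots> \<le> (C + 1)\<^sup>2 * (\<Sum>k=m..<n. (cmod (cinner v (y k)))\<^sup>2)"
        using C by (intro mult_right_mono power_mono sum_nonneg) auto
      also have "\<dots> < (C + 1)\<^sup>2 * (e / (C + 1))\<^sup>2"
        using N[OF that, of n] C by (intro mult_strict_left_mono) (auto simp: sum_nonneg)
      also have "\<dots> = e\<^sup>2" using C by (simp add: power_mult_distrib[symmetric])
      finally show ?thesis using e by (simp add: power2_less_imp_less)
    qed
    then show "\<exists>N. \<forall>m\<ge>N. \<forall>n. norm (sum (?t v) {m..<n}) < e" by blast
  qed
  have bl: "bounded_linear (\<lambda>v. suminf (?t v))"
  proof (rule bounded_linear_intro[where K = C])
    show "suminf (?t (v + w)) = suminf (?t v) + suminf (?t w)" for v w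
      using suminf_add[OF smb smb] by (simp add: cinner_add_left scaleC_add_left)
    show "suminf (?t (r *\<^sub>R v)) = r *\<^sub>R suminf (?t v)" for r v
    proof -
      have "?t (r *\<^sub>R v) k = r *\<^sub>R ?t v k" for k
        unfolding cinner.scaleR_left scaleR_conv_of_real[of r "cinner v (y k)"]
        by (metis scaleC_scaleC scaleC_of_real)
      then show ?thesis using suminf_scaleR_right[OF smb, of r v] by simp
    qed
    show "norm (suminf (?t v)) \<le> norm v * C" for v
      by (rule LIMSEQ_le_const2[OF tendsto_norm[OF summable_LIMSEQ[OF smb]]])
        (use sumb in \<open>auto simp: mult.commute\<close>)
  qed
  define S where "S = Blinfun (\<lambda>v. suminf (?t v))"
  have S: "blinfun_apply S v = suminf (?t v)" for v by (simp add: S_def bounded_linear_Blinfun_apply bl)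
  show ?thesis
  proof (rule that[of S])
    show "(\<lambda>k. ?t v k) sums S v" for v unfolding S using smb by (rule summable_sums)
    show "S \<in> bounded_operators"
      unfolding bounded_operators_iff S
    proof (intro allI)
      fix c v
      have "?t (c *\<^sub>C v) = (\<lambda>k. c *\<^sub>C ?t v k)" by (simp add: cinner_scaleC_left scaleC_scaleC)
      then show "suminf (?t (c *\<^sub>C v)) = c *\<^sub>C suminf (?t v)"
        using bounded_linear.suminf[OF bounded_linear_scaleC smb] by simp
    qed
    show "norm S \<le> C"
      using C by (rule norm_blinfun_bound)
        (auto simp: S intro!: LIMSEQ_le_const2[OF tendsto_norm[OF summable_LIMSEQ[OF smb]]] sumb)
  qed
qed

section \<open>Finite subnests\<close>

lemma closure_cspan_minimal:
  assumes "S \<subseteq> W" "closed_csubspace W"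
  shows "closure (cspan S) \<subseteq> W"
  using assms unfolding closed_csubspace_def
  by (intro closure_minimal complex_vector.span_minimal) auto

lemma subset_ocomp_ocomp: "x \<in> M \<Longrightarrow> x \<in> ocomp (ocomp M)"
  unfolding ocomp_def using cinner_eq_0_sym by blast

text \<open>For a closed subspace \<open>V\<close> this says that the compression of
  \<open>T\<close> to \<open>V\<close> has norm at most \<open>e\<close>. Stated through the
  sesquilinear form, it passes to subspaces of \<open>V\<close> at once.\<close>

definition small_on :: "real \<Rightarrow> ('h::complex_hilbert_space \<Rightarrow>\<^sub>L 'h) \<Rightarrow> 'h set \<Rightarrow> bool" where
  "small_on e T V \<longleftrightarrow> (\<forall>x\<in>V. \<forall>y\<in>V. cmod (cinner (T x) y) \<le> e * norm x * norm y)"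

lemma small_on_subset: "V \<subseteq> W \<Longrightarrow> small_on e T W \<Longrightarrow> small_on e T V"
  unfolding small_on_def by blast

lemma small_on_unitI:
  assumes V: "closed_csubspace V"
    and "\<And>x y. x \<in> V \<Longrightarrow> y \<in> V \<Longrightarrow> norm x = 1 \<Longrightarrow> norm y = 1 \<Longrightarrow> cmod (cinner (blinfun_apply T x) y) \<le> e"
  shows "small_on e T V"
  unfolding small_on_def
proof (intro ballI)
  fix x y assume xy: "x \<in> V" "y \<in> V"
  show "cmod (cinner (T x) y) \<le> e * norm x * norm y"
  proof (cases "x = 0 \<or> y = 0")
    case True
    then show ?thesis by (auto simp: cinner.zero_left cinner.zero_right)
  next
    case False
    then have "cmod (cinner (T ((1 / norm x) *\<^sub>R x)) ((1 / norm y) *\<^sub>R y)) \<le> e"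
      using xy by (intro assms(2)) (auto simp: closed_csubspaceD(5)[OF V])
    then show ?thesis using False
      by (simp add: blinfun.scaleR_right cinner.scaleR_left cinner.scaleR_right field_simps)
  qed
qed

lemma chain_diagonal_sequences:
  fixes a :: "'h::complex_hilbert_space \<Rightarrow>\<^sub>L 'h"
  assumes ch: "subspace_chain \<T>" "\<Inter>\<T> = {0}" and a: "a \<in> bounded_operators" and e: "e > 0"
    and big: "\<And>T. T \<in> \<T> \<Longrightarrow> \<not> small_on e a T"
  obtains T x y where "\<And>n::nat. T n \<in> \<T>"
    "\<And>n. x n \<in> T n \<inter> ocomp (T (Suc n)) \<and> y n \<in> T n \<inter> ocomp (T (Suc n))"
    "\<And>n. norm (x n) = 1" "\<And>n. norm (y n) = 1" "\<And>n. cmod (cinner (a (x n)) (y n)) \<ge> e / 2"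
    "\<And>m n. m \<noteq> n \<Longrightarrow> cinner (x m) (x n) = 0" "\<And>m n. m \<noteq> n \<Longrightarrow> cinner (y m) (y n) = 0"
    "\<And>m n. m \<noteq> n \<Longrightarrow> cinner (a (x m)) (y n) = 0"
proof -
  let ?ok = "\<lambda>T T' x y. x \<in> T \<inter> ocomp T' \<and> y \<in> T \<inter> ocomp T'"
  have big': "\<exists>x\<in>T. \<exists>y\<in>T. cmod (cinner (a x) y) > e * norm x * norm y" if "T \<in> \<T>" for T
    using big[OF that] by (auto simp: small_on_def not_le)
  have step: "\<exists>T'\<in>\<T>. \<exists>x\<in>ocomp G. \<exists>y\<in>ocomp G.
      norm x = 1 \<and> norm y = 1 \<and> cmod (cinner (a x) y) \<ge> e / 2 \<and> ?ok T T' x y"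
    if "T \<in> \<T>" "finite G" for T G
    using chain_select[OF ch big', of "e / 2" T G] e that by fastforce
  obtain T0 where T0: "T0 \<in> \<T>" using ch(1) by (auto simp: subspace_chain_def)
  show thesis
    using select_sequence[where \<T> = \<T> and ok = ?ok, OF a T0 step] that by blast
qed

locale nest =
  fixes \<N> :: "'h::complex_hilbert_space set set"
  assumes is_nest: "is_nest \<N>"
begin

abbreviation Alg :: "('h \<Rightarrow>\<^sub>L 'h) set" where
  "Alg \<equiv> acarrier (nest_algebra \<N>)"

abbreviation Comp :: "('h \<Rightarrow>\<^sub>L 'h) set" where
  "Comp \<equiv> nest_compacts \<N>"

lemma closed_csubspace_nest: "M \<in> \<N> \<Longrightarrow> closed_csubspace M"
  using is_nest by (auto simp: is_nest_def closed_csubspace_def)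

lemma nest_total: "M \<in> \<N> \<Longrightarrow> N \<in> \<N> \<Longrightarrow> M \<subseteq> N \<or> N \<subseteq> M"
  using is_nest unfolding is_nest_def by blast

lemma zero_in_nest: "{0} \<in> \<N>" and UNIV_in_nest: "UNIV \<in> \<N>"
  using is_nest by (auto simp: is_nest_def)

lemma Inter_in_nest: "\<F> \<subseteq> \<N> \<Longrightarrow> \<Inter>\<F> \<in> \<N>"
  and closure_cspan_in_nest: "\<F> \<subseteq> \<N> \<Longrightarrow> closure (cspan (\<Union>\<F>)) \<in> \<N>"
  using is_nest by (auto simp: is_nest_def)

lemma closed_csubspace_block: "N \<in> \<N> \<Longrightarrow> closed_csubspace (N \<inter> ocomp M)"
  by (intro closed_csubspace_Int closed_csubspace_nest closed_csubspace_ocomp)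

lemma Alg_iff: "T \<in> Alg \<longleftrightarrow> T \<in> bounded_operators \<and> (\<forall>M\<in>\<N>. \<forall>x\<in>M. T x \<in> M)"
  by (auto simp: nest_algebra_def image_subset_iff)

lemma Comp_iff: "k \<in> Comp \<longleftrightarrow> k \<in> Alg \<and> compact_operator k"
  by (simp add: nest_compacts_def)

definition refine_steps :: "('h set \<Rightarrow> bool) \<Rightarrow> ('h set \<times> 'h set) set" where
  "refine_steps B = {(M, N). M \<in> \<N> \<and> N \<in> \<N> \<and> M \<subseteq> N \<and> B (N \<inter> ocomp M)}"

text \<open>
  There is a finite subnest \<open>{0} = N\<^sub>0 \<subseteq> \<dots> \<subseteq> N\<^sub>n = H\<close> all of whose blocks \<open>N\<^sub>i \<ominus> N\<^sub>i\<^sub>-\<^sub>1\<close> satisfy \<open>B\<close>.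
\<close>

definition finite_subnest :: "('h set \<Rightarrow> bool) \<Rightarrow> bool" where
  "finite_subnest B \<longleftrightarrow> ({0}, UNIV) \<in> (refine_steps B)\<^sup>*"

text \<open>
  A Cousin-type covering argument: the supremum of the subspaces that can be reached from \<open>{0}\<close> is
  itself reached because of the left condition, and it is \<open>H\<close> because of the right condition.
\<close>

lemma finite_subnest_iff_local:
  assumes anti: "\<And>V W. V \<subseteq> W \<Longrightarrow> B W \<Longrightarrow> B V"
  shows "finite_subnest B \<longleftrightarrow> (\<forall>N\<in>\<N>.
      (N \<noteq> {0} \<longrightarrow> (\<exists>M\<in>\<N>. M \<subset> N \<and> B (N \<inter> ocomp M))) \<and>
      (N \<noteq> UNIV \<longrightarrow> (\<exists>M\<in>\<N>. N \<subset> M \<and> B (M \<inter> ocomp N))))" (is "_ \<longleftrightarrow> ?L")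
proof
  assume fin: "finite_subnest B"
  \<comment> \<open>For this and the next claim: the first step of the path that passes
    \<open>N\<close> starts at or below \<open>N\<close>, and one of its ends is the neighbour
    sought. Antitony allows its block to be cut at \<open>N\<close>.\<close>
  have left: "\<exists>M\<in>\<N>. M \<subset> N \<and> B (N \<inter> ocomp M)"
    if "({0}, P) \<in> (refine_steps B)\<^sup>*" "N \<in> \<N>" "N \<noteq> {0}" "N \<subseteq> P" for N P
    using that
  proof (induction)
    case base
    then show ?case using closed_csubspaceD(2)[OF closed_csubspace_nest[of N]] by blast
  next
    case (step P P')
    have P: "P \<in> \<N>" "B (P' \<inter> ocomp P)" using step.hyps(2) by (auto simp: refine_steps_def)
    show ?case
    proof (cases "N \<subseteq> P")
      case False
      then have "P \<subset> N" using nest_total[OF P(1) step.prems(1)] by blast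
      moreover have "B (N \<inter> ocomp P)" using step.prems(3) by (intro anti[OF _ P(2)] Int_mono) auto
      ultimately show ?thesis using P(1) by blast
    next
      case True
      then show ?thesis by (rule step.IH[OF step.prems(1,2)])
    qed
  qed
  have right: "\<exists>M\<in>\<N>. N \<subset> M \<and> B (M \<inter> ocomp N)"
    if "({0}, P) \<in> (refine_steps B)\<^sup>*" "N \<in> \<N>" "N \<subset> P" for N P
    using that
  proof (induction)
    case base
    then show ?case using closed_csubspaceD(2)[OF closed_csubspace_nest[of N]] by blast
  next
    case (step P P')
    have P: "P \<in> \<N>" "P' \<in> \<N>" "B (P' \<inter> ocomp P)" using step.hyps(2) by (auto simp: refine_steps_def)
    show ?case
    proof (cases "N \<subset> P")
      case False
      then have "P \<subseteq> N" using nest_total[OF P(1) step.prems(1)] by blast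
      then have "P' \<inter> ocomp N \<subseteq> P' \<inter> ocomp P" using ocomp_antimono by blast
      then have "B (P' \<inter> ocomp N)" using P(3) by (rule anti)
      then show ?thesis using P(2) step.prems(2) by blast
    next
      case True
      then show ?thesis by (rule step.IH[OF step.prems(1)])
    qed
  qed
  show ?L
    using left[OF fin[unfolded finite_subnest_def]] right[OF fin[unfolded finite_subnest_def]] by blast
next
  assume L: ?L
  define \<G> where "\<G> = {N \<in> \<N>. ({0}, N) \<in> (refine_steps B)\<^sup>*}"
  define N0 where "N0 = closure (cspan (\<Union>\<G>))"
  have N0: "N0 \<in> \<N>" unfolding N0_def by (rule closure_cspan_in_nest) (auto simp: \<G>_def)
  have sub: "N \<subseteq> N0" if "N \<in> \<G>" for N
    using that closure_subset complex_vector.span_superset unfolding N0_def by fast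
  have "N0 \<in> \<G>"
  proof (cases "N0 = {0}")
    case True
    then show ?thesis using N0 by (auto simp: \<G>_def)
  next
    case False
    then have "\<exists>M\<in>\<N>. M \<subset> N0 \<and> B (N0 \<inter> ocomp M)" using bspec[OF L N0] by argo
    then obtain M where M: "M \<in> \<N>" "M \<subset> N0" "B (N0 \<inter> ocomp M)" by (elim bexE conjE)
    \<comment> \<open>\<open>N0\<close> is the least closed subspace above all reachable members, so
      the smaller \<open>M\<close> cannot contain them all; from a reachable \<open>N\<close> not
      below \<open>M\<close> the block up to \<open>N0\<close> is part of the good block.\<close>
    have "N0 \<subseteq> M" if "\<Union>\<G> \<subseteq> M"
      unfolding N0_def using that closed_csubspace_nest[OF M(1)] by (rule closure_cspan_minimal)
    then have "\<not> \<Union>\<G> \<subseteq> M" using M(2) by blast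
    then obtain N where N: "N \<in> \<G>" "\<not> N \<subseteq> M" by blast
    have NN: "N \<in> \<N>" "({0}, N) \<in> (refine_steps B)\<^sup>*" using N(1) by (auto simp: \<G>_def)
    have "M \<subseteq> N" using N(2) nest_total[OF M(1) NN(1)] by blast
    then have "N0 \<inter> ocomp N \<subseteq> N0 \<inter> ocomp M" using ocomp_antimono by blast
    then have "B (N0 \<inter> ocomp N)" using M(3) by (rule anti)
    then have "(N, N0) \<in> refine_steps B" using NN(1) N0 sub[OF N(1)] by (simp add: refine_steps_def)
    then have "({0}, N0) \<in> (refine_steps B)\<^sup>*" using NN(2) by (rule rtrancl_into_rtrancl[rotated])
    then show ?thesis using N0 by (simp add: \<G>_def)
  qed
  then have reach: "({0}, N0) \<in> (refine_steps B)\<^sup>*" by (simp add: \<G>_def)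
  have "N0 = UNIV"
  proof (rule ccontr)
    assume "N0 \<noteq> UNIV"
    then have "\<exists>M\<in>\<N>. N0 \<subset> M \<and> B (M \<inter> ocomp N0)" using bspec[OF L N0] by argo
    then obtain M where M: "M \<in> \<N>" "N0 \<subset> M" "B (M \<inter> ocomp N0)" by (elim bexE conjE)
    then have "(N0, M) \<in> refine_steps B" using N0 by (auto simp: refine_steps_def)
    then have "({0}, M) \<in> (refine_steps B)\<^sup>*" by (rule rtrancl_into_rtrancl[OF reach])
    then have "M \<subseteq> N0" using sub M(1) by (auto simp: \<G>_def)
    then show False using M(2) by blast
  qed
  then show "finite_subnest B" using reach by (simp add: finite_subnest_def)
qed

section \<open>Atoms and one-sided limits in the nest\<close>

text \<open>\<open>M\<close> is the immediate predecessor of \<open>N\<close>; in the usual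
  terminology the atom is the gap \<open>N \<inter> ocomp M\<close>.\<close>

definition atom :: "'h set \<Rightarrow> 'h set \<Rightarrow> bool" where
  "atom M N \<longleftrightarrow> M \<in> \<N> \<and> N \<in> \<N> \<and> M \<subset> N \<and> (\<forall>P\<in>\<N>. P \<subseteq> M \<or> N \<subseteq> P)"

definition left_blocks :: "'h set \<Rightarrow> 'h set set" where
  "left_blocks N = (\<lambda>M. N \<inter> ocomp M) ` {M \<in> \<N>. M \<subset> N}"

definition right_blocks :: "'h set \<Rightarrow> 'h set set" where
  "right_blocks N = (\<lambda>M. M \<inter> ocomp N) ` {M \<in> \<N>. N \<subset> M}"

text \<open>Compare \<open>N\<close> with the closed span \<open>M0\<close> of the strictly smaller
  members. If they differ, \<open>M0\<close> is the predecessor of \<open>N\<close>. If they agree,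
  a vector of \<open>N\<close> orthogonal to all smaller members is orthogonal to
  \<open>N\<close>.\<close>

lemma left_blocks_cases:
  assumes N: "N \<in> \<N>" "N \<noteq> {0}"
  shows "(\<exists>M. atom M N) \<or> subspace_chain (left_blocks N) \<and> \<Inter>(left_blocks N) = {0}"
proof -
  define \<F> where "\<F> = {M \<in> \<N>. M \<subset> N}"
  define M0 where "M0 = closure (cspan (\<Union>\<F>))"
  have M0: "M0 \<in> \<N>" unfolding M0_def by (rule closure_cspan_in_nest) (auto simp: \<F>_def)
  have M0N: "M0 \<subseteq> N" unfolding M0_def
    by (rule closure_cspan_minimal[OF _ closed_csubspace_nest[OF N(1)]]) (auto simp: \<F>_def)
  have sub: "M \<subseteq> M0" if "M \<in> \<F>" for M
    using that closure_subset complex_vector.span_superset unfolding M0_def by fast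
  show ?thesis
  proof (cases "M0 = N")
    case False
    have "P \<subseteq> M0 \<or> N \<subseteq> P" if "P \<in> \<N>" for P
      using sub[of P] nest_total[OF that N(1)] that by (auto simp: \<F>_def)
    then have "atom M0 N" using False M0 M0N N(1) unfolding atom_def by blast
    then show ?thesis by blast
  next
    case True
    have "{0} \<in> \<F>"
      using N zero_in_nest closed_csubspaceD(2)[OF closed_csubspace_nest[OF N(1)]] by (auto simp: \<F>_def)
    then have ne: "\<F> \<noteq> {}" by blast
    have "subspace_chain (left_blocks N)"
      unfolding subspace_chain_def
    proof (intro conjI ballI)
      show "left_blocks N \<noteq> {}" using ne by (auto simp: left_blocks_def \<F>_def)
      show "closed_csubspace T" if "T \<in> left_blocks N" for T
        using that closed_csubspace_block[OF N(1)] by (auto simp: left_blocks_def)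
      fix S T assume "S \<in> left_blocks N" "T \<in> left_blocks N"
      then obtain M M' where "M \<in> \<N>" "M' \<in> \<N>" "S = N \<inter> ocomp M" "T = N \<inter> ocomp M'"
        by (auto simp: left_blocks_def)
      then show "S \<subseteq> T \<or> T \<subseteq> S" using nest_total[of M M'] ocomp_antimono by blast
    qed
    moreover have "x = 0" if "x \<in> \<Inter>(left_blocks N)" for x
    proof -
      have "\<forall>M\<in>\<F>. x \<in> N \<inter> ocomp M" using that by (simp only: left_blocks_def \<F>_def INT_iff)
      then have x: "x \<in> N" "\<And>M. M \<in> \<F> \<Longrightarrow> x \<in> ocomp M" using ne by blast+
      have "\<Union>\<F> \<subseteq> ocomp {x}" using ocompD'[OF x(2)] by (auto simp: ocomp_def)
      then have "N \<subseteq> ocomp {x}"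
        using closure_cspan_minimal[OF _ closed_csubspace_ocomp] True unfolding M0_def by blast
      then show ?thesis using x(1) by (auto simp: ocomp_def cinner_self_eq_0_iff)
    qed
    moreover have "0 \<in> \<Inter>(left_blocks N)"
      using closed_csubspaceD(2)[OF closed_csubspace_block[OF N(1)]] by (auto simp: left_blocks_def)
    ultimately show ?thesis by blast
  qed
qed

text \<open>Dual to the left-hand case, with the intersection of the strictly larger members in
  place of the closed span.\<close>

lemma right_blocks_cases:
  assumes N: "N \<in> \<N>" "N \<noteq> UNIV"
  shows "(\<exists>M. atom N M) \<or> subspace_chain (right_blocks N) \<and> \<Inter>(right_blocks N) = {0}"
proof -
  define \<F> where "\<F> = {M \<in> \<N>. N \<subset> M}"
  have M0: "\<Inter>\<F> \<in> \<N>" by (rule Inter_in_nest) (auto simp: \<F>_def)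
  have M0N: "N \<subseteq> \<Inter>\<F>" by (auto simp: \<F>_def)
  show ?thesis
  proof (cases "\<Inter>\<F> = N")
    case False
    have "P \<subseteq> N \<or> \<Inter>\<F> \<subseteq> P" if "P \<in> \<N>" for P
      using nest_total[OF that N(1)] that by (auto simp: \<F>_def)
    then have "atom N (\<Inter>\<F>)" using False M0 M0N N(1) unfolding atom_def by blast
    then show ?thesis by blast
  next
    case True
    have "UNIV \<in> \<F>" using N UNIV_in_nest by (auto simp: \<F>_def)
    then have ne: "\<F> \<noteq> {}" by blast
    have "subspace_chain (right_blocks N)"
      unfolding subspace_chain_def
    proof (intro conjI ballI)
      show "right_blocks N \<noteq> {}" using ne by (auto simp: right_blocks_def \<F>_def)
      show "closed_csubspace T" if "T \<in> right_blocks N" for T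
        using that closed_csubspace_block by (auto simp: right_blocks_def)
      fix S T assume "S \<in> right_blocks N" "T \<in> right_blocks N"
      then obtain M M' where "M \<in> \<N>" "M' \<in> \<N>" "S = M \<inter> ocomp N" "T = M' \<inter> ocomp N"
        by (auto simp: right_blocks_def)
      then show "S \<subseteq> T \<or> T \<subseteq> S" using nest_total[of M M'] by blast
    qed
    moreover have "x = 0" if "x \<in> \<Inter>(right_blocks N)" for x
    proof -
      have "\<forall>M\<in>\<F>. x \<in> M \<inter> ocomp N" using that by (simp only: right_blocks_def \<F>_def INT_iff)
      then have "x \<in> \<Inter>\<F>" "x \<in> ocomp N" using ne by blast+
      then show ?thesis using True ocomp_Int_self by blast
    qed
    moreover have "0 \<in> \<Inter>(right_blocks N)"
      using closed_csubspaceD(2)[OF closed_csubspace_block] by (auto simp: right_blocks_def)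
    ultimately show ?thesis by blast
  qed
qed

text \<open>The local criterion fails at some \<open>N\<close> on one side. On that side
  \<open>N\<close> either has a neighbour, which gives an atom, or is a limit of members, and then
  the property fails on every block of the chain shrinking towards \<open>N\<close>.\<close>

lemma not_finite_subnest_cases:
  assumes anti: "\<And>V W. V \<subseteq> W \<Longrightarrow> B W \<Longrightarrow> B V" and "\<not> finite_subnest B"
  obtains (atom) M N where "atom M N" "\<not> B (N \<inter> ocomp M)"
  | (left) N where "N \<in> \<N>" "subspace_chain (left_blocks N)" "\<Inter>(left_blocks N) = {0}"
      "\<And>T. T \<in> left_blocks N \<Longrightarrow> \<not> B T"
  | (right) N where "N \<in> \<N>" "subspace_chain (right_blocks N)" "\<Inter>(right_blocks N) = {0}"
      "\<And>T. T \<in> right_blocks N \<Longrightarrow> \<not> B T"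
proof -
  have "\<not> (\<forall>N\<in>\<N>. (N \<noteq> {0} \<longrightarrow> (\<exists>M\<in>\<N>. M \<subset> N \<and> B (N \<inter> ocomp M))) \<and>
      (N \<noteq> UNIV \<longrightarrow> (\<exists>M\<in>\<N>. N \<subset> M \<and> B (M \<inter> ocomp N))))"
    using assms(2)
    by (subst (asm) finite_subnest_iff_local[of B]) (blast intro: anti, assumption)
  then obtain N where N: "N \<in> \<N>" and
    or: "N \<noteq> {0} \<and> (\<forall>M\<in>\<N>. M \<subset> N \<longrightarrow> \<not> B (N \<inter> ocomp M)) \<or>
     N \<noteq> UNIV \<and> (\<forall>M\<in>\<N>. N \<subset> M \<longrightarrow> \<not> B (M \<inter> ocomp N))"
    by meson
  from or show thesis
  proof (elim disjE conjE)
    assume bad: "N \<noteq> {0}" "\<forall>M\<in>\<N>. M \<subset> N \<longrightarrow> \<not> B (N \<inter> ocomp M)"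
    consider M where "atom M N" | "subspace_chain (left_blocks N)" "\<Inter>(left_blocks N) = {0}"
      using left_blocks_cases[OF N bad(1)] by blast
    then show thesis
    proof cases
      case (1 M)
      then have "M \<in> \<N>" "M \<subset> N" by (auto simp: atom_def)
      then show thesis using bad(2) atom[OF 1] by simp
    next
      case 2
      have "\<not> B T" if "T \<in> left_blocks N" for T using that bad(2) by (auto simp: left_blocks_def)
      then show thesis using left[OF N 2] by blast
    qed
  next
    assume bad: "N \<noteq> UNIV" "\<forall>M\<in>\<N>. N \<subset> M \<longrightarrow> \<not> B (M \<inter> ocomp N)"
    consider M where "atom N M" | "subspace_chain (right_blocks N)" "\<Inter>(right_blocks N) = {0}"
      using right_blocks_cases[OF N bad(1)] by blast
    then show thesis
    proof cases
      case (1 M)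
      then have "M \<in> \<N>" "N \<subset> M" by (auto simp: atom_def)
      then show thesis using bad(2) atom[OF 1] by simp
    next
      case 2
      have "\<not> B T" if "T \<in> right_blocks N" for T using that bad(2) by (auto simp: right_blocks_def)
      then show thesis using right[OF N 2] by blast
    qed
  qed
qed

text \<open>
  The obstruction to membership in the sum of compacts and radical: \<open>a\<close> acts on the orthonormal
  sequence \<open>x\<close> as a diagonal operator into the orthonormal sequence \<open>y\<close>, the two sequences
  concentrate at one point of the nest, and the nest algebra contains the rank-one operators sending
  every \<open>y (Suc n)\<close> to \<open>x n\<close>, or those sending every \<open>y n\<close> to \<open>x (Suc n)\<close>.
\<close>

definition shiftable :: "(nat \<Rightarrow> 'h) \<Rightarrow> (nat \<Rightarrow> 'h) \<Rightarrow> bool" where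
  "shiftable x y \<longleftrightarrow> (\<forall>n. \<forall>P\<in>\<N>. x n \<in> P \<or> y (Suc n) \<in> ocomp P) \<or> (\<forall>n. \<forall>P\<in>\<N>. x (Suc n) \<in> P \<or> y n \<in> ocomp P)"

definition concentrated :: "(nat \<Rightarrow> 'h) \<Rightarrow> (nat \<Rightarrow> 'h) \<Rightarrow> bool" where
  "concentrated x y \<longleftrightarrow> (\<forall>P\<in>\<N>. (\<forall>\<^sub>F n in sequentially. x n \<in> P \<and> y n \<in> P) \<or>
    (\<forall>\<^sub>F n in sequentially. x n \<in> ocomp P \<and> y n \<in> ocomp P))"

definition diagonal_sequences :: "('h \<Rightarrow>\<^sub>L 'h) \<Rightarrow> real \<Rightarrow> (nat \<Rightarrow> 'h) \<Rightarrow> (nat \<Rightarrow> 'h) \<Rightarrow> bool" where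
  "diagonal_sequences a \<eta> x y \<longleftrightarrow>
    (\<forall>n. norm (x n) = 1) \<and> (\<forall>n. norm (y n) = 1) \<and> (\<forall>n. cmod (cinner (a (x n)) (y n)) \<ge> \<eta>) \<and>
    (\<forall>m n. m \<noteq> n \<longrightarrow> cinner (x m) (x n) = 0) \<and> (\<forall>m n. m \<noteq> n \<longrightarrow> cinner (y m) (y n) = 0) \<and>
    (\<forall>m n. m \<noteq> n \<longrightarrow> cinner (a (x m)) (y n) = 0) \<and> concentrated x y \<and> shiftable x y"

section \<open>Diagonal sequences inside an atom and near a one-sided limit\<close>

text \<open>\<open>M\<close> separates \<open>x\<close> from \<open>y\<close>. The conclusion is the
  condition under which the operator \<open>rank_one x y\<close> leaves \<open>P\<close>
  invariant.\<close>

lemma in_nest_or_ocomp: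
  assumes "M \<in> \<N>" "P \<in> \<N>" "x \<in> M" "y \<in> ocomp M"
  shows "x \<in> P \<or> y \<in> ocomp P"
  using nest_total[OF assms(1,2)] ocomp_antimono assms by blast

text \<open>No member of the nest cuts an atom: a member below \<open>M\<close> is annihilated by
  \<open>T\<close>, and every other one contains the range of \<open>T\<close>.\<close>

lemma atom_Alg:
  assumes at: "atom M N" and T: "T \<in> bounded_operators" "\<And>x. T x \<in> N \<inter> ocomp M"
    "\<And>x. x \<in> ocomp (N \<inter> ocomp M) \<Longrightarrow> T x = 0"
  shows "T \<in> Alg"
  unfolding Alg_iff
proof (intro conjI T(1) ballI)
  fix P x assume P: "P \<in> \<N>" and x: "x \<in> P"
  consider "P \<subseteq> M" | "N \<subseteq> P" using at P by (auto simp: atom_def)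
  then show "T x \<in> P"
  proof cases
    case 1
    then have "x \<in> ocomp (N \<inter> ocomp M)" using x ocompD' by (fastforce simp: ocomp_def)
    then show ?thesis using T(3) closed_csubspaceD(2)[OF closed_csubspace_nest[OF P]] by simp
  next
    case 2
    then show ?thesis using T(2) by blast
  qed
qed

text \<open>If no pair orthogonal to \<open>G\<close> can be found, then \<open>a\<close> is small
  on the block after subtracting the compact part removed by \<open>G\<close>, and that part is in
  the algebra because it lives on an atom. Compact perturbations enter the hypothesis here, unlike
  in the one-sided cases, since a block of fixed size does not make a compact operator
  small.\<close>

lemma atom_diagonal_sequences:
  assumes at: "atom M N" and a: "a \<in> Alg" and \<eta>: "\<eta> \<ge> 0"
    and nc: "\<not> (\<exists>k\<in>Comp. small_on \<eta> (a - k) (N \<inter> ocomp M))"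
  shows "\<exists>x y. diagonal_sequences a \<eta> x y"
proof -
  let ?V = "N \<inter> ocomp M"
  have MN: "M \<in> \<N>" "N \<in> \<N>" "M \<subset> N" using at by (auto simp: atom_def)
  have V: "closed_csubspace ?V" by (rule closed_csubspace_block[OF MN(2)])
  have ab: "a \<in> bounded_operators" using a by (simp add: Alg_iff)
  have step: "\<exists>x\<in>ocomp G. \<exists>y\<in>ocomp G. norm x = 1 \<and> norm y = 1 \<and> cmod (cinner (a x) y) \<ge> \<eta> \<and> x \<in> ?V \<and> y \<in> ?V"
    if G: "finite G" for G
  proof (rule ccontr)
    assume neg: "\<not> ?thesis"
    let ?F = "?V \<inter> ocomp G"
    have F: "closed_csubspace ?F" by (intro closed_csubspace_Int V closed_csubspace_ocomp)
    have sm: "small_on \<eta> a ?F"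
    proof (rule small_on_unitI[OF F])
      fix x y assume xy: "x \<in> ?F" "y \<in> ?F" "norm x = 1" "norm y = 1"
      have "\<not> \<eta> \<le> cmod (cinner (a x) y)" using neg xy by blast
      then show "cmod (cinner (a x) y) \<le> \<eta>" by linarith
    qed
    define f where "f = (cproj ?V o\<^sub>L a o\<^sub>L cproj ?V) - (cproj ?F o\<^sub>L a o\<^sub>L cproj ?F)"
    have "compact_operator f" unfolding f_def by (rule compact_compression_diff[OF G V])
    moreover have "f \<in> Alg"
    proof (rule atom_Alg[OF at])
      show "f \<in> bounded_operators"
        unfolding f_def by (intro bounded_operators_diff bounded_operators_comp bounded_operators_cproj V F ab)
      show "f x \<in> ?V" for x
      proof -
        have "cproj ?F (a (cproj ?F x)) \<in> ?V" using cproj_in[OF F] by blast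
        then have "cproj ?V (a (cproj ?V x)) - cproj ?F (a (cproj ?F x)) \<in> ?V"
          by (rule closed_csubspaceD(7)[OF V cproj_in[OF V]])
        then show ?thesis by (simp add: f_def blinfun.diff_left)
      qed
      show "f x = 0" if x: "x \<in> ocomp ?V" for x
      proof -
        have "x \<in> ocomp ?F" using x ocomp_antimono[of ?F ?V] by blast
        then show ?thesis using cproj_ocomp[OF F] cproj_ocomp[OF V x] by (simp add: f_def blinfun.diff_left)
      qed
    qed
    ultimately have "f \<in> Comp" by (simp add: Comp_iff)
    moreover have "small_on \<eta> (a - f) ?V"
      unfolding small_on_def
    proof (intro ballI)
      fix x y assume xy: "x \<in> ?V" "y \<in> ?V"
      have "cinner ((a - f) x) y = cinner (a x) y - cinner (cproj ?V (a x)) y + cinner (cproj ?F (a (cproj ?F x))) y"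
        using cproj_id[OF V xy(1)] by (simp add: f_def blinfun.diff_left cinner.diff_left)
      also have "\<dots> = cinner (a (cproj ?F x)) (cproj ?F y)"
        using cinner_cproj_left[OF V xy(2)] by (simp add: cinner_cproj[OF F])
      also have "cmod \<dots> \<le> \<eta> * norm (cproj ?F x) * norm (cproj ?F y)"
        using sm cproj_in[OF F] unfolding small_on_def by blast
      also have "\<dots> \<le> \<eta> * norm x * norm y"
        using \<eta> norm_cproj_le[OF F] by (intro mult_mono) auto
      finally show "cmod (cinner ((a - f) x) y) \<le> \<eta> * norm x * norm y" .
    qed
    ultimately show False using nc by blast
  qed
  \<comment> \<open>The state from the one-point type is a dummy: the block stays the same in every
    step.\<close>
  have step': "\<exists>T'\<in>UNIV :: unit set. \<exists>x\<in>ocomp G. \<exists>y\<in>ocomp G.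
      norm x = 1 \<and> norm y = 1 \<and> cmod (cinner (a x) y) \<ge> \<eta> \<and> x \<in> ?V \<and> y \<in> ?V" if "finite G" for G
    using step[OF that] by blast
  obtain x y where xy: "\<And>n::nat. x n \<in> ?V \<and> y n \<in> ?V"
    "\<And>n. norm (x n) = 1" "\<And>n. norm (y n) = 1" "\<And>n. cmod (cinner (a (x n)) (y n)) \<ge> \<eta>"
    "\<And>m n. m \<noteq> n \<Longrightarrow> cinner (x m) (x n) = 0" "\<And>m n. m \<noteq> n \<Longrightarrow> cinner (y m) (y n) = 0"
    "\<And>m n. m \<noteq> n \<Longrightarrow> cinner (a (x m)) (y n) = 0"
  proof (rule select_sequence[where \<T> = UNIV and ok = "\<lambda>_ _ u v. u \<in> ?V \<and> v \<in> ?V", OF ab UNIV_I])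
    fix x y :: "nat \<Rightarrow> 'h"
    assume "\<And>n. x n \<in> ?V \<and> y n \<in> ?V"
      "\<And>n. norm (x n) = 1" "\<And>n. norm (y n) = 1" "\<And>n. cmod (cinner (a (x n)) (y n)) \<ge> \<eta>"
      "\<And>m n. m \<noteq> n \<Longrightarrow> cinner (x m) (x n) = 0" "\<And>m n. m \<noteq> n \<Longrightarrow> cinner (y m) (y n) = 0"
      "\<And>m n. m \<noteq> n \<Longrightarrow> cinner (a (x m)) (y n) = 0"
    then show thesis by (rule that)
  qed (rule step')
  have alt: "(\<forall>n. x n \<in> P \<and> y n \<in> P) \<or> (\<forall>n. x n \<in> ocomp P \<and> y n \<in> ocomp P)" if "P \<in> \<N>" for P
  proof -
    consider "P \<subseteq> M" | "N \<subseteq> P" using at \<open>P \<in> \<N>\<close> by (auto simp: atom_def)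
    then show ?thesis using xy(1) ocomp_antimono by cases blast+
  qed
  have "concentrated x y"
    unfolding concentrated_def
  proof
    fix P assume "P \<in> \<N>"
    from alt[OF this] show "(\<forall>\<^sub>F n in sequentially. x n \<in> P \<and> y n \<in> P) \<or>
        (\<forall>\<^sub>F n in sequentially. x n \<in> ocomp P \<and> y n \<in> ocomp P)"
      by (elim disjE) simp_all
  qed
  moreover have "shiftable x y" unfolding shiftable_def using alt by blast
  ultimately have "diagonal_sequences a \<eta> x y"
    unfolding diagonal_sequences_def using xy by blast
  then show ?thesis by blast
qed

lemma left_diagonal_sequences:
  assumes N: "N \<in> \<N>" and ch: "subspace_chain (left_blocks N)" "\<Inter>(left_blocks N) = {0}"
    and a: "a \<in> Alg" and e: "e > 0" and big: "\<And>T. T \<in> left_blocks N \<Longrightarrow> \<not> small_on e a T"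
  shows "\<exists>x y. diagonal_sequences a (e / 2) x y"
proof -
  have ab: "a \<in> bounded_operators" using a by (simp add: Alg_iff)
  obtain T x y where T: "\<And>n::nat. T n \<in> left_blocks N"
    and ok: "\<And>n. x n \<in> T n \<inter> ocomp (T (Suc n)) \<and> y n \<in> T n \<inter> ocomp (T (Suc n))"
    and xy: "\<And>n. norm (x n) = 1" "\<And>n. norm (y n) = 1" "\<And>n. cmod (cinner (a (x n)) (y n)) \<ge> e / 2"
    "\<And>m n. m \<noteq> n \<Longrightarrow> cinner (x m) (x n) = 0" "\<And>m n. m \<noteq> n \<Longrightarrow> cinner (y m) (y n) = 0"
    "\<And>m n. m \<noteq> n \<Longrightarrow> cinner (a (x m)) (y n) = 0"
    using chain_diagonal_sequences[OF ch ab e big] by blast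
  have "\<exists>M. M \<in> \<N> \<and> M \<subset> N \<and> T n = N \<inter> ocomp M" for n
    using T[of n] by (auto simp: left_blocks_def)
  then obtain M where M: "\<And>n. M n \<in> \<N>" "\<And>n. M n \<subset> N" "\<And>n. T n = N \<inter> ocomp (M n)" by metis
  \<comment> \<open>The orthogonal complement of \<open>N \<inter> ocomp (M (Suc n))\<close> within
    \<open>N\<close> is \<open>M (Suc n)\<close>.\<close>
  have inM: "v \<in> M (Suc n)" if "v \<in> T n \<inter> ocomp (T (Suc n))" for v n
  proof -
    note cM = closed_csubspace_nest[OF M(1)]
    have v: "v \<in> N" "v \<in> ocomp (N \<inter> ocomp (M (Suc n)))" using that M(3) by auto
    have "cproj (M (Suc n)) v \<in> N" using cproj_in[OF cM] M(2) by blast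
    then have "v - cproj (M (Suc n)) v \<in> N"
      by (rule closed_csubspaceD(7)[OF closed_csubspace_nest[OF N] v(1)])
    then have w: "v - cproj (M (Suc n)) v \<in> N \<inter> ocomp (M (Suc n))"
      using cproj_diff[OF cM] by (rule IntI)
    have "cproj (M (Suc n)) v \<in> ocomp (N \<inter> ocomp (M (Suc n)))"
      by (rule subsetD[OF ocomp_antimono[OF Int_lower2] subset_ocomp_ocomp[OF cproj_in[OF cM]]])
    then have "v - cproj (M (Suc n)) v \<in> ocomp (N \<inter> ocomp (M (Suc n)))"
      by (rule closed_csubspaceD(7)[OF closed_csubspace_ocomp v(2)])
    with w have "v - cproj (M (Suc n)) v = 0" by (rule ocomp_Int_self)
    then show ?thesis using cproj_in[OF cM, of "Suc n" v] by simp
  qed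
  have up: "x n \<in> M (Suc n)" "y n \<in> M (Suc n)" and low: "x n \<in> ocomp (M n)" "y n \<in> ocomp (M n)" for n
    using ok[of n] inM M(3)[of n] by auto
  \<comment> \<open>The chain lemma does not supply this order; it is forced by the unit vector
    \<open>x n\<close>, which lies in \<open>M (Suc n)\<close> and is orthogonal to
    \<open>M n\<close>.\<close>
  have "M n \<subseteq> M (Suc n)" for n
  proof (rule ccontr)
    assume "\<not> M n \<subseteq> M (Suc n)"
    then have "x n \<in> M n" using nest_total[OF M(1) M(1)] up(1) by blast
    then have "x n = 0" using low(1) by (rule ocomp_Int_self)
    then show False using xy(1)[of n] by simp
  qed
  then have mono: "m \<le> n \<Longrightarrow> M m \<subseteq> M n" for m n by (rule lift_Suc_mono_le)
  have "concentrated x y"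
    unfolding concentrated_def
  proof
    fix P assume P: "P \<in> \<N>"
    show "(\<forall>\<^sub>F n in sequentially. x n \<in> P \<and> y n \<in> P) \<or> (\<forall>\<^sub>F n in sequentially. x n \<in> ocomp P \<and> y n \<in> ocomp P)"
    proof (cases "\<forall>n. M n \<subseteq> P")
      case True
      then show ?thesis using up by (intro disjI1 always_eventually) blast
    next
      case False
      then obtain m where "P \<subseteq> M m" using nest_total[OF P M(1)] by blast
      then have "x n \<in> ocomp P \<and> y n \<in> ocomp P" if "n \<ge> m" for n
        using mono[OF that] low[of n] ocomp_antimono[of P "M n"] by blast
      then show ?thesis by (intro disjI2) (auto simp: eventually_sequentially)
    qed
  qed
  moreover have "shiftable x y"
    unfolding shiftable_def using in_nest_or_ocomp[OF M(1) _ up(1) low(2)] by blast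
  ultimately have "diagonal_sequences a (e / 2) x y"
    unfolding diagonal_sequences_def using xy by blast
  then show ?thesis by blast
qed

text \<open>The mirror image: the members \<open>M n\<close> now decrease, so
  \<open>M (Suc n)\<close> separates \<open>x (Suc n)\<close> from \<open>y n\<close>. This gives
  the second alternative of \<open>shiftable\<close>, while an increasing sequence gives the
  first.\<close>

lemma right_diagonal_sequences:
  assumes N: "N \<in> \<N>" and ch: "subspace_chain (right_blocks N)" "\<Inter>(right_blocks N) = {0}"
    and a: "a \<in> Alg" and e: "e > 0" and big: "\<And>T. T \<in> right_blocks N \<Longrightarrow> \<not> small_on e a T"
  shows "\<exists>x y. diagonal_sequences a (e / 2) x y"
proof -
  have ab: "a \<in> bounded_operators" using a by (simp add: Alg_iff)
  obtain T x y where T: "\<And>n::nat. T n \<in> right_blocks N"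
    and ok: "\<And>n. x n \<in> T n \<inter> ocomp (T (Suc n)) \<and> y n \<in> T n \<inter> ocomp (T (Suc n))"
    and xy: "\<And>n. norm (x n) = 1" "\<And>n. norm (y n) = 1" "\<And>n. cmod (cinner (a (x n)) (y n)) \<ge> e / 2"
    "\<And>m n. m \<noteq> n \<Longrightarrow> cinner (x m) (x n) = 0" "\<And>m n. m \<noteq> n \<Longrightarrow> cinner (y m) (y n) = 0"
    "\<And>m n. m \<noteq> n \<Longrightarrow> cinner (a (x m)) (y n) = 0"
    using chain_diagonal_sequences[OF ch ab e big] by blast
  have "\<exists>M. M \<in> \<N> \<and> N \<subset> M \<and> T n = M \<inter> ocomp N" for n
    using T[of n] by (auto simp: right_blocks_def)
  then obtain M where M: "\<And>n. M n \<in> \<N>" "\<And>n. N \<subset> M n" "\<And>n. T n = M n \<inter> ocomp N" by metis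
  note cN = closed_csubspace_nest[OF N]
  \<comment> \<open>A vector of \<open>M (Suc n)\<close> splits into a part in \<open>N\<close> and
    a part in the next block, and \<open>v\<close> is orthogonal to both.\<close>
  have inM: "v \<in> ocomp (M (Suc n))" if "v \<in> T n \<inter> ocomp (T (Suc n))" for v n
    unfolding ocomp_def
  proof (intro CollectI ballI)
    fix g assume g: "g \<in> M (Suc n)"
    have v: "v \<in> ocomp N" "v \<in> ocomp (M (Suc n) \<inter> ocomp N)" using that M(3) by auto
    have "cproj N g \<in> M (Suc n)" using cproj_in[OF cN] M(2) by blast
    then have "g - cproj N g \<in> M (Suc n) \<inter> ocomp N"
      using cproj_diff[OF cN, of g] closed_csubspaceD(7)[OF closed_csubspace_nest[OF M(1)] g] by blast
    then have "cinner v (g - cproj N g) = 0" by (rule ocompD[OF v(2)])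
    moreover have "cinner v (cproj N g) = 0" by (rule ocompD[OF v(1) cproj_in[OF cN]])
    ultimately show "cinner v g = 0" by (simp add: cinner.diff_right)
  qed
  have up: "x n \<in> M n" "y n \<in> M n" and low: "x n \<in> ocomp (M (Suc n))" "y n \<in> ocomp (M (Suc n))" for n
    using ok[of n] inM M(3)[of n] by auto
  have "M (Suc n) \<subseteq> M n" for n
  proof (rule ccontr)
    assume "\<not> M (Suc n) \<subseteq> M n"
    then have "x n \<in> M (Suc n)" using nest_total[OF M(1) M(1)] up(1) by blast
    then have "x n = 0" using low(1) by (rule ocomp_Int_self)
    then show False using xy(1)[of n] by simp
  qed
  then have anti: "m \<le> n \<Longrightarrow> M n \<subseteq> M m" for m n by (rule lift_Suc_antimono_le)
  have "concentrated x y"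
    unfolding concentrated_def
  proof
    fix P assume P: "P \<in> \<N>"
    show "(\<forall>\<^sub>F n in sequentially. x n \<in> P \<and> y n \<in> P) \<or> (\<forall>\<^sub>F n in sequentially. x n \<in> ocomp P \<and> y n \<in> ocomp P)"
    proof (cases "\<forall>n. P \<subseteq> M n")
      case True
      then show ?thesis using low ocomp_antimono by (intro disjI2 always_eventually) blast
    next
      case False
      then obtain m where "M m \<subseteq> P" using nest_total[OF P M(1)] by blast
      then have "x n \<in> P \<and> y n \<in> P" if "n \<ge> m" for n
        using anti[OF that] up[of n] by blast
      then show ?thesis by (intro disjI1) (auto simp: eventually_sequentially)
    qed
  qed
  moreover have "shiftable x y"
    unfolding shiftable_def using in_nest_or_ocomp[OF M(1) _ up(1) low(2)] by blast
  ultimately have "diagonal_sequences a (e / 2) x y"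
    unfolding diagonal_sequences_def using xy by blast
  then show ?thesis by blast
qed

end

lemma sums_in_closed_csubspace:
  assumes W: "closed_csubspace W" and "\<And>k. t k \<in> W" "t sums s"
  shows "s \<in> W"
proof -
  have "(\<Sum>k<n. t k) \<in> W" for n
    by (induction n) (use assms(2) closed_csubspaceD(2,3)[OF W] in simp_all)
  then show ?thesis
    using closed_sequentially[OF closed_csubspaceD(1)[OF W], of "\<lambda>n. \<Sum>k<n. t k"] assms(3)
    unfolding sums_def by blast
qed

context nest
begin

section \<open>Ringrose's description of the radical\<close>

abbreviation scale :: "complex \<Rightarrow> ('h \<Rightarrow>\<^sub>L 'h) \<Rightarrow> 'h \<Rightarrow>\<^sub>L 'h" where
  "scale \<equiv> ascale (nest_algebra \<N>)"

lemma nest_algebra_ops [simp]: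
  "azero (nest_algebra \<N>) = 0" "aplus (nest_algebra \<N>) = (+)" "amult (nest_algebra \<N>) = (o\<^sub>L)"
  "anorm (nest_algebra \<N>) = norm"
  by (simp_all add: nest_algebra_def)

lemma scale_apply [simp]: "scale c T x = c *\<^sub>C T x"
  by (rule blinfun_apply_ascale)

lemma Alg_bounded: "T \<in> Alg \<Longrightarrow> T \<in> bounded_operators"
  and Alg_apply: "T \<in> Alg \<Longrightarrow> M \<in> \<N> \<Longrightarrow> x \<in> M \<Longrightarrow> T x \<in> M"
  by (auto simp: Alg_iff)

lemma Alg_add: "S \<in> Alg \<Longrightarrow> T \<in> Alg \<Longrightarrow> S + T \<in> Alg"
  by (auto simp: Alg_iff bounded_operators_add blinfun.add_left closed_csubspaceD(3)[OF closed_csubspace_nest])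

lemma Alg_diff: "S \<in> Alg \<Longrightarrow> T \<in> Alg \<Longrightarrow> S - T \<in> Alg"
  by (auto simp: Alg_iff bounded_operators_diff blinfun.diff_left closed_csubspaceD(7)[OF closed_csubspace_nest])

lemma Alg_comp: "S \<in> Alg \<Longrightarrow> T \<in> Alg \<Longrightarrow> S o\<^sub>L T \<in> Alg"
  by (auto simp: Alg_iff bounded_operators_comp)

lemma Alg_0: "0 \<in> Alg" and Alg_id: "id_blinfun \<in> Alg"
  using closed_csubspaceD(2)[OF closed_csubspace_nest] by (auto simp: Alg_iff bounded_operators_iff)

lemma Alg_scale: "T \<in> Alg \<Longrightarrow> scale c T \<in> Alg"
  using banach_algebra.scale_closed[OF banach_algebra_nest_algebra[OF is_nest]] .

lemma closed_Alg: "closed Alg"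
  by (rule closed_nest_algebra[OF is_nest])

lemma Alg_cproj:
  assumes P: "P \<in> \<N>"
  shows "cproj P \<in> Alg"
  unfolding Alg_iff
proof (intro conjI ballI bounded_operators_cproj closed_csubspace_nest P)
  fix M x assume M: "M \<in> \<N>" and x: "x \<in> M"
  consider "M \<subseteq> P" | "P \<subseteq> M" using nest_total[OF M P] by blast
  then show "cproj P x \<in> M"
  proof cases
    case 1
    then have "cproj P x = x" using x by (intro cproj_id closed_csubspace_nest P) auto
    then show ?thesis using x by simp
  next
    case 2
    then show ?thesis using cproj_in[OF closed_csubspace_nest[OF P]] by blast
  qed
qed

lemma Alg_rank_one:
  assumes "\<And>P. P \<in> \<N> \<Longrightarrow> x \<in> P \<or> y \<in> ocomp P"
  shows "rank_one x y \<in> Alg"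
  unfolding Alg_iff
proof (intro conjI ballI bounded_operators_rank_one)
  fix M v assume M: "M \<in> \<N>" "v \<in> M"
  note cM = closed_csubspaceD[OF closed_csubspace_nest[OF M(1)]]
  from assms[OF M(1)] show "rank_one x y v \<in> M"
  proof
    assume "x \<in> M"
    then show ?thesis using cM(4) by simp
  next
    assume "y \<in> ocomp M"
    then have "cinner v y = 0" using M(2) by (rule ocompD')
    then show ?thesis using cM(2) by simp
  qed
qed

lemma cproj_block:
  assumes "M \<in> \<N>" "N \<in> \<N>" "M \<subseteq> N"
  shows "cproj (N \<inter> ocomp M) = cproj N - cproj M"
proof (rule blinfun_eqI)
  fix x
  note cM = closed_csubspace_nest[OF assms(1)] and cN = closed_csubspace_nest[OF assms(2)]
  have 1: "cproj M x = cproj M (cproj N x)" using cproj_cproj[OF cM cN assms(3)] by simp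
  have "cproj (N \<inter> ocomp M) x = cproj N x - cproj M x"
  proof (rule cproj_eqI[OF closed_csubspace_block[OF assms(2)]], rule IntI)
    have "cproj M x \<in> N" using cproj_in[OF cM] assms(3) by blast
    then show "cproj N x - cproj M x \<in> N" by (rule closed_csubspaceD(7)[OF cN cproj_in[OF cN]])
    show "cproj N x - cproj M x \<in> ocomp M" unfolding 1 by (rule cproj_diff[OF cM])
    have "x - cproj N x \<in> ocomp (N \<inter> ocomp M)"
      by (rule subsetD[OF ocomp_antimono[OF Int_lower1] cproj_diff[OF cN]])
    moreover have "cproj M x \<in> ocomp (N \<inter> ocomp M)"
      by (rule subsetD[OF ocomp_antimono[OF Int_lower2] subset_ocomp_ocomp[OF cproj_in[OF cM]]])
    ultimately have "(x - cproj N x) + cproj M x \<in> ocomp (N \<inter> ocomp M)"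
      by (rule closed_csubspaceD(3)[OF closed_csubspace_ocomp])
    then show "x - (cproj N x - cproj M x) \<in> ocomp (N \<inter> ocomp M)" by (simp add: algebra_simps)
  qed
  then show "cproj (N \<inter> ocomp M) x = (cproj N - cproj M) x" by (simp add: blinfun.diff_left)
qed

lemma Comp_0: "0 \<in> Comp"
  by (simp add: Comp_iff Alg_0 compact_operator_0)

lemma Comp_add: "S \<in> Comp \<Longrightarrow> T \<in> Comp \<Longrightarrow> S + T \<in> Comp"
  and Comp_diff: "S \<in> Comp \<Longrightarrow> T \<in> Comp \<Longrightarrow> S - T \<in> Comp"
  and Comp_left: "T \<in> Comp \<Longrightarrow> S \<in> Alg \<Longrightarrow> S o\<^sub>L T \<in> Comp"
  and Comp_right: "T \<in> Comp \<Longrightarrow> S \<in> Alg \<Longrightarrow> T o\<^sub>L S \<in> Comp"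
  by (simp_all add: Comp_iff Alg_add Alg_diff Alg_comp compact_operator_add compact_operator_diff
      compact_operator_comp_left compact_operator_comp_right)

lemma closed_Comp: "closed Comp"
proof -
  have "Comp = Alg \<inter> {T. compact_operator T}" by (auto simp: Comp_iff)
  then show ?thesis using closed_Int[OF closed_Alg closed_compact_operators] by simp
qed

text \<open>Scalar multiples are left multiples, so closure under scalars comes from closure under
  left multiplication by the algebra.\<close>

lemma scale_eq_comp: "scale c T = scale c id_blinfun o\<^sub>L T"
  by (rule blinfun_eqI) simp

lemma finite_subnest_mono:
  assumes "finite_subnest B"
    and "\<And>M N. M \<in> \<N> \<Longrightarrow> N \<in> \<N> \<Longrightarrow> M \<subseteq> N \<Longrightarrow> B (N \<inter> ocomp M) \<Longrightarrow> B' (N \<inter> ocomp M)"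
  shows "finite_subnest B'"
proof -
  have "refine_steps B \<subseteq> refine_steps B'" using assms(2) by (auto simp: refine_steps_def)
  from rtrancl_mono[OF this] show ?thesis using assms(1) unfolding finite_subnest_def by blast
qed

text \<open>Plays the role of a common refinement of two finite subnests. With the local criterion
  it is enough to take, on each side of a member, the nearer of the two neighbours.\<close>

lemma finite_subnest_conj:
  assumes anti: "\<And>V W. V \<subseteq> W \<Longrightarrow> B W \<Longrightarrow> B V" "\<And>V W. V \<subseteq> W \<Longrightarrow> B' W \<Longrightarrow> B' V"
    and fin: "finite_subnest B" "finite_subnest B'"
  shows "finite_subnest (\<lambda>V. B V \<and> B' V)"
proof (subst finite_subnest_iff_local)
  show "B V \<and> B' V" if "V \<subseteq> W" "B W \<and> B' W" for V W using anti that by meson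
  have loc: "\<forall>N\<in>\<N>. (N \<noteq> {0} \<longrightarrow> (\<exists>M\<in>\<N>. M \<subset> N \<and> B (N \<inter> ocomp M))) \<and>
      (N \<noteq> UNIV \<longrightarrow> (\<exists>M\<in>\<N>. N \<subset> M \<and> B (M \<inter> ocomp N)))"
    using fin(1) by (subst (asm) finite_subnest_iff_local) (erule (1) anti(1))
  have loc': "\<forall>N\<in>\<N>. (N \<noteq> {0} \<longrightarrow> (\<exists>M\<in>\<N>. M \<subset> N \<and> B' (N \<inter> ocomp M))) \<and>
      (N \<noteq> UNIV \<longrightarrow> (\<exists>M\<in>\<N>. N \<subset> M \<and> B' (M \<inter> ocomp N)))"
    using fin(2) by (subst (asm) finite_subnest_iff_local) (erule (1) anti(2))
  show "\<forall>N\<in>\<N>. (N \<noteq> {0} \<longrightarrow> (\<exists>M\<in>\<N>. M \<subset> N \<and> B (N \<inter> ocomp M) \<and> B' (N \<inter> ocomp M))) \<and>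
      (N \<noteq> UNIV \<longrightarrow> (\<exists>M\<in>\<N>. N \<subset> M \<and> B (M \<inter> ocomp N) \<and> B' (M \<inter> ocomp N)))"
  proof (intro ballI conjI impI)
    fix N assume N: "N \<in> \<N>"
    {
      assume "N \<noteq> {0}"
      then have "\<exists>M\<in>\<N>. M \<subset> N \<and> B (N \<inter> ocomp M)" "\<exists>M\<in>\<N>. M \<subset> N \<and> B' (N \<inter> ocomp M)"
        using bspec[OF loc N] bspec[OF loc' N] by argo+
      then obtain M M' where M: "M \<in> \<N>" "M \<subset> N" "B (N \<inter> ocomp M)"
        and M': "M' \<in> \<N>" "M' \<subset> N" "B' (N \<inter> ocomp M')" by (elim bexE conjE)
      from nest_total[OF M(1) M'(1)] show "\<exists>M\<in>\<N>. M \<subset> N \<and> B (N \<inter> ocomp M) \<and> B' (N \<inter> ocomp M)"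
      proof
        assume "M \<subseteq> M'"
        then have "B (N \<inter> ocomp M')" by (intro anti(1)[OF _ M(3)] Int_mono order_refl ocomp_antimono)
        then show ?thesis using M' by (intro bexI[of _ M'] conjI)
      next
        assume "M' \<subseteq> M"
        then have "B' (N \<inter> ocomp M)" by (intro anti(2)[OF _ M'(3)] Int_mono order_refl ocomp_antimono)
        then show ?thesis using M by (intro bexI[of _ M] conjI)
      qed
    next
      assume "N \<noteq> UNIV"
      then have "\<exists>M\<in>\<N>. N \<subset> M \<and> B (M \<inter> ocomp N)" "\<exists>M\<in>\<N>. N \<subset> M \<and> B' (M \<inter> ocomp N)"
        using bspec[OF loc N] bspec[OF loc' N] by argo+
      then obtain M M' where M: "M \<in> \<N>" "N \<subset> M" "B (M \<inter> ocomp N)"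
        and M': "M' \<in> \<N>" "N \<subset> M'" "B' (M' \<inter> ocomp N)" by (elim bexE conjE)
      from nest_total[OF M(1) M'(1)] show "\<exists>M\<in>\<N>. N \<subset> M \<and> B (M \<inter> ocomp N) \<and> B' (M \<inter> ocomp N)"
      proof
        assume "M \<subseteq> M'"
        then have "B' (M \<inter> ocomp N)" by (intro anti(2)[OF _ M'(3)] Int_mono order_refl)
        then show ?thesis using M by (intro bexI[of _ M] conjI)
      next
        assume "M' \<subseteq> M"
        then have "B (M' \<inter> ocomp N)" by (intro anti(1)[OF _ M(3)] Int_mono order_refl)
        then show ?thesis using M' by (intro bexI[of _ M'] conjI)
      qed
    }
  qed
qed

section \<open>The ideal of operators with small diagonal blocks\<close>

definition ringrose_ideal :: "('h \<Rightarrow>\<^sub>L 'h) set" where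
  "ringrose_ideal = {a \<in> Alg. \<forall>e>0. finite_subnest (small_on e a)}"

lemma ringrose_Alg: "a \<in> ringrose_ideal \<Longrightarrow> a \<in> Alg"
  by (simp add: ringrose_ideal_def)

lemma small_on_add:
  assumes "small_on d S V" "small_on e T V"
  shows "small_on (d + e) (S + T) V"
  unfolding small_on_def
proof (intro ballI)
  fix x y assume xy: "x \<in> V" "y \<in> V"
  have "cmod (cinner ((S + T) x) y) \<le> cmod (cinner (S x) y) + cmod (cinner (T x) y)"
    by (simp add: blinfun.add_left cinner_add_left norm_triangle_ineq)
  also have "\<dots> \<le> d * norm x * norm y + e * norm x * norm y"
    using assms xy unfolding small_on_def by (intro add_mono) auto
  finally show "cmod (cinner ((S + T) x) y) \<le> (d + e) * norm x * norm y" by (simp add: algebra_simps)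
qed

lemma small_on_norm: "small_on (norm S) S V"
  unfolding small_on_def
  by (intro ballI order_trans[OF norm_cinner_le] mult_right_mono norm_blinfun norm_ge_zero)

lemma small_on_mono: "small_on d T V \<Longrightarrow> d \<le> e \<Longrightarrow> small_on e T V"
  unfolding small_on_def by (meson mult_right_mono norm_ge_zero order_trans)

lemma small_on_perturb:
  assumes "small_on e T V" "norm (S - T) \<le> d"
  shows "small_on (d + e) S V"
  using small_on_add[OF small_on_mono[OF small_on_norm assms(2)] assms(1)] by simp

lemma ringrose_add:
  assumes "S \<in> ringrose_ideal" "T \<in> ringrose_ideal"
  shows "S + T \<in> ringrose_ideal"
  unfolding ringrose_ideal_def
proof (intro CollectI conjI allI impI Alg_add)
  fix e :: real assume "e > 0"
  then have "finite_subnest (small_on (e/2) S)" "finite_subnest (small_on (e/2) T)"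
    using assms by (auto simp: ringrose_ideal_def)
  then have "finite_subnest (\<lambda>V. small_on (e/2) S V \<and> small_on (e/2) T V)"
    using finite_subnest_conj[of "small_on (e/2) S" "small_on (e/2) T"] small_on_subset by blast
  then show "finite_subnest (small_on e (S + T))"
    by (rule finite_subnest_mono) (use small_on_add[of "e/2" S _ "e/2" T] in auto)
qed (use assms in \<open>auto simp: ringrose_ideal_def\<close>)

lemma Alg_split:
  assumes M: "M \<in> \<N>" "N \<in> \<N>" "M \<subseteq> N" and z: "z \<in> N"
  shows "z - cproj M z \<in> N \<inter> ocomp M"
proof
  have "cproj M z \<in> N" using cproj_in[OF closed_csubspace_nest[OF M(1)]] M(3) by blast
  then show "z - cproj M z \<in> N" by (rule closed_csubspaceD(7)[OF closed_csubspace_nest[OF M(2)] z])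
  show "z - cproj M z \<in> ocomp M" by (rule cproj_diff[OF closed_csubspace_nest[OF M(1)]])
qed

text \<open>\<open>S\<close> keeps \<open>cproj M z\<close> inside \<open>M\<close>, where
  \<open>y\<close> does not see it. Hence compression to a block is multiplicative on the algebra,
  and smallness on blocks survives products.\<close>

lemma Alg_cinner_split:
  assumes S: "S \<in> Alg" and M: "M \<in> \<N>" and y: "y \<in> ocomp M"
  shows "cinner (S z) y = cinner (S (z - cproj M z)) y"
proof -
  have "S (cproj M z) \<in> M" by (intro Alg_apply[OF S M] cproj_in closed_csubspace_nest M)
  then have "cinner (S (cproj M z)) y = 0" by (rule ocompD'[OF y])
  then show ?thesis by (simp add: blinfun.diff_right cinner.diff_left)
qed

lemma small_on_comp_left:
  assumes S: "S \<in> Alg" and T: "T \<in> Alg" and M: "M \<in> \<N>" "N \<in> \<N>" "M \<subseteq> N" and e: "e \<ge> 0"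
    and sm: "small_on e T (N \<inter> ocomp M)"
  shows "small_on (norm S * e) (S o\<^sub>L T) (N \<inter> ocomp M)"
  unfolding small_on_def
proof (intro ballI)
  fix x y assume x: "x \<in> N \<inter> ocomp M" and y: "y \<in> N \<inter> ocomp M"
  define u where "u = T x - cproj M (T x)"
  have u: "u \<in> N \<inter> ocomp M"
    unfolding u_def using x by (intro Alg_split M Alg_apply[OF T]) auto
  \<comment> \<open>\<open>u\<close> is the component of \<open>T x\<close> in the block; testing
    smallness of \<open>T\<close> against \<open>u\<close> itself bounds
    \<open>norm u\<close>.\<close>
  have "cinner u u = cinner (T x) u"
    using ocompD'[of u M "cproj M (T x)"] u cproj_in[OF closed_csubspace_nest[OF M(1)], of "T x"]
    by (subst u_def) (simp add: cinner.diff_left)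
  then have "norm u * norm u \<le> (e * norm x) * norm u"
    using sm x u unfolding small_on_def by (metis cinner_self norm_of_real abs_of_nonneg power2_eq_square zero_le_power2)
  then have nu: "norm u \<le> e * norm x"
    using e by (cases "u = 0") (auto dest: mult_right_le_imp_le)
  have "cmod (cinner ((S o\<^sub>L T) x) y) = cmod (cinner (S u) y)"
    using Alg_cinner_split[OF S M(1), of y "T x"] y by (simp add: u_def)
  also have "\<dots> \<le> norm (S u) * norm y" by (rule norm_cinner_le)
  also have "\<dots> \<le> (norm S * (e * norm x)) * norm y"
    using nu by (intro mult_right_mono order_trans[OF norm_blinfun] mult_left_mono) auto
  finally show "cmod (cinner ((S o\<^sub>L T) x) y) \<le> norm S * e * norm x * norm y" by (simp add: mult.assoc)
qed

lemma small_on_comp_right: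
  assumes S: "S \<in> Alg" and T: "T \<in> Alg" and M: "M \<in> \<N>" "N \<in> \<N>" "M \<subseteq> N" and e: "e \<ge> 0"
    and sm: "small_on e T (N \<inter> ocomp M)"
  shows "small_on (e * norm S) (T o\<^sub>L S) (N \<inter> ocomp M)"
  unfolding small_on_def
proof (intro ballI)
  fix x y assume x: "x \<in> N \<inter> ocomp M" and y: "y \<in> N \<inter> ocomp M"
  define u where "u = S x - cproj M (S x)"
  have u: "u \<in> N \<inter> ocomp M"
    unfolding u_def using x by (intro Alg_split M Alg_apply[OF S]) auto
  have "norm u \<le> norm (S x)"
    using norm_diff_cproj_le[OF closed_csubspace_nest[OF M(1)] closed_csubspaceD(2)[OF closed_csubspace_nest[OF M(1)]], of "S x"]
    by (simp add: u_def)
  then have nu: "norm u \<le> norm S * norm x" using norm_blinfun order_trans by blast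
  have "cmod (cinner ((T o\<^sub>L S) x) y) = cmod (cinner (T u) y)"
    using Alg_cinner_split[OF T M(1), of y "S x"] y by (simp add: u_def)
  also have "\<dots> \<le> e * norm u * norm y" using sm u y unfolding small_on_def by blast
  also have "\<dots> \<le> e * (norm S * norm x) * norm y"
    using nu e by (intro mult_right_mono mult_left_mono) auto
  finally show "cmod (cinner ((T o\<^sub>L S) x) y) \<le> e * norm S * norm x * norm y" by (simp add: mult.assoc)
qed

lemma ringrose_left:
  assumes T: "T \<in> ringrose_ideal" and S: "S \<in> Alg"
  shows "S o\<^sub>L T \<in> ringrose_ideal"
  unfolding ringrose_ideal_def
proof (intro CollectI conjI allI impI Alg_comp S ringrose_Alg T)
  fix e :: real assume e: "e > 0"
  have pos: "norm S + 1 > 0" by (simp add: add_nonneg_pos)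
  then have "finite_subnest (small_on (e / (norm S + 1)) T)" using T e by (simp add: ringrose_ideal_def)
  then show "finite_subnest (small_on e (S o\<^sub>L T))"
  proof (rule finite_subnest_mono)
    fix M N assume M: "M \<in> \<N>" "N \<in> \<N>" "M \<subseteq> N" "small_on (e / (norm S + 1)) T (N \<inter> ocomp M)"
    have "norm S * (e / (norm S + 1)) \<le> e" using pos e by (simp add: field_simps)
    moreover have "e / (norm S + 1) \<ge> 0" using pos e by simp
    ultimately show "small_on e (S o\<^sub>L T) (N \<inter> ocomp M)"
      using small_on_mono[OF small_on_comp_left[OF S ringrose_Alg[OF T] M(1-3) _ M(4)]] by blast
  qed
qed

lemma ringrose_right:
  assumes T: "T \<in> ringrose_ideal" and S: "S \<in> Alg"
  shows "T o\<^sub>L S \<in> ringrose_ideal"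
  unfolding ringrose_ideal_def
proof (intro CollectI conjI allI impI Alg_comp S ringrose_Alg T)
  fix e :: real assume e: "e > 0"
  have pos: "norm S + 1 > 0" by (simp add: add_nonneg_pos)
  then have "finite_subnest (small_on (e / (norm S + 1)) T)" using T e by (simp add: ringrose_ideal_def)
  then show "finite_subnest (small_on e (T o\<^sub>L S))"
  proof (rule finite_subnest_mono)
    fix M N assume M: "M \<in> \<N>" "N \<in> \<N>" "M \<subseteq> N" "small_on (e / (norm S + 1)) T (N \<inter> ocomp M)"
    have "(e / (norm S + 1)) * norm S \<le> e" using pos e by (simp add: field_simps)
    moreover have "e / (norm S + 1) \<ge> 0" using pos e by simp
    ultimately show "small_on e (T o\<^sub>L S) (N \<inter> ocomp M)"
      using small_on_mono[OF small_on_comp_right[OF S ringrose_Alg[OF T] M(1-3) _ M(4)]] by blast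
  qed
qed

lemma ringrose_scale: "T \<in> ringrose_ideal \<Longrightarrow> scale c T \<in> ringrose_ideal"
  by (subst scale_eq_comp) (intro ringrose_left Alg_scale Alg_id)

lemma ringrose_0: "0 \<in> ringrose_ideal"
proof -
  have "(({0}::'h set), UNIV) \<in> refine_steps (small_on e 0)" if "e > 0" for e
    using that zero_in_nest UNIV_in_nest by (auto simp: refine_steps_def small_on_def cinner.zero_left)
  then show ?thesis by (auto simp: ringrose_ideal_def finite_subnest_def Alg_0)
qed

lemma ringrose_uminus: "T \<in> ringrose_ideal \<Longrightarrow> - T \<in> ringrose_ideal"
proof -
  have "- T = scale (-1) T" by (rule blinfun_eqI) (simp add: blinfun.minus_left scaleC_minus_one)
  then show "T \<in> ringrose_ideal \<Longrightarrow> - T \<in> ringrose_ideal" using ringrose_scale by simp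
qed

lemma closed_ringrose: "closed ringrose_ideal"
  unfolding closed_sequential_limits
proof (intro allI impI, elim conjE)
  fix X T assume X: "\<forall>n. X n \<in> ringrose_ideal" "X \<longlonglongrightarrow> T"
  have "T \<in> Alg" using closed_sequentially[OF closed_Alg _ X(2)] X(1) ringrose_Alg by blast
  moreover have "finite_subnest (small_on e T)" if "e > 0" for e
  proof -
    have e: "e / 2 > 0" using that by simp
    obtain n where n: "norm (X n - T) < e/2" using LIMSEQ_D[OF X(2) e] by blast
    have "finite_subnest (small_on (e/2) (X n))" using X(1) e by (simp add: ringrose_ideal_def)
    then show ?thesis
    proof (rule finite_subnest_mono)
      fix M N assume "small_on (e/2) (X n) (N \<inter> ocomp M)"
      from small_on_perturb[OF this, of T "e/2"] n show "small_on e T (N \<inter> ocomp M)"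
        by (simp add: norm_minus_commute)
    qed
  qed
  ultimately show "T \<in> ringrose_ideal" by (simp add: ringrose_ideal_def)
qed

section \<open>Corners and the block decomposition along a finite subnest\<close>

definition corner :: "'h set \<Rightarrow> ('h \<Rightarrow>\<^sub>L 'h) \<Rightarrow> 'h \<Rightarrow>\<^sub>L 'h" where
  "corner P T = cproj P o\<^sub>L (T o\<^sub>L (id_blinfun - cproj P))"

lemma corner_apply: "corner P T x = cproj P (T (x - cproj P x))"
  by (simp add: corner_def blinfun.diff_left)

lemma Alg_corner: "P \<in> \<N> \<Longrightarrow> T \<in> Alg \<Longrightarrow> corner P T \<in> Alg"
  unfolding corner_def by (intro Alg_comp Alg_diff Alg_cproj Alg_id)

text \<open>\<open>b\<close> keeps the range of the corner inside \<open>P\<close>, where the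
  right-hand factor \<open>id_blinfun - cproj P\<close> vanishes.\<close>

lemma corner_sandwich:
  assumes P: "P \<in> \<N>" and b: "b \<in> Alg"
  shows "corner P T o\<^sub>L (b o\<^sub>L corner P T) = 0"
proof (rule blinfun_eqI)
  fix x
  note cP = closed_csubspace_nest[OF P]
  have "b (corner P T x) \<in> P" unfolding corner_apply by (intro Alg_apply[OF b P] cproj_in cP)
  then show "(corner P T o\<^sub>L (b o\<^sub>L corner P T)) x = (0 :: 'h \<Rightarrow>\<^sub>L 'h) x"
    using cproj_id[OF cP] by (simp add: corner_apply)
qed

text \<open>
  Induction along the finite subnest: the step from \<open>N\<close> to \<open>N'\<close>, with \<open>E\<close> the projection onto
  \<open>N' \<ominus> N\<close>, adds to \<open>D\<close> the orthogonal block \<open>E (a - k) E\<close>, to \<open>k\<close> the block \<open>E k E\<close> and to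
  \<open>u\<close> one corner.
\<close>

lemma block_decomposition:
  assumes a: "a \<in> Alg" and e: "e \<ge> 0"
    and K: "0 \<in> K" "\<And>k l. k \<in> K \<Longrightarrow> l \<in> K \<Longrightarrow> k + l \<in> K"
      "\<And>k b. k \<in> K \<Longrightarrow> b \<in> Alg \<Longrightarrow> b o\<^sub>L (k o\<^sub>L b) \<in> K"
    and U: "0 \<in> U" "\<And>u v. u \<in> U \<Longrightarrow> v \<in> U \<Longrightarrow> u + v \<in> U"
      "\<And>P b. P \<in> \<N> \<Longrightarrow> b \<in> Alg \<Longrightarrow> corner P (a o\<^sub>L b) \<in> U"
    and fin: "finite_subnest (\<lambda>V. \<exists>k\<in>K. small_on e (a - k) V)"
  obtains D u k where "a = D + u + k" "norm D \<le> e" "u \<in> U" "k \<in> K"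
proof -
  let ?B = "\<lambda>V. \<exists>k\<in>K. small_on e (a - k) V"
  \<comment> \<open>Bounding \<open>D x\<close> by the projection onto \<open>N\<close> lets
    orthogonal blocks combine by Pythagoras, so the error \<open>e\<close> does not grow with their
    number. \<open>K\<close> will be zero or the compacts; \<open>U\<close> will be the radical, its
    compact elements, a maximal left ideal, or a closed ideal of the sum.\<close>
  have "\<exists>D u k. a o\<^sub>L cproj N = D + u + k \<and> u \<in> U \<and> k \<in> K \<and>
      (\<forall>x. D x \<in> N \<and> norm (D x) \<le> e * norm (cproj N x))"
    if "({0}, N) \<in> (refine_steps ?B)\<^sup>*" for N
    using that
  proof induction
    case base
    have "cproj {0} x = 0" for x :: 'h
      using cproj_in[OF closed_csubspace_0] by blast
    then have "a o\<^sub>L cproj {0} = 0 + 0 + 0" by (intro blinfun_eqI) simp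
    then show ?case using K(1) U(1) e
      by (intro exI[of _ 0] exI[of _ "0 :: 'h \<Rightarrow>\<^sub>L 'h"] conjI allI) auto
  next
    case (step N N')
    have N: "N \<in> \<N>" "N' \<in> \<N>" "N \<subseteq> N'" "?B (N' \<inter> ocomp N)"
      using step.hyps(2) by (auto simp: refine_steps_def)
    note cN = closed_csubspace_nest[OF N(1)] and cN' = closed_csubspace_nest[OF N(2)]
    let ?V = "N' \<inter> ocomp N"
    have cV: "closed_csubspace ?V" by (rule closed_csubspace_block[OF N(2)])
    define E where "E = cproj ?V"
    have E: "E = cproj N' - cproj N" unfolding E_def by (rule cproj_block[OF N(1-3)])
    have EA: "E \<in> Alg" unfolding E by (intro Alg_diff Alg_cproj N)
    have Ein: "E x \<in> ?V" for x unfolding E_def by (rule cproj_in[OF cV])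
    obtain k' where k': "k' \<in> K" "small_on e (a - k') ?V" using N(4) by blast
    obtain D u k where IH: "a o\<^sub>L cproj N = D + u + k" "u \<in> U" "k \<in> K"
      "\<And>x. D x \<in> N" "\<And>x. norm (D x) \<le> e * norm (cproj N x)" using step.IH by blast
    define F where "F = E o\<^sub>L ((a - k') o\<^sub>L E)"
    \<comment> \<open>\<open>a\<close> maps the new block into \<open>N'\<close>, so only components
      in the block and in \<open>N\<close> occur. The latter is a corner because \<open>E\<close>
      vanishes on \<open>N\<close>.\<close>
    have "a (E x) = E (a (E x)) + corner N (a o\<^sub>L E) x" for x
    proof -
      have "cproj N x \<in> ocomp ?V"
        by (rule subsetD[OF ocomp_antimono[OF Int_lower2] subset_ocomp_ocomp[OF cproj_in[OF cN]]])
      then have EN: "E (cproj N x) = 0" unfolding E_def by (rule cproj_ocomp[OF cV])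
      have "corner N (a o\<^sub>L E) x = cproj N (a (E x))"
        by (simp add: corner_apply blinfun.diff_right EN)
      moreover have "a (E x) \<in> N'" using Ein by (intro Alg_apply[OF a N(2)]) auto
      then have "cproj N' (a (E x)) = a (E x)" by (rule cproj_id[OF cN'])
      ultimately show ?thesis by (simp add: E blinfun.diff_left)
    qed
    then have aE: "a o\<^sub>L E = (E o\<^sub>L (a o\<^sub>L E)) + corner N (a o\<^sub>L E)"
      by (intro blinfun_eqI) (simp add: blinfun.add_left)
    have "a o\<^sub>L cproj N' = (a o\<^sub>L cproj N) + (a o\<^sub>L E)"
      by (rule blinfun_eqI) (simp add: E blinfun.add_left blinfun.diff_left blinfun.diff_right)
    also have "E o\<^sub>L (a o\<^sub>L E) = F + (E o\<^sub>L (k' o\<^sub>L E))"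
      by (rule blinfun_eqI) (simp add: F_def blinfun.add_left blinfun.diff_left blinfun.diff_right)
    note aE[unfolded this]
    finally have "a o\<^sub>L cproj N' = (D + F) + (u + corner N (a o\<^sub>L E)) + (k + (E o\<^sub>L (k' o\<^sub>L E)))"
      unfolding IH(1) by (simp add: algebra_simps)
    moreover have "u + corner N (a o\<^sub>L E) \<in> U" by (intro U(2,3) IH(2) N EA)
    moreover have "k + (E o\<^sub>L (k' o\<^sub>L E)) \<in> K" by (intro K(2,3) IH(3) k'(1) EA)
    moreover have "(D + F) x \<in> N' \<and> norm ((D + F) x) \<le> e * norm (cproj N' x)" for x
    proof
      have Fx: "F x \<in> ?V" using Ein by (simp add: F_def)
      have "D x \<in> N'" using IH(4) N(3) by blast
      then show "(D + F) x \<in> N'"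
        using Fx closed_csubspaceD(3)[OF cN'] by (simp add: blinfun.add_left)
      have "cinner (F x) (F x) = cinner ((a - k') (E x)) (F x)"
        using cinner_cproj_left[OF cV Fx, of "(a - k') (E x)"] by (simp add: F_def E_def)
      then have "norm (F x) * norm (F x) \<le> (e * norm (E x)) * norm (F x)"
        using k'(2) Ein[of x] Fx unfolding small_on_def
        by (metis cinner_self norm_of_real abs_of_nonneg power2_eq_square zero_le_power2)
      then have nF: "norm (F x) \<le> e * norm (E x)"
        using e by (cases "F x = 0") (auto dest: mult_right_le_imp_le)
      have "cinner (D x) (F x) = 0" using ocompD'[of "F x" N "D x"] Fx IH(4) by blast
      then have "(norm ((D + F) x))\<^sup>2 = (norm (D x))\<^sup>2 + (norm (F x))\<^sup>2"
        by (simp add: blinfun.add_left norm_Pythagoras)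
      also have "\<dots> \<le> (e * norm (cproj N x))\<^sup>2 + (e * norm (E x))\<^sup>2"
        using nF IH(5) by (intro add_mono power_mono) auto
      also have "\<dots> = e\<^sup>2 * ((norm (cproj N x))\<^sup>2 + (norm (E x))\<^sup>2)"
        by (simp add: power_mult_distrib algebra_simps)
      also have "(norm (cproj N x))\<^sup>2 + (norm (E x))\<^sup>2 = (norm (cproj N' x))\<^sup>2"
      proof -
        have "cinner (cproj N x) (E x) = 0"
          using ocompD'[of "E x" N "cproj N x"] Ein[of x] cproj_in[OF cN] by blast
        from norm_Pythagoras[OF this] show ?thesis by (simp add: E blinfun.diff_left)
      qed
      finally have "(norm ((D + F) x))\<^sup>2 \<le> (e * norm (cproj N' x))\<^sup>2" by (simp add: power_mult_distrib)
      then show "norm ((D + F) x) \<le> e * norm (cproj N' x)" using e by (simp add: abs_le_square_iff[symmetric])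
    qed
    ultimately show ?case by blast
  qed
  from this[OF fin[unfolded finite_subnest_def]]
  obtain D u k where D: "a o\<^sub>L cproj UNIV = D + u + k" "u \<in> U" "k \<in> K"
    "\<And>x. norm (D x) \<le> e * norm (cproj UNIV x)" by blast
  have id: "cproj UNIV x = x" for x :: 'h by (rule cproj_id[OF closed_csubspace_UNIV]) simp
  have "a o\<^sub>L cproj UNIV = a" by (rule blinfun_eqI) (simp add: id)
  then have "a = D + u + k" using D(1) by simp
  moreover have "norm D \<le> e" using D(4) e by (intro norm_blinfun_bound) (simp_all add: id)
  ultimately show thesis using D(2,3) that by blast
qed


section \<open>Maximal left ideals and one-sided inverses modulo the radical\<close>

abbreviation jac :: "('h \<Rightarrow>\<^sub>L 'h) set" where
  "jac \<equiv> jacobson_radical (nest_algebra \<N>)"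

abbreviation maximal_left :: "('h \<Rightarrow>\<^sub>L 'h) set \<Rightarrow> bool" where
  "maximal_left \<equiv> maximal_modular_left_ideal (nest_algebra \<N>)"

lemma left_ideal_iff:
  "left_ideal (nest_algebra \<N>) L \<longleftrightarrow> L \<subseteq> Alg \<and> 0 \<in> L \<and> (\<forall>x\<in>L. \<forall>y\<in>L. x + y \<in> L) \<and>
    (\<forall>a\<in>Alg. \<forall>x\<in>L. a o\<^sub>L x \<in> L)"
proof -
  have "scale c x \<in> L" if "\<forall>a\<in>Alg. \<forall>x\<in>L. a o\<^sub>L x \<in> L" "x \<in> L" for c x
    using that Alg_scale[OF Alg_id] by (subst scale_eq_comp) blast
  then show ?thesis unfolding left_ideal_def alg_subspace_def nest_algebra_ops by blast
qed

lemma left_ideal_eq_Alg: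
  assumes L: "left_ideal (nest_algebra \<N>) L" and "id_blinfun \<in> L"
  shows "L = Alg"
proof
  show "L \<subseteq> Alg" using L by (simp add: left_ideal_iff)
  show "Alg \<subseteq> L"
  proof
    fix a assume "a \<in> Alg"
    then have "a o\<^sub>L id_blinfun \<in> L" using L assms(2) unfolding left_ideal_iff by blast
    moreover have "a o\<^sub>L id_blinfun = a" by (rule blinfun_eqI) simp
    ultimately show "a \<in> L" by simp
  qed
qed

lemma maximal_left_iff:
  "maximal_left L \<longleftrightarrow> left_ideal (nest_algebra \<N>) L \<and> id_blinfun \<notin> L \<and>
    (\<forall>L'. left_ideal (nest_algebra \<N>) L' \<and> L \<subseteq> L' \<and> id_blinfun \<notin> L' \<longrightarrow> L' = L)"
proof -
  have "modular_left_ideal (nest_algebra \<N>) L \<longleftrightarrow> left_ideal (nest_algebra \<N>) L" for L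
  proof -
    have "x o\<^sub>L id_blinfun = x" for x :: "'h \<Rightarrow>\<^sub>L 'h" by (rule blinfun_eqI) simp
    then show ?thesis using Alg_id
      by (auto simp: modular_left_ideal_def aminus_nest_algebra left_ideal_iff intro!: bexI[of _ id_blinfun])
  qed
  moreover have "L = Alg \<longleftrightarrow> id_blinfun \<in> L" if "left_ideal (nest_algebra \<N>) L" for L
    using left_ideal_eq_Alg[OF that] Alg_id by blast
  ultimately show ?thesis unfolding maximal_modular_left_ideal_def by blast
qed

text \<open>The left ideal generated by \<open>L\<close> and \<open>s\<close> is strictly larger
  than \<open>L\<close>, hence contains the identity.\<close>

lemma not_in_maximal_left:
  assumes L: "maximal_left L" and s: "s \<in> Alg" "s \<notin> L"
  obtains b where "b \<in> Alg" "id_blinfun - (b o\<^sub>L s) \<in> L"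
proof -
  have LI: "L \<subseteq> Alg" "0 \<in> L" "\<And>x y. x \<in> L \<Longrightarrow> y \<in> L \<Longrightarrow> x + y \<in> L" "\<And>a x. a \<in> Alg \<Longrightarrow> x \<in> L \<Longrightarrow> a o\<^sub>L x \<in> L"
    using L unfolding maximal_left_iff left_ideal_iff by blast+
  let ?L' = "{l + (b o\<^sub>L s) | l b. l \<in> L \<and> b \<in> Alg}"
  have "left_ideal (nest_algebra \<N>) ?L'"
    unfolding left_ideal_iff
  proof (intro conjI ballI)
    show "?L' \<subseteq> Alg" using LI(1) s(1) Alg_add Alg_comp by blast
    have "0 + (0 o\<^sub>L s) \<in> ?L'" using LI(2) Alg_0 by blast
    then show "0 \<in> ?L'" by simp
    fix x assume "x \<in> ?L'"
    then obtain l b where x: "x = l + (b o\<^sub>L s)" "l \<in> L" "b \<in> Alg" by blast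
    {
      fix y assume "y \<in> ?L'"
      then obtain m c where y: "y = m + (c o\<^sub>L s)" "m \<in> L" "c \<in> Alg" by blast
      have "x + y = (l + m) + ((b + c) o\<^sub>L s)"
        by (rule blinfun_eqI) (simp add: x y blinfun.add_left)
      then show "x + y \<in> ?L'" using LI(3)[OF x(2) y(2)] Alg_add[OF x(3) y(3)] by blast
    }
    fix a assume a: "a \<in> Alg"
    have "a o\<^sub>L x = (a o\<^sub>L l) + ((a o\<^sub>L b) o\<^sub>L s)"
      by (rule blinfun_eqI) (simp add: x blinfun.add_left blinfun.add_right)
    then show "a o\<^sub>L x \<in> ?L'" using LI(4)[OF a x(2)] Alg_comp[OF a x(3)] by blast
  qed
  moreover have "L \<subseteq> ?L'"
  proof
    fix l assume "l \<in> L"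
    then have "l + (0 o\<^sub>L s) \<in> ?L'" using Alg_0 by blast
    then show "l \<in> ?L'" by simp
  qed
  moreover have "?L' \<noteq> L"
  proof -
    have "0 + (id_blinfun o\<^sub>L s) \<in> ?L'" using LI(2) Alg_id by blast
    moreover have "id_blinfun o\<^sub>L s = s" by (rule blinfun_eqI) simp
    ultimately show ?thesis using s(2) by auto
  qed
  ultimately have "id_blinfun \<in> ?L'" using L unfolding maximal_left_iff by blast
  then obtain l b where lb: "id_blinfun = l + (b o\<^sub>L s)" "l \<in> L" "b \<in> Alg" by blast
  have "id_blinfun - (b o\<^sub>L s) = l" by (subst lb(1)) simp
  then show thesis using that lb(2,3) by metis
qed

text \<open>For a corner \<open>s\<close> the product \<open>b s\<close> has square zero, so
  \<open>1 + b s\<close> is a left inverse of \<open>1 - b s\<close>, and no proper left ideal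
  contains \<open>1 - b s\<close>.\<close>

lemma corner_in_jac:
  assumes P: "P \<in> \<N>" and T: "T \<in> Alg"
  shows "corner P T \<in> jac"
  unfolding jacobson_radical_def
proof (intro CollectI conjI allI impI)
  let ?s = "corner P T"
  show s: "?s \<in> Alg" by (rule Alg_corner[OF P T])
  fix L assume L: "maximal_left L"
  show "?s \<in> L"
  proof (rule ccontr)
    assume "?s \<notin> L"
    then obtain b where b: "b \<in> Alg" "id_blinfun - (b o\<^sub>L ?s) \<in> L"
      using not_in_maximal_left[OF L s] by blast
    have "id_blinfun + (b o\<^sub>L ?s) \<in> Alg" by (intro Alg_add Alg_id Alg_comp b s)
    then have "(id_blinfun + (b o\<^sub>L ?s)) o\<^sub>L (id_blinfun - (b o\<^sub>L ?s)) \<in> L"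
      using L b(2) unfolding maximal_left_iff left_ideal_iff by blast
    moreover have "(id_blinfun + (b o\<^sub>L ?s)) o\<^sub>L (id_blinfun - (b o\<^sub>L ?s)) = id_blinfun"
    proof (rule blinfun_eqI)
      fix x
      have "?s (b (?s x)) = 0"
        using arg_cong[OF corner_sandwich[OF P b(1), of T], of "\<lambda>f. f x"] by simp
      then show "((id_blinfun + (b o\<^sub>L ?s)) o\<^sub>L (id_blinfun - (b o\<^sub>L ?s))) x = id_blinfun x"
        by (simp add: blinfun.add_left blinfun.diff_left blinfun.diff_right blinfun.add_right)
    qed
    ultimately show False using L unfolding maximal_left_iff by simp
  qed
qed

text \<open>The inverse is the fixed point of the contraction taking \<open>G\<close> to
  \<open>1 + G D\<close> on the complete set \<open>Alg\<close>; this replaces the Neumann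
  series.\<close>

lemma Neumann_left_inverse:
  assumes D: "D \<in> Alg" "norm D < 1"
  obtains G where "G \<in> Alg" "G o\<^sub>L (id_blinfun - D) = id_blinfun"
proof -
  have "\<exists>!G\<in>Alg. id_blinfun + (G o\<^sub>L D) = G"
  proof (rule Banach_fix[where c = "norm D"])
    show "complete Alg" using closed_Alg by (simp add: complete_eq_closed)
    show "Alg \<noteq> {}" using Alg_0 by blast
    show "(\<lambda>G. id_blinfun + (G o\<^sub>L D)) ` Alg \<subseteq> Alg" using D(1) Alg_add Alg_comp Alg_id by blast
    fix x y assume "x \<in> Alg" "y \<in> Alg"
    have "(id_blinfun + (x o\<^sub>L D)) - (id_blinfun + (y o\<^sub>L D)) = (x - y) o\<^sub>L D"
      by (rule blinfun_eqI) (simp add: blinfun.diff_left blinfun.add_left)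
    then show "dist (id_blinfun + (x o\<^sub>L D)) (id_blinfun + (y o\<^sub>L D)) \<le> norm D * dist x y"
      using norm_blinfun_compose[of "x - y" D] by (simp only: dist_norm mult.commute)
  qed (use D in auto)
  then obtain G where G: "G \<in> Alg" "id_blinfun + (G o\<^sub>L D) = G" by blast
  have "G o\<^sub>L (id_blinfun - D) = G - (G o\<^sub>L D)"
    by (rule blinfun_eqI) (simp add: blinfun.diff_left blinfun.diff_right)
  also have "\<dots> = id_blinfun" using G(2) by (metis add_diff_cancel_right')
  finally show thesis using G(1) that by blast
qed

lemma finite_subnest_minus_0:
  assumes "finite_subnest (small_on e a)"
  shows "finite_subnest (\<lambda>V. \<exists>k\<in>{0}. small_on e (a - k) V)"
  using assms by simp

text \<open>If \<open>T\<close> is outside a maximal left ideal \<open>L\<close>, some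
  \<open>1 - b T\<close> lies in \<open>L\<close>. The operator \<open>b T\<close> again has small
  blocks, hence is a sum of corners, which belong to \<open>L\<close>, and some \<open>D\<close> of
  norm at most 1/2. Then the left invertible \<open>1 - D\<close> lies in \<open>L\<close>.\<close>

lemma ringrose_subset_jac: "ringrose_ideal \<subseteq> jac"
proof
  fix T assume T: "T \<in> ringrose_ideal"
  show "T \<in> jac"
    unfolding jacobson_radical_def
  proof (intro CollectI conjI allI impI ringrose_Alg[OF T])
    fix L assume L: "maximal_left L"
    have LI: "L \<subseteq> Alg" "0 \<in> L" "\<And>x y. x \<in> L \<Longrightarrow> y \<in> L \<Longrightarrow> x + y \<in> L" "\<And>a x. a \<in> Alg \<Longrightarrow> x \<in> L \<Longrightarrow> a o\<^sub>L x \<in> L"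
      using L unfolding maximal_left_iff left_ideal_iff by blast+
    show "T \<in> L"
    proof (rule ccontr)
      assume "T \<notin> L"
      then obtain b where b: "b \<in> Alg" "id_blinfun - (b o\<^sub>L T) \<in> L"
        using not_in_maximal_left[OF L ringrose_Alg[OF T]] by metis
      have bT: "b o\<^sub>L T \<in> ringrose_ideal" by (rule ringrose_left[OF T b(1)])
      then have "finite_subnest (small_on (1/2) (b o\<^sub>L T))" by (simp add: ringrose_ideal_def)
      note fin = finite_subnest_minus_0[OF this]
      obtain D u k where D: "b o\<^sub>L T = D + u + k" "norm D \<le> 1/2" "u \<in> L" "k \<in> {0}"
      proof (rule block_decomposition[OF ringrose_Alg[OF bT] _ _ _ _ LI(2,3) _ fin])
        show "corner P ((b o\<^sub>L T) o\<^sub>L c) \<in> L" if "P \<in> \<N>" "c \<in> Alg" for P c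
          using corner_in_jac[OF that(1) Alg_comp[OF ringrose_Alg[OF bT] that(2)]] L
          unfolding jacobson_radical_def by blast
      qed (auto simp: that)
      have D': "D = (b o\<^sub>L T) - u" using D(1,4) by simp
      have DA: "D \<in> Alg" unfolding D' using D(3) LI(1) by (intro Alg_diff ringrose_Alg[OF bT]) auto
      have "norm D < 1" using D(2) by simp
      then obtain G where G: "G \<in> Alg" "G o\<^sub>L (id_blinfun - D) = id_blinfun"
        using Neumann_left_inverse[OF DA] by metis
      have "(id_blinfun - (b o\<^sub>L T)) + u \<in> L" by (rule LI(3)[OF b(2) D(3)])
      then have "id_blinfun - D \<in> L" by (simp add: D' algebra_simps)
      then have "id_blinfun \<in> L" using LI(4)[OF G(1)] G(2) by metis
      then show False using L unfolding maximal_left_iff by blast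
    qed
  qed
qed

text \<open>If the left ideal generated by \<open>1 - b a\<close> were proper, Zorn's lemma would
  place it in a maximal one. This contains \<open>a\<close>, therefore \<open>b a\<close>, and so
  the identity.\<close>

lemma jac_left_inverse:
  assumes a: "a \<in> jac" and b: "b \<in> Alg"
  obtains c where "c \<in> Alg" "c o\<^sub>L (id_blinfun - (b o\<^sub>L a)) = id_blinfun"
proof -
  have aA: "a \<in> Alg" using a by (simp add: jacobson_radical_def)
  let ?t = "id_blinfun - (b o\<^sub>L a)"
  have t: "?t \<in> Alg" by (intro Alg_diff Alg_id Alg_comp aA b)
  let ?L0 = "(\<lambda>c. c o\<^sub>L ?t) ` Alg"
  have L0: "left_ideal (nest_algebra \<N>) ?L0"
    unfolding left_ideal_iff
  proof (intro conjI ballI)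
    show "?L0 \<subseteq> Alg" using t Alg_comp by blast
    have "0 = 0 o\<^sub>L ?t" by simp
    then show "0 \<in> ?L0" using Alg_0 by (rule image_eqI)
    fix x assume "x \<in> ?L0"
    then obtain c where c: "x = c o\<^sub>L ?t" "c \<in> Alg" by blast
    {
      fix y assume "y \<in> ?L0"
      then obtain d where d: "y = d o\<^sub>L ?t" "d \<in> Alg" by blast
      have "x + y = (c + d) o\<^sub>L ?t" by (rule blinfun_eqI) (simp add: c d blinfun.add_left)
      then show "x + y \<in> ?L0" using Alg_add[OF c(2) d(2)] by (rule image_eqI)
    }
    fix e assume e: "e \<in> Alg"
    have "e o\<^sub>L x = (e o\<^sub>L c) o\<^sub>L ?t" by (rule blinfun_eqI) (simp add: c)
    then show "e o\<^sub>L x \<in> ?L0" using Alg_comp[OF e c(2)] by (rule image_eqI)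
  qed
  have "id_blinfun \<in> ?L0"
  proof (rule ccontr)
    assume no: "id_blinfun \<notin> ?L0"
    let ?\<A> = "{L. left_ideal (nest_algebra \<N>) L \<and> ?L0 \<subseteq> L \<and> id_blinfun \<notin> L}"
    have "\<exists>M\<in>?\<A>. \<forall>X\<in>?\<A>. M \<subseteq> X \<longrightarrow> X = M"
    proof (rule subset_Zorn_nonempty)
      show "?\<A> \<noteq> {}" using L0 no by blast
      fix C assume C: "C \<noteq> {}" "subset.chain ?\<A> C"
      then have CA: "C \<subseteq> ?\<A>" and ch: "\<And>X Y. X \<in> C \<Longrightarrow> Y \<in> C \<Longrightarrow> X \<subseteq> Y \<or> Y \<subseteq> X"
        by (auto simp: subset_chain_def)
      have CL: "X \<subseteq> Alg" "0 \<in> X" "\<And>x y. x \<in> X \<Longrightarrow> y \<in> X \<Longrightarrow> x + y \<in> X"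
        "\<And>a x. a \<in> Alg \<Longrightarrow> x \<in> X \<Longrightarrow> a o\<^sub>L x \<in> X" "?L0 \<subseteq> X" "id_blinfun \<notin> X" if "X \<in> C" for X
      proof -
        have "left_ideal (nest_algebra \<N>) X" "?L0 \<subseteq> X" "id_blinfun \<notin> X" using CA that by blast+
        then show "X \<subseteq> Alg" "0 \<in> X" "\<And>x y. x \<in> X \<Longrightarrow> y \<in> X \<Longrightarrow> x + y \<in> X"
          "\<And>a x. a \<in> Alg \<Longrightarrow> x \<in> X \<Longrightarrow> a o\<^sub>L x \<in> X" "?L0 \<subseteq> X" "id_blinfun \<notin> X"
          unfolding left_ideal_iff by blast+
      qed
      obtain X0 where X0: "X0 \<in> C" using C(1) by blast
      have "left_ideal (nest_algebra \<N>) (\<Union>C)"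
        unfolding left_ideal_iff
      proof (intro conjI ballI)
        show "\<Union>C \<subseteq> Alg" using CL(1) by blast
        show "0 \<in> \<Union>C" using CL(2) X0 by blast
        fix x assume "x \<in> \<Union>C"
        then obtain X where X: "X \<in> C" "x \<in> X" by blast
        {
          fix y assume "y \<in> \<Union>C"
          then obtain Y where Y: "Y \<in> C" "y \<in> Y" by blast
          from ch[OF X(1) Y(1)] show "x + y \<in> \<Union>C"
          proof
            assume "X \<subseteq> Y"
            then have "x + y \<in> Y" using X Y by (intro CL(3)[OF Y(1)]) auto
            then show ?thesis using Y(1) by blast
          next
            assume "Y \<subseteq> X"
            then have "x + y \<in> X" using X Y by (intro CL(3)[OF X(1)]) auto
            then show ?thesis using X(1) by blast
          qed
        }
        show "e o\<^sub>L x \<in> \<Union>C" if "e \<in> Alg" for e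
          using CL(4)[OF X(1) that X(2)] X(1) by blast
      qed
      moreover have "?L0 \<subseteq> \<Union>C" using CL(5)[OF X0] X0 by blast
      moreover have "id_blinfun \<notin> \<Union>C" using CL(6) by blast
      ultimately show "\<Union>C \<in> ?\<A>" by blast
    qed
    then obtain L where LA: "L \<in> ?\<A>" and mx0: "\<forall>X\<in>?\<A>. L \<subseteq> X \<longrightarrow> X = L" by (elim bexE)
    have L: "left_ideal (nest_algebra \<N>) L" "?L0 \<subseteq> L" "id_blinfun \<notin> L" using LA by simp_all
    have mx: "X = L" if "left_ideal (nest_algebra \<N>) X" "?L0 \<subseteq> X" "id_blinfun \<notin> X" "L \<subseteq> X" for X
      using mx0 that by simp
    have "maximal_left L"
      unfolding maximal_left_iff
    proof (intro conjI allI impI L, elim conjE)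
      fix L' assume L': "left_ideal (nest_algebra \<N>) L'" "L \<subseteq> L'" "id_blinfun \<notin> L'"
      show "L' = L" by (rule mx[OF L'(1) order_trans[OF L(2) L'(2)] L'(3,2)])
    qed
    then have "a \<in> L" using a unfolding jacobson_radical_def by blast
    then have "b o\<^sub>L a \<in> L" using L(1) b unfolding left_ideal_iff by blast
    moreover have "?t \<in> L"
    proof -
      have "?t = id_blinfun o\<^sub>L ?t" by (rule blinfun_eqI) simp
      then have "?t \<in> ?L0" using Alg_id by (rule image_eqI)
      then show ?thesis using L(2) by blast
    qed
    ultimately have "?t + (b o\<^sub>L a) \<in> L" using L(1) unfolding left_ideal_iff by blast
    then show False using L(3) by simp
  qed
  then obtain c where c: "id_blinfun = c o\<^sub>L ?t" "c \<in> Alg" by (rule imageE)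
  show thesis by (rule that[OF c(2) c(1)[symmetric]])
qed

text \<open>The left inverse satisfies \<open>c = 1 + c b a\<close>, which again has the form
  \<open>1 - b' a\<close> with \<open>b'\<close> in the algebra. So \<open>c\<close> has a left
  inverse too, and this must be \<open>1 - b a\<close>.\<close>

lemma jac_right_inverse:
  assumes a: "a \<in> jac" and b: "b \<in> Alg"
  obtains c where "c \<in> Alg" "(id_blinfun - (b o\<^sub>L a)) o\<^sub>L c = id_blinfun"
proof -
  let ?t = "id_blinfun - (b o\<^sub>L a)"
  obtain c where c: "c \<in> Alg" "c o\<^sub>L ?t = id_blinfun" using jac_left_inverse[OF a b] by blast
  have "0 - (c o\<^sub>L b) \<in> Alg" by (intro Alg_diff Alg_0 Alg_comp c b)
  then obtain d where d: "d \<in> Alg" "d o\<^sub>L (id_blinfun - ((0 - (c o\<^sub>L b)) o\<^sub>L a)) = id_blinfun"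
    using jac_left_inverse[OF a] by blast
  have cx: "c (x - b (a x)) = x" for x
    using arg_cong[OF c(2), of "\<lambda>f. f x"] by (simp add: blinfun.diff_left)
  have "id_blinfun - ((0 - (c o\<^sub>L b)) o\<^sub>L a) = c"
  proof (rule blinfun_eqI)
    fix x
    have "c x - c (b (a x)) = x" using cx[of x] by (simp add: blinfun.diff_right)
    then show "(id_blinfun - ((0 - (c o\<^sub>L b)) o\<^sub>L a)) x = c x"
      by (simp add: blinfun.diff_left blinfun.minus_left diff_eq_eq)
  qed
  then have dc: "d (c x) = x" for x
    using arg_cong[OF d(2), of "\<lambda>f. f x"] by simp
  have "d x = ?t x" for x
    using dc[of "?t x"] cx[of x] by (simp add: blinfun.diff_left)
  then have "?t o\<^sub>L c = id_blinfun" using dc by (intro blinfun_eqI) simp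
  then show thesis using c(1) that by blast
qed

section \<open>Shifts in the nest algebra and the converse half of Ringrose's theorem\<close>

text \<open>\<open>S\<close> sends \<open>v\<close> to the sum over \<open>k\<close> in
  \<open>I\<close> of \<open>cinner v (y k)\<close> times \<open>x (\<sigma> k)\<close>, divided by
  the diagonal entry of \<open>a\<close> at \<open>k\<close>. The entries are at least
  \<open>\<eta>\<close> in modulus, injectivity keeps the images orthogonal, and diagonality leaves
  one term of \<open>S (a (x k))\<close>. The last conclusion confines the range of \<open>S\<close>
  to the closed span of the vectors \<open>x (\<sigma> k)\<close>.\<close>

lemma shift_operator:
  assumes dg: "diagonal_sequences a \<eta> x y" and \<eta>: "\<eta> > 0"
    and inj: "inj_on \<sigma> I" and \<sigma>: "\<And>k P. k \<in> I \<Longrightarrow> P \<in> \<N> \<Longrightarrow> x (\<sigma> k) \<in> P \<or> y k \<in> ocomp P"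
  obtains S where "S \<in> Alg" "norm S \<le> 1 / \<eta>" "\<And>k. S (a (x k)) = (if k \<in> I then x (\<sigma> k) else 0)"
    "\<And>W v. closed_csubspace W \<Longrightarrow> (\<And>k. k \<in> I \<Longrightarrow> x (\<sigma> k) \<in> W) \<Longrightarrow> S v \<in> W"
proof -
  have d: "norm (x n) = 1" "norm (y n) = 1" "cmod (cinner (a (x n)) (y n)) \<ge> \<eta>"
    "m \<noteq> n \<Longrightarrow> cinner (x m) (x n) = 0" "m \<noteq> n \<Longrightarrow> cinner (y m) (y n) = 0"
    "m \<noteq> n \<Longrightarrow> cinner (a (x m)) (y n) = 0" for m n
    using dg unfolding diagonal_sequences_def by blast+
  define g where "g k = (if k \<in> I then (1 / cinner (a (x k)) (y k)) *\<^sub>C x (\<sigma> k) else 0)" for k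
  have ng: "norm (g k) \<le> 1 / \<eta>" for k
    using d(3)[of k] \<eta> by (auto simp: g_def norm_scaleC norm_divide d(1) frac_le)
  have og: "cinner (g m) (g n) = 0" if "m \<noteq> n" for m n
    using that inj d(4)[of "\<sigma> m" "\<sigma> n"]
    by (auto simp: g_def cinner_scaleC_left cinner_scaleC_right cinner.zero_left cinner.zero_right inj_on_def)
  obtain S where S: "S \<in> bounded_operators" "norm S \<le> 1 / \<eta>"
    "\<And>v. (\<lambda>k. cinner v (y k) *\<^sub>C g k) sums blinfun_apply S v"
    using orthonormal_series_operator[where y = y and g = g, OF d(2) d(5) ng og] by blast
  show thesis
  proof (rule that[OF _ S(2)])
    show "S \<in> Alg"
      unfolding Alg_iff
    proof (intro conjI ballI S(1))
      fix M v assume M: "M \<in> \<N>" "v \<in> M"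
      note cM = closed_csubspace_nest[OF M(1)]
      show "S v \<in> M"
      proof (rule sums_in_closed_csubspace[OF cM _ S(3)])
        fix k
        show "cinner v (y k) *\<^sub>C g k \<in> M"
        proof (cases "k \<in> I \<and> x (\<sigma> k) \<in> M")
          case True
          then show ?thesis by (simp add: g_def closed_csubspaceD(4)[OF cM])
        next
          case False
          have "g k = 0 \<or> cinner v (y k) = 0"
            using False \<sigma>[of k M] M ocompD'[of "y k" M v] by (auto simp: g_def)
          then show ?thesis using closed_csubspaceD(2)[OF cM] by auto
        qed
      qed
    qed
    show "S (a (x k)) = (if k \<in> I then x (\<sigma> k) else 0)" for k
    proof -
      have "(\<lambda>j. cinner (a (x k)) (y j) *\<^sub>C g j) = (\<lambda>j. if j = k then cinner (a (x k)) (y k) *\<^sub>C g k else 0)"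
        using d(6)[of k] by (auto simp: fun_eq_iff)
      then have "S (a (x k)) = cinner (a (x k)) (y k) *\<^sub>C g k"
        using S(3)[of "a (x k)"] sums_unique2 sums_single[of k "\<lambda>j. cinner (a (x k)) (y k) *\<^sub>C g k"] by metis
      moreover have "cinner (a (x k)) (y k) \<noteq> 0" using d(3)[of k] \<eta> by auto
      ultimately show ?thesis by (simp add: g_def scaleC_scaleC)
    qed
    show "S v \<in> W" if W: "closed_csubspace W" "\<And>k. k \<in> I \<Longrightarrow> x (\<sigma> k) \<in> W" for W v
      by (rule sums_in_closed_csubspace[OF W(1) _ S(3)])
        (auto simp: g_def W closed_csubspaceD(2,4)[OF W(1)])
  qed
qed

text \<open>
  For a suitable \<open>S\<close> in the nest algebra, \<open>S a\<close> acts on \<open>x\<close> as a backward or a forward shift, so that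
  \<open>v = \<Sum>k. 2\<^sup>-\<^sup>k x k\<close> is fixed by \<open>2 S a\<close> or annihilates the range of \<open>1 - 2 S a\<close> on the span of
  \<open>x\<close>; in both cases \<open>1 - 2 S a\<close> is not invertible.
\<close>

lemma diagonal_sequences_not_jac:
  assumes dg: "diagonal_sequences a \<eta> x y" and \<eta>: "\<eta> > 0"
  shows "a \<notin> jac"
proof
  assume a: "a \<in> jac"
  have d: "norm (x n) = 1" "m \<noteq> n \<Longrightarrow> cinner (x m) (x n) = 0" for m n
    using dg unfolding diagonal_sequences_def by blast+
  have xx: "cinner (x n) (x n) = 1" for n using d(1) norm_eq_1_iff_cinner by blast
  let ?f = "\<lambda>k. (1/2) ^ k *\<^sub>R x k"
  define v where "v = suminf ?f"
  have smf: "summable ?f"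
    by (rule summable_norm_cancel) (simp add: d(1) summable_geometric)
  have vx: "cinner v (x k) = (1/2) ^ k" for k
  proof -
    have "(\<lambda>j. cinner (?f j) (x k)) sums cinner v (x k)"
      unfolding v_def by (intro bounded_linear.sums[OF cinner.bounded_linear_left] summable_sums smf)
    moreover have "(\<lambda>j. cinner (?f j) (x k)) = (\<lambda>j. if j = k then (1/2) ^ k else 0)"
      using d(2) xx by (auto simp: fun_eq_iff cinner.scaleR_left scaleR_conv_of_real)
    ultimately show ?thesis using sums_single[of k "\<lambda>j. (1/2) ^ k :: complex"] sums_unique2 by metis
  qed
  from dg have "shiftable x y" by (simp add: diagonal_sequences_def)
  then consider "\<forall>n. \<forall>P\<in>\<N>. x n \<in> P \<or> y (Suc n) \<in> ocomp P" | "\<forall>n. \<forall>P\<in>\<N>. x (Suc n) \<in> P \<or> y n \<in> ocomp P"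
    unfolding shiftable_def by blast
  then show False
  proof cases
    case 1
    have "x (k - 1) \<in> P \<or> y k \<in> ocomp P" if "k \<in> {1..}" "P \<in> \<N>" for k P
      using 1[rule_format, of P "k - 1"] that by simp
    moreover have "inj_on (\<lambda>k. k - 1) {1::nat..}" by (auto simp: inj_on_def)
    ultimately obtain S where S: "S \<in> Alg" "\<And>k. S (a (x k)) = (if k \<in> {1..} then x (k - 1) else 0)"
      using shift_operator[OF dg \<eta>, of "\<lambda>k. k - 1" "{1..}"] by metis
    have "(S o\<^sub>L a) v = (\<Sum>k. (S o\<^sub>L a) (?f k))"
      unfolding v_def by (rule bounded_linear.suminf[OF blinfun.bounded_linear_right smf])
    also have "\<dots> = (\<Sum>k. (S o\<^sub>L a) (?f (Suc k))) + (S o\<^sub>L a) (?f 0)"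
      using suminf_split_head[OF bounded_linear.summable[OF blinfun.bounded_linear_right smf, of "S o\<^sub>L a"]] by simp
    also have "\<dots> = (\<Sum>k. (1/2) *\<^sub>R ?f k)" by (simp add: blinfun.scaleR_right S(2))
    also have "\<dots> = (1/2) *\<^sub>R v" unfolding v_def by (rule suminf_scaleR_right[OF smf, symmetric])
    finally have Sv: "S (a v) = (1/2) *\<^sub>R v" by simp
    obtain c where c: "c o\<^sub>L (id_blinfun - ((S + S) o\<^sub>L a)) = id_blinfun"
      using jac_left_inverse[OF a Alg_add[OF S(1) S(1)]] by blast
    have "v = c (v - (S (a v) + S (a v)))"
      using arg_cong[OF c, of "\<lambda>f. f v"] by (simp add: blinfun.diff_left blinfun.add_left)
    also have "\<dots> = 0" unfolding Sv by (simp add: scaleR_add_left[symmetric])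
    finally show False using vx[of 0] by (simp add: cinner.zero_left)
  next
    case 2
    have "x (Suc k) \<in> P \<or> y k \<in> ocomp P" if "k \<in> UNIV" "P \<in> \<N>" for k P
      using 2 that by simp
    moreover have "inj_on Suc UNIV" by simp
    ultimately obtain S where S: "S \<in> Alg" "\<And>k. S (a (x k)) = x (Suc k)"
      "\<And>W v. closed_csubspace W \<Longrightarrow> (\<And>k. x (Suc k) \<in> W) \<Longrightarrow> S v \<in> W"
      using shift_operator[OF dg \<eta>, of Suc UNIV] by (metis UNIV_I)
    obtain c where c: "(id_blinfun - ((S + S) o\<^sub>L a)) o\<^sub>L c = id_blinfun"
      using jac_right_inverse[OF a Alg_add[OF S(1) S(1)]] by blast
    define u where "u = c (x 0)"
    have u: "u - (S (a u) + S (a u)) = x 0"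
      using arg_cong[OF c, of "\<lambda>f. f (x 0)"] by (simp add: u_def blinfun.diff_left blinfun.add_left)
    let ?t = "id_blinfun - ((S + S) o\<^sub>L a)"
    have aA: "a \<in> Alg" using a by (simp add: jacobson_radical_def)
    have tb: "?t \<in> bounded_operators" by (intro Alg_bounded Alg_diff Alg_id Alg_comp Alg_add S(1) aA)
    \<comment> \<open>The vector \<open>u\<close> solves \<open>?t u = x 0\<close>. Once
      \<open>?W\<close> contains every \<open>x k\<close>, it contains \<open>S (a u)\<close> and so
      \<open>u\<close>, which would make the product of \<open>x 0\<close> with \<open>v\<close>
      zero although it equals 1.\<close>
    let ?W = "{w. cinner (?t w) v = 0}"
    have W: "closed_csubspace ?W"
    proof (rule closed_csubspaceI)
      show "closed ?W"
        by (intro closed_Collect_eq continuous_on_const cinner.continuous_on blinfun.continuous_on continuous_on_id)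
    qed (use tb in \<open>auto simp: blinfun.add_right cinner_add_left bounded_operators_iff cinner_scaleC_left
        cinner.zero_left\<close>)
    \<comment> \<open>\<open>?t (x k)\<close> is \<open>x k - 2 x (Suc k)\<close>, and the geometric
      weights of \<open>v\<close> make its product with \<open>v\<close> vanish.\<close>
    have xW: "x k \<in> ?W" for k
    proof -
      have "cinner (x j) v = (1/2) ^ j" for j
        using vx[of j] cinner_commute[of "x j" v] by simp
      then show ?thesis by (simp add: blinfun.diff_left blinfun.add_left S(2) cinner.diff_left cinner_add_left)
    qed
    have "S (a u) \<in> ?W" using S(3)[OF W xW] .
    then have "x 0 + (S (a u) + S (a u)) \<in> ?W" by (intro closed_csubspaceD(3)[OF W] xW)
    moreover have "x 0 + (S (a u) + S (a u)) = u" using u by (simp add: algebra_simps)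
    ultimately have "u \<in> ?W" by simp
    then have "cinner (x 0) v = 0" using u by (simp add: blinfun.diff_left blinfun.add_left)
    then show False using vx[of 0] cinner_eq_0_sym[of "x 0" v] by simp
  qed
qed

text \<open>When an element of the radical has no fine enough subnest, the two limit cases are
  excluded by \<open>diagonal_sequences_not_jac\<close>. In an atom, arbitrary rank-one operators on
  the block are available and one of them already contradicts invertibility.\<close>

lemma jac_eq_ringrose: "jac = ringrose_ideal"
proof
  show "jac \<subseteq> ringrose_ideal"
  proof
    fix a assume a: "a \<in> jac"
    then have aA: "a \<in> Alg" by (simp add: jacobson_radical_def)
    have "finite_subnest (small_on e a)" if e: "e > 0" for e
    proof (rule ccontr)
      assume "\<not> finite_subnest (small_on e a)"
      then show False
      proof (rule not_finite_subnest_cases[rotated])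
        fix M N assume at: "atom M N" and ns: "\<not> small_on e a (N \<inter> ocomp M)"
        have MN: "M \<in> \<N>" "N \<in> \<N>" "\<And>P. P \<in> \<N> \<Longrightarrow> P \<subseteq> M \<or> N \<subseteq> P" using at by (auto simp: atom_def)
        obtain x y where xy: "x \<in> N \<inter> ocomp M" "y \<in> N \<inter> ocomp M" "cmod (cinner (a x) y) > e * norm x * norm y"
          using ns unfolding small_on_def by (auto simp: not_le)
        define z where "z = cinner (a x) y"
        have "0 \<le> e * norm x * norm y" using e by simp
        then have z: "z \<noteq> 0" using xy(3) by (auto simp: z_def)
        \<comment> \<open>Normalised so that \<open>b (a x) = x\<close>; then \<open>1 - b a\<close>
          kills the nonzero vector \<open>x\<close>.\<close>
        define b where "b = rank_one ((1 / z) *\<^sub>C x) y"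
        have "b \<in> Alg"
          unfolding b_def
        proof (rule Alg_rank_one)
          fix P assume P: "P \<in> \<N>"
          from MN(3)[OF P] show "(1 / z) *\<^sub>C x \<in> P \<or> y \<in> ocomp P"
          proof
            assume "P \<subseteq> M"
            then show ?thesis using ocomp_antimono[of P M] xy(2) by blast
          next
            assume "N \<subseteq> P"
            then show ?thesis using closed_csubspaceD(4)[OF closed_csubspace_nest[OF P]] xy(1) by blast
          qed
        qed
        then obtain c where c: "c o\<^sub>L (id_blinfun - (b o\<^sub>L a)) = id_blinfun"
          using jac_left_inverse[OF a] by blast
        have "b (a x) = x" using z by (simp add: b_def z_def[symmetric] scaleC_scaleC)
        then have "x = 0"
          using arg_cong[OF c, of "\<lambda>f. f x"] by (simp add: blinfun.diff_left)
        then show False using z by (simp add: z_def cinner.zero_left)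
      next
        fix N assume "N \<in> \<N>" "subspace_chain (left_blocks N)" "\<Inter>(left_blocks N) = {0}"
          "\<And>T. T \<in> left_blocks N \<Longrightarrow> \<not> small_on e a T"
        from left_diagonal_sequences[OF this(1-3) aA e this(4)] show False
          using diagonal_sequences_not_jac[of a "e/2"] a e by auto
      next
        fix N assume "N \<in> \<N>" "subspace_chain (right_blocks N)" "\<Inter>(right_blocks N) = {0}"
          "\<And>T. T \<in> right_blocks N \<Longrightarrow> \<not> small_on e a T"
        from right_diagonal_sequences[OF this(1-3) aA e this(4)] show False
          using diagonal_sequences_not_jac[of a "e/2"] a e by auto
      next
        show "small_on e a V" if "V \<subseteq> W" "small_on e a W" for V W
          using that by (rule small_on_subset)
      qed
    qed
    then show "a \<in> ringrose_ideal" using aA by (simp add: ringrose_ideal_def)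
  qed
qed (rule ringrose_subset_jac)

end

section \<open>The sum of the compacts and the radical\<close>

lemma infdist_add_le:
  fixes I :: "'a::real_normed_vector set"
  assumes "I \<noteq> {}" "\<And>i j. i \<in> I \<Longrightarrow> j \<in> I \<Longrightarrow> i + j \<in> I"
  shows "infdist (u + v) I \<le> infdist u I + infdist v I"
proof -
  have 1: "infdist (u + v) I \<le> dist u i + dist v j" if "i \<in> I" "j \<in> I" for i j
    using infdist_le[OF assms(2)[OF that], of "u + v"] norm_triangle_ineq[of "u - i" "v - j"]
    by (simp add: dist_norm algebra_simps)
  have 2: "infdist (u + v) I - dist v j \<le> infdist u I" if "j \<in> I" for j
    unfolding infdist_notempty[OF assms(1), of u] using assms(1) 1[OF _ that]
    by (intro cINF_greatest) (auto simp: algebra_simps)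
  have "infdist (u + v) I - infdist u I \<le> infdist v I"
    unfolding infdist_notempty[OF assms(1), of v] using assms(1) 2
    by (intro cINF_greatest) (auto simp: algebra_simps)
  then show ?thesis by simp
qed

lemma infdist_uminus:
  fixes I :: "'a::real_normed_vector set"
  assumes "\<And>i. i \<in> I \<Longrightarrow> - i \<in> I"
  shows "infdist (- u) I = infdist u I"
proof -
  have le: "infdist (- w) I \<le> infdist w I" for w
  proof (cases "I = {}")
    case False
    show ?thesis
      unfolding infdist_notempty[OF False, of w]
    proof (rule cINF_greatest[OF False])
      fix i assume "i \<in> I"
      from infdist_le[OF assms[OF this], of "- w"] show "infdist (- w) I \<le> dist w i"
        by (simp add: dist_norm norm_minus_commute)
    qed
  qed (simp add: infdist_def)
  show ?thesis using le[of u] le[of "- u"] by simp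
qed

context nest
begin

definition sum_ideal :: "('h \<Rightarrow>\<^sub>L 'h) set" where
  "sum_ideal = {k + r | k r. k \<in> Comp \<and> r \<in> jac}"

lemma jac_Alg: "r \<in> jac \<Longrightarrow> r \<in> Alg"
  and jac_add: "r \<in> jac \<Longrightarrow> s \<in> jac \<Longrightarrow> r + s \<in> jac"
  and jac_0: "0 \<in> jac"
  and jac_uminus: "r \<in> jac \<Longrightarrow> - r \<in> jac"
  and jac_left: "r \<in> jac \<Longrightarrow> a \<in> Alg \<Longrightarrow> a o\<^sub>L r \<in> jac"
  and jac_right: "r \<in> jac \<Longrightarrow> a \<in> Alg \<Longrightarrow> r o\<^sub>L a \<in> jac"
  and closed_jac: "closed jac"
  unfolding jac_eq_ringrose
  by (simp_all add: ringrose_Alg ringrose_add ringrose_0 ringrose_uminus ringrose_left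
      ringrose_right closed_ringrose)

lemma Comp_Alg: "k \<in> Comp \<Longrightarrow> k \<in> Alg"
  by (simp add: Comp_iff)

text \<open>
  A compact operator which is close to the radical has small diagonal along some finite subnest;
  subtracting the diagonal leaves compact corners.
\<close>

lemma Comp_near_jac:
  assumes k: "k \<in> Comp" and r: "r \<in> jac" and d: "norm (k - r) \<le> d" and \<delta>: "\<delta> > 0"
  obtains u where "u \<in> Comp" "u \<in> jac" "norm (k - u) \<le> d + \<delta>"
proof -
  have "finite_subnest (small_on \<delta> r)" using r \<delta> by (simp add: jac_eq_ringrose ringrose_ideal_def)
  then have "finite_subnest (small_on (d + \<delta>) k)"
    by (rule finite_subnest_mono) (rule small_on_perturb[OF _ d])
  note fin = finite_subnest_minus_0[OF this]
  have "d + \<delta> \<ge> 0" using order_trans[OF norm_ge_zero d] \<delta> by simp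
  then obtain D u l where D: "k = D + u + l" "norm D \<le> d + \<delta>" "u \<in> Comp \<inter> jac" "l \<in> {0}"
  proof (rule block_decomposition[OF Comp_Alg[OF k] _ _ _ _ _ _ _ fin])
    show "corner P (k o\<^sub>L b) \<in> Comp \<inter> jac" if "P \<in> \<N>" "b \<in> Alg" for P b
    proof
      show "corner P (k o\<^sub>L b) \<in> jac" by (rule corner_in_jac[OF that(1) Alg_comp[OF Comp_Alg[OF k] that(2)]])
      show "corner P (k o\<^sub>L b) \<in> Comp"
        unfolding corner_def by (intro Comp_left Comp_right k that(2) Alg_cproj Alg_diff Alg_id that(1))
    qed
    show "u + v \<in> Comp \<inter> jac" if "u \<in> Comp \<inter> jac" "v \<in> Comp \<inter> jac" for u v
      using that by (simp add: Comp_add jac_add)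
  qed (auto simp: Comp_0 jac_0 that)
  have "k - u = D" using D(1,4) by simp
  then show thesis using D(2,3) that[of u] by simp
qed

text \<open>\<open>- r\<close> is a radical element at distance \<open>norm q\<close> from
  \<open>k\<close>. With \<open>\<delta> = norm q\<close>, moving an operator \<open>u\<close> that
  is both compact and radical from one summand to the other bounds the first by
  \<open>2 * norm q\<close>, and the triangle inequality bounds the second. The case
  \<open>q = 0\<close> is separate because \<open>\<delta>\<close> must be positive.\<close>

lemma sum_ideal_split:
  assumes q: "q \<in> sum_ideal"
  obtains k r where "q = k + r" "k \<in> Comp" "r \<in> jac" "norm k \<le> 2 * norm q" "norm r \<le> 3 * norm q"
proof (cases "q = 0")
  case True
  then show thesis using that[of 0 0] by (simp add: Comp_0 jac_0)
next
  case False
  obtain k r where kr: "q = k + r" "k \<in> Comp" "r \<in> jac" using q by (auto simp: sum_ideal_def)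
  have "norm (k - - r) \<le> norm q" "norm q > 0" using kr(1) False by simp_all
  then obtain u where u: "u \<in> Comp" "u \<in> jac" "norm (k - u) \<le> norm q + norm q"
    by (rule Comp_near_jac[OF kr(2) jac_uminus[OF kr(3)]])
  have eq: "q = (k - u) + (r + u)" using kr(1) by simp
  then have "norm (r + u) \<le> norm q + norm (k - u)"
    using norm_triangle_ineq4[of q "k - u"] by (metis add_diff_cancel_left')
  then show thesis
    using that[OF eq Comp_diff[OF kr(2) u(1)] jac_add[OF kr(3) u(2)]] u(3) by simp
qed

lemma sum_idealI: "k \<in> Comp \<Longrightarrow> r \<in> jac \<Longrightarrow> k + r \<in> sum_ideal"
  unfolding sum_ideal_def by blast

lemma Comp_sum_ideal: "k \<in> Comp \<Longrightarrow> k \<in> sum_ideal"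
  and jac_sum_ideal: "r \<in> jac \<Longrightarrow> r \<in> sum_ideal"
  using sum_idealI[OF _ jac_0, of k] sum_idealI[OF Comp_0, of r] by simp_all

lemma sum_ideal_Alg: "q \<in> sum_ideal \<Longrightarrow> q \<in> Alg"
  unfolding sum_ideal_def using Alg_add Comp_Alg jac_Alg by blast

lemma sum_ideal_add:
  assumes "p \<in> sum_ideal" "q \<in> sum_ideal"
  shows "p + q \<in> sum_ideal"
proof -
  obtain k r l s where "p = k + r" "q = l + s" "k \<in> Comp" "l \<in> Comp" "r \<in> jac" "s \<in> jac"
    using assms by (auto simp: sum_ideal_def)
  then show ?thesis using sum_idealI[OF Comp_add[of k l] jac_add[of r s]] by (simp add: algebra_simps)
qed

lemma sum_ideal_left:
  assumes "q \<in> sum_ideal" "a \<in> Alg"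
  shows "a o\<^sub>L q \<in> sum_ideal"
proof -
  obtain k r where kr: "q = k + r" "k \<in> Comp" "r \<in> jac" using assms(1) by (auto simp: sum_ideal_def)
  have "a o\<^sub>L q = (a o\<^sub>L k) + (a o\<^sub>L r)"
    unfolding kr(1) by (rule blinfun_eqI) (simp add: blinfun.add_left blinfun.add_right)
  then show ?thesis using sum_idealI[OF Comp_left[OF kr(2) assms(2)] jac_left[OF kr(3) assms(2)]] by simp
qed

lemma sum_ideal_right:
  assumes "q \<in> sum_ideal" "a \<in> Alg"
  shows "q o\<^sub>L a \<in> sum_ideal"
proof -
  obtain k r where kr: "q = k + r" "k \<in> Comp" "r \<in> jac" using assms(1) by (auto simp: sum_ideal_def)
  have "q o\<^sub>L a = (k o\<^sub>L a) + (r o\<^sub>L a)"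
    unfolding kr(1) by (rule blinfun_eqI) (simp add: blinfun.add_left)
  then show ?thesis using sum_idealI[OF Comp_right[OF kr(2) assms(2)] jac_right[OF kr(3) assms(2)]] by simp
qed

lemma sum_ideal_0: "0 \<in> sum_ideal"
  by (rule Comp_sum_ideal[OF Comp_0])

lemma sum_ideal_scale: "q \<in> sum_ideal \<Longrightarrow> scale c q \<in> sum_ideal"
  by (subst scale_eq_comp) (intro sum_ideal_left Alg_scale Alg_id)

lemma sum_ideal_diff:
  assumes "p \<in> sum_ideal" "q \<in> sum_ideal"
  shows "p - q \<in> sum_ideal"
proof -
  have "p - q = p + scale (-1) q" by (rule blinfun_eqI) (simp add: blinfun.diff_left blinfun.add_left scaleC_minus_one)
  then show ?thesis by (simp only: sum_ideal_add[OF assms(1) sum_ideal_scale[OF assms(2)]])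
qed

text \<open>Along a rapidly convergent subsequence the successive differences are split with norm
  control. The compact parts and the radical parts then form two absolutely convergent series, each
  with its sum in a closed set.\<close>

lemma closed_sum_ideal: "closed sum_ideal"
  unfolding closed_sequential_limits
proof (intro allI impI, elim conjE)
  fix X T assume X: "\<forall>n. X n \<in> sum_ideal" "X \<longlonglongrightarrow> T"
  have "\<exists>m. norm (X m - T) < (1/2) ^ n" for n :: nat
    using LIMSEQ_D[OF X(2), of "(1/2) ^ n"] by auto
  then obtain m where m: "\<And>n. norm (X (m n) - T) < (1/2) ^ n" by metis
  define q where "q n = X (m n)" for n
  have q: "q n \<in> sum_ideal" for n using X(1) by (simp add: q_def)
  have "\<exists>k r. q (Suc n) - q n = k + r \<and> k \<in> Comp \<and> r \<in> jac \<and> norm k \<le> 2 * norm (q (Suc n) - q n)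
      \<and> norm r \<le> 3 * norm (q (Suc n) - q n)" for n
    using sum_ideal_split[OF sum_ideal_diff[OF q q], of "Suc n" n] by metis
  then obtain k r where kr: "\<And>n. q (Suc n) - q n = k n + r n" "\<And>n. k n \<in> Comp" "\<And>n. r n \<in> jac"
    "\<And>n. norm (k n) \<le> 2 * norm (q (Suc n) - q n)" "\<And>n. norm (r n) \<le> 3 * norm (q (Suc n) - q n)" by metis
  have dq: "norm (q (Suc n) - q n) \<le> 2 * (1/2) ^ n" for n
  proof -
    have "norm (q (Suc n) - q n) \<le> norm (q (Suc n) - T) + norm (q n - T)"
      using norm_triangle_ineq4[of "q (Suc n) - T" "q n - T"] by simp
    also have "\<dots> \<le> (1/2) ^ Suc n + (1/2) ^ n" unfolding q_def by (intro add_mono less_imp_le m)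
    also have "\<dots> \<le> 2 * (1/2) ^ n" by simp
    finally show ?thesis .
  qed
  have geo: "summable (\<lambda>n. C * (1/2) ^ n)" for C :: real by (intro summable_mult summable_geometric) simp
  have sk: "summable k"
  proof (rule summable_comparison_test'[OF geo[of 4], of 0])
    show "norm (k n) \<le> 4 * (1/2) ^ n" for n using kr(4)[of n] dq[of n] by linarith
  qed
  have sr: "summable r"
  proof (rule summable_comparison_test'[OF geo[of 6], of 0])
    show "norm (r n) \<le> 6 * (1/2) ^ n" for n using kr(5)[of n] dq[of n] by linarith
  qed
  have "(\<Sum>i<n. k i) \<in> Comp" for n by (induction n) (auto simp: Comp_0 Comp_add kr(2))
  then have K: "suminf k \<in> Comp"
    using closed_sequentially[OF closed_Comp _ summable_LIMSEQ[OF sk]] by blast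
  have "(\<Sum>i<n. r i) \<in> jac" for n by (induction n) (auto simp: jac_0 jac_add kr(3))
  then have R: "suminf r \<in> jac"
    using closed_sequentially[OF closed_jac _ summable_LIMSEQ[OF sr]] by blast
  have "q \<longlonglongrightarrow> T"
  proof (rule LIM_zero_cancel, rule Lim_null_comparison)
    show "\<forall>\<^sub>F n in sequentially. norm (q n - T) \<le> (1/2) ^ n"
      using m by (auto simp: q_def intro!: always_eventually less_imp_le)
    show "(\<lambda>n. (1/2) ^ n :: real) \<longlonglongrightarrow> 0" by (rule LIMSEQ_realpow_zero) auto
  qed
  then have "(\<lambda>n. q (Suc n) - q n) sums (T - q 0)" by (rule telescope_sums)
  moreover have "(\<lambda>n. q (Suc n) - q n) sums (suminf k + suminf r)"
    unfolding kr(1) by (intro sums_add summable_sums sk sr)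
  ultimately have "T = q 0 + (suminf k + suminf r)" by (metis sums_unique2 add.commute diff_add_cancel)
  then show "T \<in> sum_ideal" using sum_ideal_add[OF q sum_idealI[OF K R]] by simp
qed

section \<open>Closed ideals of the nest algebra and of its subalgebras\<close>

lemma restrict_ops [simp]:
  "acarrier (alg_restrict A X) = X" "azero (alg_restrict A X) = azero A"
  "aplus (alg_restrict A X) = aplus A" "amult (alg_restrict A X) = amult A"
  "ascale (alg_restrict A X) = ascale A" "anorm (alg_restrict A X) = anorm A"
  by (simp_all add: alg_restrict_def)

text \<open>Replaces the metric on a carrier by the subspace topology of the operator norm, so that
  closedness of ideals and compactness become statements about ordinary sets of operators.\<close>

lemma atopology_restrict: "atopology (alg_restrict (nest_algebra \<N>) X) = top_of_set X"
proof -
  let ?B = "alg_restrict (nest_algebra \<N>) X"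
  have am: "aminus ?B S T = S - T" for S T
    using aminus_nest_algebra[of \<N> S T] by (simp add: aminus_def)
  have dist: "adist ?B S T = (if S \<in> X \<and> T \<in> X then dist S T else 0)" for S T
    by (simp add: adist_def am dist_norm)
  interpret B: Metric_space X "adist ?B"
    by standard (auto simp: dist dist_commute dist_triangle)
  have "openin B.mtopology U \<longleftrightarrow> openin (top_of_set X) U" for U
  proof -
    have "B.mball x r \<subseteq> U \<longleftrightarrow> (\<forall>x'\<in>X. dist x' x < r \<longrightarrow> x' \<in> U)" if "x \<in> X" for x r
      using that by (auto simp: B.mball_def dist dist_commute)
    then show ?thesis
      unfolding B.openin_mtopology openin_euclidean_subtopology_iff by (meson subsetD)
  qed
  then show ?thesis by (simp add: atopology_def topology_eq)
qed

lemma restrict_Alg: "alg_restrict (nest_algebra \<N>) Alg = nest_algebra \<N>"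
  by (simp add: alg_restrict_def)

lemma closed_ideal_restrict_iff:
  assumes X: "closed X" "X \<subseteq> Alg"
  shows "closed_ideal (alg_restrict (nest_algebra \<N>) X) I \<longleftrightarrow>
    I \<subseteq> X \<and> 0 \<in> I \<and> (\<forall>x\<in>I. \<forall>y\<in>I. x + y \<in> I) \<and> (\<forall>c. \<forall>x\<in>I. scale c x \<in> I) \<and>
    (\<forall>a\<in>X. \<forall>x\<in>I. a o\<^sub>L x \<in> I \<and> x o\<^sub>L a \<in> I) \<and> closed I"
  unfolding closed_ideal_def alg_subspace_def atopology_restrict closedin_closed_eq[OF X(1)]
  by auto

lemma closed_ideal_iff:
  "closed_ideal (nest_algebra \<N>) I \<longleftrightarrow>
    I \<subseteq> Alg \<and> 0 \<in> I \<and> (\<forall>x\<in>I. \<forall>y\<in>I. x + y \<in> I) \<and> (\<forall>c. \<forall>x\<in>I. scale c x \<in> I) \<and>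
    (\<forall>a\<in>Alg. \<forall>x\<in>I. a o\<^sub>L x \<in> I \<and> x o\<^sub>L a \<in> I) \<and> closed I"
  using closed_ideal_restrict_iff[OF closed_Alg order_refl] by (simp add: restrict_Alg)

lemma closed_ideal_sum_ideal: "closed_ideal (nest_algebra \<N>) sum_ideal"
  unfolding closed_ideal_iff
  by (auto simp: sum_ideal_Alg sum_ideal_0 sum_ideal_add sum_ideal_scale sum_ideal_left sum_ideal_right
      closed_sum_ideal)

end

section \<open>Compact elements of quotients\<close>

text \<open>Hypocompactness of an ideal \<open>X\<close> quantifies over closed ideals
  \<open>I\<close> of \<open>X\<close> itself. Such an \<open>I\<close> absorbs multiplication by
  \<open>X\<close>, but need not be an ideal of the whole algebra.\<close>

locale nest_quotient = nest \<N> for \<N> :: "'h::complex_hilbert_space set set" +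
  fixes X I :: "('h \<Rightarrow>\<^sub>L 'h) set"
  assumes X: "closed_ideal (nest_algebra \<N>) X"
    and I: "closed_ideal (alg_restrict (nest_algebra \<N>) X) I"
begin

abbreviation Quot :: "('h \<Rightarrow>\<^sub>L 'h) set normed_alg" where
  "Quot \<equiv> alg_quotient (alg_restrict (nest_algebra \<N>) X) I"

abbreviation coset :: "('h \<Rightarrow>\<^sub>L 'h) \<Rightarrow> ('h \<Rightarrow>\<^sub>L 'h) set" where
  "coset \<equiv> alg_coset (alg_restrict (nest_algebra \<N>) X) I"

lemma X_props: "X \<subseteq> Alg" "0 \<in> X" "x \<in> X \<Longrightarrow> y \<in> X \<Longrightarrow> x + y \<in> X" "x \<in> X \<Longrightarrow> scale c x \<in> X"
  "a \<in> Alg \<Longrightarrow> x \<in> X \<Longrightarrow> a o\<^sub>L x \<in> X" "a \<in> Alg \<Longrightarrow> x \<in> X \<Longrightarrow> x o\<^sub>L a \<in> X" "closed X"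
  using X unfolding closed_ideal_iff by blast+

lemma I_props: "I \<subseteq> X" "0 \<in> I" "x \<in> I \<Longrightarrow> y \<in> I \<Longrightarrow> x + y \<in> I" "x \<in> I \<Longrightarrow> scale c x \<in> I"
  "a \<in> X \<Longrightarrow> x \<in> I \<Longrightarrow> a o\<^sub>L x \<in> I" "a \<in> X \<Longrightarrow> x \<in> I \<Longrightarrow> x o\<^sub>L a \<in> I" "closed I"
  using I unfolding closed_ideal_restrict_iff[OF X_props(7,1)] by blast+

lemma scale_minus_one: "scale (-1) x = - x"
  by (rule blinfun_eqI) (simp add: blinfun.minus_left scaleC_minus_one)

lemma I_uminus: "x \<in> I \<Longrightarrow> - x \<in> I"
  using I_props(4)[of x "-1"] by (simp add: scale_minus_one)

lemma I_diff: "x \<in> I \<Longrightarrow> y \<in> I \<Longrightarrow> x - y \<in> I"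
  using I_props(3)[OF _ I_uminus, of x y] by simp

lemma coset_iff: "z \<in> coset x \<longleftrightarrow> z - x \<in> I"
proof
  assume "z - x \<in> I"
  then have "x + (z - x) \<in> coset x" unfolding alg_coset_def by (intro image_eqI[of _ _ "z - x"]) auto
  then show "z \<in> coset x" by simp
qed (auto simp: alg_coset_def)

lemma coset_eq_iff: "coset x = coset y \<longleftrightarrow> x - y \<in> I"
proof
  assume "coset x = coset y"
  then have "x \<in> coset y" using coset_iff[of x x] I_props(2) by simp
  then show "x - y \<in> I" by (simp add: coset_iff)
next
  assume xy: "x - y \<in> I"
  have "z - x \<in> I \<longleftrightarrow> z - y \<in> I" for z
    using I_props(3)[OF _ xy, of "z - x"] I_diff[OF _ xy, of "z - y"] by auto
  then show "coset x = coset y" by (auto simp: coset_iff)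
qed

lemma Quot_carrier: "acarrier Quot = coset ` X"
  and Quot_zero: "azero Quot = coset 0"
  by (simp_all add: alg_quotient_def)

lemma Union_cosets:
  assumes "\<And>x'. x' \<in> coset x \<Longrightarrow> coset (f x') = coset (f x)"
  shows "(\<Union>x'\<in>coset x. coset (f x')) = coset (f x)"
proof -
  have "x \<in> coset x" using I_props(2) by (simp add: coset_iff)
  then show ?thesis using assms by blast
qed

lemma Quot_plus: "aplus Quot (coset x) (coset y) = coset (x + y)"
proof -
  have 1: "(\<Union>y'\<in>coset y. coset (x' + y')) = coset (x' + y)" for x'
    by (rule Union_cosets) (simp add: coset_eq_iff coset_iff)
  have "(\<Union>x'\<in>coset x. coset (x' + y)) = coset (x + y)"
    by (rule Union_cosets[where f = "\<lambda>x'. x' + y"]) (simp add: coset_eq_iff coset_iff)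
  then show ?thesis using 1 by (simp add: alg_quotient_def)
qed

lemma Quot_scale: "ascale Quot c (coset x) = coset (scale c x)"
proof -
  have "(\<Union>x'\<in>coset x. coset (scale c x')) = coset (scale c x)"
  proof (rule Union_cosets)
    fix x' assume "x' \<in> coset x"
    then have "scale c (x' - x) \<in> I" by (intro I_props(4)) (simp add: coset_iff)
    moreover have "scale c (x' - x) = scale c x' - scale c x"
      by (rule blinfun_eqI) (simp add: blinfun.diff_left complex_vector.scale_right_diff_distrib)
    ultimately show "coset (scale c x') = coset (scale c x)" by (simp add: coset_eq_iff)
  qed
  then show ?thesis by (simp add: alg_quotient_def)
qed

lemma coset_subset_X: "x \<in> X \<Longrightarrow> x' \<in> coset x \<Longrightarrow> x' \<in> X"
  using X_props(3)[of "x' - x" x] I_props(1) by (auto simp: coset_iff)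

lemma Quot_mult:
  assumes x: "x \<in> X" and y: "y \<in> X"
  shows "amult Quot (coset x) (coset y) = coset (x o\<^sub>L y)"
proof -
  have 1: "(\<Union>y'\<in>coset y. coset (x' o\<^sub>L y')) = coset (x' o\<^sub>L y)" if x': "x' \<in> X" for x'
  proof (rule Union_cosets)
    fix y' assume "y' \<in> coset y"
    then have "x' o\<^sub>L (y' - y) \<in> I" by (intro I_props(5) x') (simp add: coset_iff)
    moreover have "x' o\<^sub>L (y' - y) = (x' o\<^sub>L y') - (x' o\<^sub>L y)"
      by (rule blinfun_eqI) (simp add: blinfun.diff_left blinfun.diff_right)
    ultimately show "coset (x' o\<^sub>L y') = coset (x' o\<^sub>L y)" by (simp add: coset_eq_iff)
  qed
  have "(\<Union>x'\<in>coset x. coset (x' o\<^sub>L y)) = coset (x o\<^sub>L y)"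
  proof (rule Union_cosets[where f = "\<lambda>x'. x' o\<^sub>L y"])
    fix x' assume "x' \<in> coset x"
    then have "(x' - x) o\<^sub>L y \<in> I" by (intro I_props(6) y) (simp add: coset_iff)
    moreover have "(x' - x) o\<^sub>L y = (x' o\<^sub>L y) - (x o\<^sub>L y)"
      by (rule blinfun_eqI) (simp add: blinfun.diff_left)
    ultimately show "coset (x' o\<^sub>L y) = coset (x o\<^sub>L y)" by (simp add: coset_eq_iff)
  qed
  then show ?thesis using 1 coset_subset_X[OF x] by (simp add: alg_quotient_def)
qed

lemma Quot_norm: "anorm Quot (coset x) = infdist x I"
proof -
  have ne: "I \<noteq> {}" using I_props(2) by blast
  have "norm ` coset x = dist x ` I"
  proof
    show "norm ` coset x \<subseteq> dist x ` I"
    proof (rule image_subsetI)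
      fix z assume "z \<in> coset x"
      then have "x - z \<in> I" using I_uminus[of "z - x"] by (simp add: coset_iff)
      then show "norm z \<in> dist x ` I" by (intro image_eqI[of _ _ "x - z"]) (simp_all add: dist_norm)
    qed
    show "dist x ` I \<subseteq> norm ` coset x"
    proof (rule image_subsetI)
      fix i assume "i \<in> I"
      then have "x - i \<in> coset x" using I_uminus[of i] by (simp add: coset_iff)
      then show "dist x i \<in> norm ` coset x" by (intro image_eqI[of _ _ "x - i"]) (simp_all add: dist_norm)
    qed
  qed
  then show ?thesis by (simp add: alg_quotient_def infdist_notempty[OF ne])
qed

lemma Quot_minus: "aminus Quot (coset x) (coset y) = coset (x - y)"
  by (simp add: aminus_def Quot_scale Quot_plus scale_minus_one)

lemma Quot_dist: "x \<in> X \<Longrightarrow> y \<in> X \<Longrightarrow> adist Quot (coset x) (coset y) = infdist (x - y) I"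
  by (simp add: adist_def Quot_carrier Quot_minus Quot_norm)

lemma Quot_Metric_space: "Metric_space (coset ` X) (adist Quot)"
proof
  have ne: "I \<noteq> {}" using I_props(2) by blast
  show "0 \<le> adist Quot C D" for C D
    by (auto simp: adist_def Quot_carrier Quot_minus Quot_norm infdist_nonneg)
  show "adist Quot C D = adist Quot D C" for C D
  proof (cases "C \<in> coset ` X \<and> D \<in> coset ` X")
    case True
    then obtain x y where "C = coset x" "D = coset y" "x \<in> X" "y \<in> X" by blast
    then show ?thesis using infdist_uminus[OF I_uminus, of "x - y"] by (simp add: Quot_dist)
  qed (auto simp: adist_def Quot_carrier)
  show "adist Quot C D = 0 \<longleftrightarrow> C = D" if "C \<in> coset ` X" "D \<in> coset ` X" for C D
  proof -
    obtain x y where "C = coset x" "D = coset y" "x \<in> X" "y \<in> X" using \<open>C \<in> _\<close> \<open>D \<in> _\<close> by blast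
    then show ?thesis
      using in_closed_iff_infdist_zero[OF I_props(7) ne, of "x - y"] by (simp add: Quot_dist coset_eq_iff)
  qed
  show "adist Quot C E \<le> adist Quot C D + adist Quot D E"
    if "C \<in> coset ` X" "D \<in> coset ` X" "E \<in> coset ` X" for C D E
  proof -
    obtain x y z where "C = coset x" "D = coset y" "E = coset z" "x \<in> X" "y \<in> X" "z \<in> X" using \<open>C \<in> _\<close> \<open>D \<in> _\<close> \<open>E \<in> _\<close> by blast
    then show ?thesis using infdist_add_le[OF ne I_props(3), of "x - y" "y - z"] by (simp add: Quot_dist)
  qed
qed

sublocale Q: Metric_space "coset ` X" "adist Quot"
  by (rule Quot_Metric_space)

lemma Quot_topology: "atopology Quot = Q.mtopology"
  by (simp add: atopology_def Quot_carrier)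

lemma Quot_sandwich:
  assumes "a \<in> X" "x \<in> X"
  shows "amult Quot (amult Quot (coset a) (coset x)) (coset a) = coset (a o\<^sub>L x o\<^sub>L a)"
    and "a o\<^sub>L x o\<^sub>L a \<in> X"
proof -
  have aA: "a \<in> Alg" using assms(1) X_props(1) by blast
  have ax: "a o\<^sub>L x \<in> X" by (rule X_props(5)[OF aA assms(2)])
  show "a o\<^sub>L x o\<^sub>L a \<in> X" by (rule X_props(6)[OF aA ax])
  show "amult Quot (amult Quot (coset a) (coset x)) (coset a) = coset (a o\<^sub>L x o\<^sub>L a)"
    by (simp only: Quot_mult[OF assms] Quot_mult[OF ax assms(1)])
qed

text \<open>The quotient norm is an infimum, so a class of norm at most 1 has a representative of
  norm below 2. The image of the unit ball therefore lies in the continuous image of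
  \<open>K\<close>.\<close>

lemma compact_element_cosetI:
  assumes a: "a \<in> X" and K: "compact K" "K \<subseteq> X" "\<And>x. x \<in> X \<Longrightarrow> norm x \<le> 2 \<Longrightarrow> a o\<^sub>L x o\<^sub>L a \<in> K"
  shows "compact_element Quot (coset a)"
proof -
  let ?f = "\<lambda>C. amult Quot (amult Quot (coset a) C) (coset a)"
  let ?S = "?f ` {C \<in> acarrier Quot. anorm Quot C \<le> 1}"
  have "?S \<subseteq> coset ` K"
  proof (rule image_subsetI)
    fix C assume "C \<in> {C \<in> acarrier Quot. anorm Quot C \<le> 1}"
    then obtain x where x: "C = coset x" "x \<in> X" "infdist x I \<le> 1" by (auto simp: Quot_carrier Quot_norm)
    have "(INF i\<in>I. dist x i) < 2" using x(3) infdist_notempty[of I x] I_props(2) by fastforce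
    then obtain i where i: "i \<in> I" "dist x i < 2"
      using cINF_less_iff[of I "dist x" 2] I_props(2) by (auto intro: bdd_belowI[of _ 0])
    have "x - i \<in> coset x" using i(1) I_uminus[of i] by (simp add: coset_iff)
    then have xi: "x - i \<in> X" "coset (x - i) = C" using coset_subset_X[OF x(2)] i(1) I_uminus
      by (simp_all add: coset_eq_iff x(1))
    then have "?f C = coset (a o\<^sub>L (x - i) o\<^sub>L a)" using Quot_sandwich(1)[OF a xi(1)] by simp
    moreover have "a o\<^sub>L (x - i) o\<^sub>L a \<in> K" using i(2) by (intro K(3) xi(1)) (simp add: dist_norm)
    ultimately show "?f C \<in> coset ` K" by simp
  qed
  moreover have "compactin Q.mtopology (coset ` K)"
  proof (rule image_compactin)
    show "compactin (top_of_set X) K" using K(1,2) by (simp add: compactin_subtopology)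
    show "continuous_map (top_of_set X) Q.mtopology coset"
      unfolding Q.continuous_map_to_metric
    proof (intro ballI allI impI)
      fix x and e :: real assume x: "x \<in> topspace (top_of_set X)" and e: "e > 0"
      have "coset y \<in> Q.mball (coset x) e" if y: "y \<in> X \<inter> ball x e" for y
      proof -
        have "infdist (x - y) I \<le> dist x y" using infdist_le[OF I_props(2), of "x - y"] by (simp add: dist_norm)
        then show ?thesis using x y by (auto simp: Q.mball_def Quot_dist)
      qed
      then show "\<exists>U. openin (top_of_set X) U \<and> x \<in> U \<and> (\<forall>y\<in>U. coset y \<in> Q.mball (coset x) e)"
        using x e by (intro exI[of _ "X \<inter> ball x e"]) (auto simp: openin_open_Int)
    qed
  qed
  ultimately have "compactin Q.mtopology (Q.mtopology closure_of ?S)"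
    using Q.Hausdorff_space_mtopology
    by (meson closed_compactin closedin_closure_of closure_of_minimal compactin_imp_closedin)
  then show ?thesis
    using a by (simp add: compact_element_def compact_map_def Quot_topology Quot_carrier)
qed

text \<open>After division by \<open>C\<close> the classes of \<open>z n\<close> lie in the unit
  ball and their images stay \<open>d / C\<close> apart. A convergent subsequence, which compactness
  would supply, has two terms closer than that.\<close>

lemma not_compact_element_coset:
  assumes a: "a \<in> X" and z: "\<And>n::nat. z n \<in> X" "\<And>n. norm (z n) \<le> C" and C: "C > 0" and d: "d > 0"
    and sep: "\<And>m n. m \<noteq> n \<Longrightarrow> d \<le> infdist ((a o\<^sub>L z m o\<^sub>L a) - (a o\<^sub>L z n o\<^sub>L a)) I"
  shows "\<not> compact_element Quot (coset a)"
proof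
  assume ce: "compact_element Quot (coset a)"
  let ?f = "\<lambda>C. amult Quot (amult Quot (coset a) C) (coset a)"
  let ?S = "?f ` {C \<in> acarrier Quot. anorm Quot C \<le> 1}"
  let ?w = "\<lambda>n. (1 / C) *\<^sub>R z n"
  have w_eq: "?w n = scale (complex_of_real (1 / C)) (z n)" for n
    by (rule blinfun_eqI) (simp only: scale_apply scaleC_of_real blinfun.scaleR_left)
  have w: "?w n \<in> X" for n unfolding w_eq by (rule X_props(4)[OF z(1)])
  have "infdist (?w n) I \<le> 1" for n
  proof -
    have "infdist (?w n) I \<le> norm (?w n)" using infdist_le[OF I_props(2), of "?w n"] by simp
    also have "\<dots> \<le> 1" using z(2)[of n] C by simp
    finally show ?thesis .
  qed
  then have in_S: "coset (a o\<^sub>L ?w n o\<^sub>L a) \<in> ?S" for n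
    using w Quot_sandwich(1)[OF a w[of n]] by (intro image_eqI[of _ _ "coset (?w n)"]) (auto simp: Quot_carrier Quot_norm)
  define s where "s n = coset (a o\<^sub>L ?w n o\<^sub>L a)" for n
  have "?S \<subseteq> topspace Q.mtopology"
    using Quot_sandwich[OF a] by (auto simp: Quot_carrier)
  then have "?S \<subseteq> Q.mtopology closure_of ?S" by (rule closure_of_subset)
  then have "range s \<subseteq> Q.mtopology closure_of ?S" using in_S by (auto simp: s_def)
  moreover have "compactin Q.mtopology (Q.mtopology closure_of ?S)"
    using ce by (simp add: compact_element_def compact_map_def Quot_topology)
  ultimately obtain l r where lr: "strict_mono (r :: nat \<Rightarrow> nat)" "limitin Q.mtopology (s \<circ> r) l sequentially"
    unfolding Q.compactin_sequentially by blast
  have "d / C / 2 > 0" using d C by simp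
  then have "\<forall>\<^sub>F n in sequentially. (s \<circ> r) n \<in> coset ` X \<and> adist Quot ((s \<circ> r) n) l < d / C / 2"
    using lr(2) unfolding Q.limitin_metric by blast
  then obtain N where N: "\<And>n. n \<ge> N \<Longrightarrow> adist Quot (s (r n)) l < d / C / 2"
    unfolding eventually_sequentially by auto
  have lX: "l \<in> coset ` X" using lr(2) unfolding Q.limitin_metric by blast
  have sX: "s n \<in> coset ` X" for n using Quot_sandwich(2)[OF a w] by (auto simp: s_def)
  have "adist Quot (s (r N)) (s (r (Suc N))) \<le> adist Quot (s (r N)) l + adist Quot l (s (r (Suc N)))"
    by (rule Q.triangle[OF sX lX sX])
  also have "\<dots> < d / C" using N[of N] N[of "Suc N"] Q.commute[of l "s (r (Suc N))"] by simp
  finally have lt: "adist Quot (s (r N)) (s (r (Suc N))) < d / C" .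
  have ne: "r N \<noteq> r (Suc N)" using lr(1) by (metis n_not_Suc_n strict_mono_eq)
  let ?t = "(a o\<^sub>L z (r N) o\<^sub>L a) - (a o\<^sub>L z (r (Suc N)) o\<^sub>L a)"
  have neI: "I \<noteq> {}" using I_props(2) by blast
  have "d / C \<le> infdist ((1 / C) *\<^sub>R ?t) I"
    unfolding infdist_notempty[OF neI, of "(1 / C) *\<^sub>R ?t"]
  proof (rule cINF_greatest[OF neI])
    fix i assume i: "i \<in> I"
    have "scale (complex_of_real C) i = C *\<^sub>R i"
      by (rule blinfun_eqI) (simp only: scale_apply scaleC_of_real blinfun.scaleR_left)
    then have "C *\<^sub>R i \<in> I" using I_props(4)[OF i] by metis
    then have "d \<le> norm (?t - C *\<^sub>R i)"
      using sep[OF ne] infdist_le[of "C *\<^sub>R i" I ?t] by (simp add: dist_norm)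
    also have "?t - C *\<^sub>R i = C *\<^sub>R ((1 / C) *\<^sub>R ?t - i)" using C by (simp add: scaleR_diff_right)
    also have "norm \<dots> = C * norm ((1 / C) *\<^sub>R ?t - i)" using C by simp
    finally show "d / C \<le> dist ((1 / C) *\<^sub>R ?t) i" using C by (simp add: dist_norm field_simps)
  qed
  also have "(1 / C) *\<^sub>R ?t = (a o\<^sub>L ?w (r N) o\<^sub>L a) - (a o\<^sub>L ?w (r (Suc N)) o\<^sub>L a)"
    by (rule blinfun_eqI) (simp add: blinfun.diff_left blinfun.scaleR_left blinfun.scaleR_right scaleR_diff_right)
  also have "infdist \<dots> I = adist Quot (s (r N)) (s (r (Suc N)))"
    unfolding s_def by (rule Quot_dist[symmetric]) (intro Quot_sandwich(2) a w)+
  finally show False using lt by simp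
qed

end

context nest
begin

section \<open>The hypocompact radical\<close>

lemma hypocompact_sum_ideal: "hypocompact (alg_restrict (nest_algebra \<N>) sum_ideal)"
  unfolding hypocompact_def
proof (intro allI impI, elim conjE)
  fix I assume I: "closed_ideal (alg_restrict (nest_algebra \<N>) sum_ideal) I"
    and ne: "I \<noteq> acarrier (alg_restrict (nest_algebra \<N>) sum_ideal)"
  interpret nest_quotient \<N> sum_ideal I
    by unfold_locales (rule closed_ideal_sum_ideal, rule I)
  have goal: "\<exists>a. compact_element Quot a \<and> a \<noteq> azero Quot" if "s \<in> sum_ideal" "s \<notin> I" "compact_element Quot (coset s)" for s
  proof -
    have "coset s \<noteq> azero Quot" using that(2) by (simp add: Quot_zero coset_eq_iff)
    then show ?thesis using that(3) by blast
  qed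
  show "\<exists>a. compact_element Quot a \<and> a \<noteq> azero Quot"
  proof (cases "Comp \<subseteq> I")
    case False
    then obtain k where k: "k \<in> Comp" "k \<notin> I" by blast
    let ?K = "closure ((\<lambda>x. k o\<^sub>L x o\<^sub>L k) ` cball 0 2) \<inter> sum_ideal"
    have kQ: "k \<in> sum_ideal" by (rule Comp_sum_ideal[OF k(1)])
    have "compact_element Quot (coset k)"
    proof (rule compact_element_cosetI[OF kQ])
      show "compact ?K" using k(1) by (intro compact_Int_closed compact_multiplication closed_sum_ideal) (simp add: Comp_iff)
      show "k o\<^sub>L x o\<^sub>L k \<in> ?K" if "x \<in> sum_ideal" "norm x \<le> 2" for x
        using that(2) Quot_sandwich(2)[OF kQ that(1)] by (intro IntI subsetD[OF closure_subset] imageI) auto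
    qed simp
    then show ?thesis by (rule goal[OF kQ k(2)])
  next
    case True
    \<comment> \<open>If every corner were in \<open>I\<close>, radical elements would be limits of
      sums of corners and so lie in the closed set \<open>I\<close>; as \<open>I\<close> also
      contains the compacts, it would not be proper.\<close>
    have "\<exists>P\<in>\<N>. \<exists>T\<in>Alg. corner P T \<notin> I"
    proof (rule ccontr)
      assume "\<not> ?thesis"
      then have cI: "corner P T \<in> I" if "P \<in> \<N>" "T \<in> Alg" for P T using that by blast
      have "r \<in> I" if r: "r \<in> jac" for r
      proof -
        have "\<exists>u\<in>I. dist u r < e" if e: "e > 0" for e
        proof -
          have "finite_subnest (small_on (e/2) r)" using r e by (simp add: jac_eq_ringrose ringrose_ideal_def)
          note fin = finite_subnest_minus_0[OF this]
          obtain D u k where D: "r = D + u + k" "norm D \<le> e/2" "u \<in> I" "k \<in> {0}"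
          proof (rule block_decomposition[OF jac_Alg[OF r] _ _ _ _ I_props(2,3) _ fin])
            show "corner P (r o\<^sub>L b) \<in> I" if "P \<in> \<N>" "b \<in> Alg" for P b
              by (rule cI[OF that(1) Alg_comp[OF jac_Alg[OF r] that(2)]])
          qed (use e in \<open>auto simp: that\<close>)
          have "r - u = D" using D(1,4) by simp
          then have "dist u r < e" using D(2) e by (simp add: dist_norm norm_minus_commute)
          then show ?thesis using D(3) by blast
        qed
        then have "r \<in> closure I" by (simp add: closure_approachable)
        then show ?thesis using I_props(7) by simp
      qed
      then have "sum_ideal \<subseteq> I" using True I_props(3) unfolding sum_ideal_def by blast
      then show False using ne I_props(1) by auto
    qed
    then obtain P T where P: "P \<in> \<N>" and T: "T \<in> Alg" and nI: "corner P T \<notin> I" by blast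
    have sQ: "corner P T \<in> sum_ideal" by (rule jac_sum_ideal[OF corner_in_jac[OF P T]])
    have "compact_element Quot (coset (corner P T))"
    proof (rule compact_element_cosetI[OF sQ])
      show "compact {0 :: 'h \<Rightarrow>\<^sub>L 'h}" by simp
      show "corner P T o\<^sub>L x o\<^sub>L corner P T \<in> {0}" if "x \<in> sum_ideal" for x
      proof -
        have "corner P T o\<^sub>L x o\<^sub>L corner P T = corner P T o\<^sub>L (x o\<^sub>L corner P T)"
          by (rule blinfun_eqI) simp
        then show ?thesis using corner_sandwich[OF P sum_ideal_Alg[OF that]] by simp
      qed
    qed (simp add: sum_ideal_0)
    then show ?thesis by (rule goal[OF sQ nI])
  qed
qed

section \<open>Operators outside the sum ideal\<close>

text \<open>If for every \<open>e\<close> some finite subnest made the blocks of \<open>a\<close>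
  small modulo compacts, the block decomposition would place \<open>a\<close> in the closure of the
  sum, which is closed.\<close>

lemma not_sum_ideal_diagonal_sequences:
  assumes a: "a \<in> Alg" "a \<notin> sum_ideal"
  obtains \<eta> x y where "\<eta> > 0" "diagonal_sequences a \<eta> x y"
proof -
  let ?B = "\<lambda>e V. \<exists>k\<in>Comp. small_on e (a - k) V"
  have "\<exists>e>0. \<not> finite_subnest (?B e)"
  proof (rule ccontr)
    assume "\<not> ?thesis"
    then have fin: "finite_subnest (?B e)" if "e > 0" for e using that by blast
    have "\<exists>q\<in>sum_ideal. dist q a < e" if e: "e > 0" for e
    proof -
      have e2: "e / 2 > 0" "e / 2 \<ge> 0" using e by simp_all
      obtain D u k where D: "a = D + u + k" "norm D \<le> e/2" "u \<in> jac" "k \<in> Comp"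
      proof (rule block_decomposition[OF a(1) e2(2) Comp_0 Comp_add _ jac_0 jac_add _ fin[OF e2(1)]])
        show "b o\<^sub>L (k o\<^sub>L b) \<in> Comp" if "k \<in> Comp" "b \<in> Alg" for k b
          by (intro Comp_left Comp_right that)
        show "corner P (a o\<^sub>L b) \<in> jac" if "P \<in> \<N>" "b \<in> Alg" for P b
          by (rule corner_in_jac[OF that(1) Alg_comp[OF a(1) that(2)]])
      qed (assumption | rule that)+
      have "a - (k + u) = D" using D(1) by simp
      then have "dist (k + u) a < e" using D(2) e by (simp add: dist_norm norm_minus_commute)
      then show ?thesis using sum_idealI[OF D(4,3)] by blast
    qed
    then have "a \<in> closure sum_ideal" by (simp add: closure_approachable)
    then show False using closed_sum_ideal a(2) by simp
  qed
  then obtain e where e: "e > 0" and nf: "\<not> finite_subnest (?B e)" by blast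
  \<comment> \<open>Take \<open>k = 0\<close>: in the limit cases it is enough that \<open>a\<close>
    itself is large on every block.\<close>
  have small: "\<not> small_on e a T" if "\<not> ?B e T" for T
  proof
    assume "small_on e a T"
    then have "small_on e (a - 0) T" by simp
    then show False using that Comp_0 by blast
  qed
  show thesis
    using nf
  proof (rule not_finite_subnest_cases[rotated])
    fix M N assume "atom M N" "\<not> ?B e (N \<inter> ocomp M)"
    then show thesis using atom_diagonal_sequences[OF _ a(1) less_imp_le[OF e]] that e by blast
  next
    fix N assume N: "N \<in> \<N>" "subspace_chain (left_blocks N)" "\<Inter>(left_blocks N) = {0}"
      and nb: "\<And>T. T \<in> left_blocks N \<Longrightarrow> \<not> ?B e T"
    from left_diagonal_sequences[OF N a(1) e small[OF nb]] show thesis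
      using that[of "e/2"] e by auto
  next
    fix N assume N: "N \<in> \<N>" "subspace_chain (right_blocks N)" "\<Inter>(right_blocks N) = {0}"
      and nb: "\<And>T. T \<in> right_blocks N \<Longrightarrow> \<not> ?B e T"
    from right_diagonal_sequences[OF N a(1) e small[OF nb]] show thesis
      using that[of "e/2"] e by auto
  next
    show "?B e V" if "V \<subseteq> W" "?B e W" for V W
      using that small_on_subset by blast
  qed
qed

lemma cinner_orthonormal_tendsto_0:
  fixes y :: "nat \<Rightarrow> 'h"
  assumes "\<And>n. norm (y n) = 1" "\<And>m n. m \<noteq> n \<Longrightarrow> cinner (y m) (y n) = 0"
  shows "(\<lambda>n. cmod (cinner g (y n))) \<longlonglongrightarrow> 0"
proof -
  have "summable (\<lambda>n. (cmod (cinner g (y n)))\<^sup>2)"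
    by (rule summableI_nonneg_bounded[where x = "(norm g)\<^sup>2"])
      (use Bessel_inequality[of _ y g] assms in auto)
  then have "(\<lambda>n. (cmod (cinner g (y n)))\<^sup>2) \<longlonglongrightarrow> 0" by (rule summable_LIMSEQ_zero)
  then have "(\<lambda>n. sqrt ((cmod (cinner g (y n)))\<^sup>2)) \<longlonglongrightarrow> sqrt 0" by (rule tendsto_real_sqrt)
  then show ?thesis by simp
qed

text \<open>For the compact part, a finite net and Bessel's inequality give a bound uniform in
  \<open>i\<close>. For the radical part, one follows a finite subnest with small blocks until the
  tails of both sequences stop being orthogonal to its members; by concentration they then lie in a
  single block.\<close>

lemma sum_ideal_entries_small:
  assumes dg: "diagonal_sequences a \<eta> x y" and q: "q \<in> sum_ideal" and e: "e > 0"
  shows "\<exists>K. \<forall>i\<ge>K. \<forall>j\<ge>K. cmod (cinner (q (x i)) (y j)) < e"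
proof -
  have d: "norm (x n) = 1" "norm (y n) = 1" "m \<noteq> n \<Longrightarrow> cinner (y m) (y n) = 0" for m n
    using dg unfolding diagonal_sequences_def by blast+
  have conc: "(\<forall>\<^sub>F n in sequentially. x n \<in> P \<and> y n \<in> P) \<or>
      (\<forall>\<^sub>F n in sequentially. x n \<in> ocomp P \<and> y n \<in> ocomp P)" if "P \<in> \<N>" for P
    using dg that unfolding diagonal_sequences_def concentrated_def by blast
  obtain k r where kr: "q = k + r" "k \<in> Comp" "r \<in> jac" using q by (auto simp: sum_ideal_def)
  have "\<exists>K. \<forall>i. \<forall>j\<ge>K. cmod (cinner (k (x i)) (y j)) < e / 2"
  proof -
    have "e / 4 > 0" using e by simp
    then obtain F where F: "finite F" "\<And>v. norm v \<le> 1 \<Longrightarrow> \<exists>g\<in>F. norm (k v - g) < e / 4"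
      using kr(2) unfolding Comp_iff compact_operator_iff_net by metis
    have "\<forall>g\<in>F. \<forall>\<^sub>F j in sequentially. cmod (cinner g (y j)) < e / 4"
      using order_tendstoD(2)[OF cinner_orthonormal_tendsto_0[where y = y, OF d(2,3)] \<open>e / 4 > 0\<close>] by blast
    then have "\<forall>\<^sub>F j in sequentially. \<forall>g\<in>F. cmod (cinner g (y j)) < e / 4"
      using F(1) by (simp add: eventually_ball_finite)
    then obtain K where K: "\<And>j g. j \<ge> K \<Longrightarrow> g \<in> F \<Longrightarrow> cmod (cinner g (y j)) < e / 4"
      unfolding eventually_sequentially by blast
    have "cmod (cinner (k (x i)) (y j)) < e / 2" if j: "j \<ge> K" for i j
    proof -
      obtain g where g: "g \<in> F" "norm (k (x i) - g) < e / 4" using F(2)[of "x i"] d(1) by auto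
      have "cmod (cinner (k (x i) - g) (y j)) \<le> norm (k (x i) - g)"
        using norm_cinner_le[of "k (x i) - g" "y j"] d(2) by simp
      then have "cmod (cinner (k (x i) - g) (y j) + cinner g (y j)) < e / 4 + e / 4"
        using g K[OF j g(1)] by (intro norm_triangle_lt) linarith
      then show ?thesis by (simp add: cinner.diff_left)
    qed
    then show ?thesis by blast
  qed
  then obtain K1 where K1: "\<And>i j. j \<ge> K1 \<Longrightarrow> cmod (cinner (k (x i)) (y j)) < e / 2" by blast
  let ?small = "\<exists>K. \<forall>i\<ge>K. \<forall>j\<ge>K. cmod (cinner (r (x i)) (y j)) \<le> e / 2"
  have fin: "({0}, UNIV) \<in> (refine_steps (small_on (e / 2) r))\<^sup>*"
    using kr(3) e by (simp add: jac_eq_ringrose ringrose_ideal_def finite_subnest_def)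
  \<comment> \<open>Either the block has been found below \<open>P\<close>, or the tails are still
    orthogonal to \<open>P\<close>. The second alternative fails at the whole space, since the
    vectors have norm 1.\<close>
  have "?small \<or> (\<forall>\<^sub>F n in sequentially. x n \<in> ocomp P \<and> y n \<in> ocomp P)"
    if "({0}, P) \<in> (refine_steps (small_on (e / 2) r))\<^sup>*" for P
    using that
  proof induction
    case base
    show ?case by (intro disjI2 always_eventually) (simp add: ocomp_def cinner.zero_right)
  next
    case (step P P')
    have P: "P' \<in> \<N>" "small_on (e / 2) r (P' \<inter> ocomp P)" using step.hyps(2) by (auto simp: refine_steps_def)
    from step.IH show ?case
    proof
      assume per: "\<forall>\<^sub>F n in sequentially. x n \<in> ocomp P \<and> y n \<in> ocomp P"
      from conc[OF P(1)] show ?case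
      proof
        assume "\<forall>\<^sub>F n in sequentially. x n \<in> P' \<and> y n \<in> P'"
        with per have "\<forall>\<^sub>F n in sequentially. x n \<in> P' \<inter> ocomp P \<and> y n \<in> P' \<inter> ocomp P"
          by eventually_elim blast
        then obtain K where K: "\<And>n. n \<ge> K \<Longrightarrow> x n \<in> P' \<inter> ocomp P \<and> y n \<in> P' \<inter> ocomp P"
          unfolding eventually_sequentially by blast
        have "cmod (cinner (r (x i)) (y j)) \<le> e / 2" if "i \<ge> K" "j \<ge> K" for i j
        proof -
          have "cmod (cinner (r (x i)) (y j)) \<le> e / 2 * norm (x i) * norm (y j)"
            using P(2) K[OF that(1)] K[OF that(2)] unfolding small_on_def by blast
          then show ?thesis by (simp add: d)
        qed
        then show ?case by blast
      qed (rule disjI2)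
    qed (rule disjI1)
  qed
  from this[OF fin] have ?small
  proof
    assume "\<forall>\<^sub>F n in sequentially. x n \<in> ocomp UNIV \<and> y n \<in> ocomp UNIV"
    then obtain n where "x n \<in> ocomp UNIV" unfolding eventually_sequentially by blast
    then have "x n = 0" using ocomp_Int_self[of "x n" UNIV] by simp
    then show ?small using d(1)[of n] by simp
  qed
  then obtain K2 where K2: "\<And>i j. i \<ge> K2 \<Longrightarrow> j \<ge> K2 \<Longrightarrow> cmod (cinner (r (x i)) (y j)) \<le> e / 2" by blast
  have "cmod (cinner (q (x i)) (y j)) < e" if "i \<ge> max K1 K2" "j \<ge> max K1 K2" for i j
  proof -
    have "cmod (cinner (k (x i)) (y j) + cinner (r (x i)) (y j)) < e / 2 + e / 2"
      using K1[of j i] K2[of i j] that by (intro norm_triangle_lt) simp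
    then show ?thesis by (simp add: kr(1) blinfun.add_left cinner_add_left)
  qed
  then show ?thesis by blast
qed

text \<open>Treats both shift directions at once. The index 0 may be missing from \<open>I\<close>,
  since the backward shift has no value there, and the last bound says that a shift lowers an index
  by at most one.\<close>

lemma shiftable_index:
  assumes "shiftable x y"
  obtains \<sigma> I where "inj_on \<sigma> I" "\<And>k P. k \<in> I \<Longrightarrow> P \<in> \<N> \<Longrightarrow> x (\<sigma> k) \<in> P \<or> y k \<in> ocomp P"
    "\<And>k :: nat. k \<ge> 1 \<Longrightarrow> k \<in> I" "\<And>k. k \<le> Suc (\<sigma> k)"
proof -
  from assms consider "\<forall>n. \<forall>P\<in>\<N>. x n \<in> P \<or> y (Suc n) \<in> ocomp P" | "\<forall>n. \<forall>P\<in>\<N>. x (Suc n) \<in> P \<or> y n \<in> ocomp P"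
    unfolding shiftable_def by blast
  then show thesis
  proof cases
    case 1
    show thesis
    proof (rule that[of "\<lambda>k. k - 1" "{1..}"])
      show "inj_on (\<lambda>k. k - 1) {1::nat..}" by (auto simp: inj_on_def)
      show "x (k - 1) \<in> P \<or> y k \<in> ocomp P" if "k \<in> {1..}" "P \<in> \<N>" for k P
        using 1[rule_format, of P "k - 1"] that by simp
    qed auto
  next
    case 2
    show thesis by (rule that[of Suc UNIV]) (use 2 in auto)
  qed
qed

lemma hypocompact_ideal_subset:
  assumes J: "closed_ideal (nest_algebra \<N>) J" and hc: "hypocompact (alg_restrict (nest_algebra \<N>) J)"
  shows "J \<subseteq> sum_ideal"
proof (rule ccontr)
  assume nsub: "\<not> J \<subseteq> sum_ideal"
  have JA: "J \<subseteq> Alg" "closed J" using J unfolding closed_ideal_iff by blast+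
  \<comment> \<open>A closed ideal of \<open>J\<close>, proper because \<open>J\<close> is not
    contained in the sum. A nonzero compact element of the quotient is then the class of some
    \<open>a\<close> outside the sum.\<close>
  let ?I = "J \<inter> sum_ideal"
  have I: "closed_ideal (alg_restrict (nest_algebra \<N>) J) ?I"
    unfolding closed_ideal_restrict_iff[OF JA(2,1)]
  proof (intro conjI)
    show "closed ?I" using JA(2) closed_sum_ideal by (rule closed_Int)
  qed (use J[unfolded closed_ideal_iff] in \<open>auto simp: sum_ideal_0 sum_ideal_add sum_ideal_scale sum_ideal_left sum_ideal_right\<close>)
  interpret nest_quotient \<N> J ?I by unfold_locales (rule J, rule I)
  have "?I \<noteq> acarrier (alg_restrict (nest_algebra \<N>) J)" using nsub by auto
  then obtain \<alpha> where \<alpha>: "compact_element Quot \<alpha>" "\<alpha> \<noteq> azero Quot"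
    using hc I unfolding hypocompact_def by blast
  then have "\<alpha> \<in> acarrier Quot" by (simp add: compact_element_def)
  then obtain a where a: "\<alpha> = coset a" "a \<in> J" unfolding Quot_carrier by blast
  have aA: "a \<in> Alg" using a(2) JA(1) by blast
  have "a \<notin> sum_ideal" using \<alpha>(2) a by (simp add: Quot_zero coset_eq_iff)
  then obtain \<eta> x y where \<eta>: "\<eta> > 0" and dg: "diagonal_sequences a \<eta> x y"
    using not_sum_ideal_diagonal_sequences[OF aA] by blast
  have d: "norm (x n) = 1" "norm (y n) = 1" "cmod (cinner (a (x n)) (y n)) \<ge> \<eta>" for n
    using dg unfolding diagonal_sequences_def by blast+
  have "shiftable x y" using dg unfolding diagonal_sequences_def by blast
  then obtain \<sigma> I0 where \<sigma>: "inj_on \<sigma> I0" "\<And>k P. k \<in> I0 \<Longrightarrow> P \<in> \<N> \<Longrightarrow> x (\<sigma> k) \<in> P \<or> y k \<in> ocomp P"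
    "\<And>k. k \<ge> 1 \<Longrightarrow> k \<in> I0" "\<And>k. k \<le> Suc (\<sigma> k)" using shiftable_index by metis
  obtain S where S: "S \<in> Alg" "norm S \<le> 1 / \<eta>" "\<And>k. S (a (x k)) = (if k \<in> I0 then x (\<sigma> k) else 0)"
    using shift_operator[OF dg \<eta> \<sigma>(1,2)] by metis
  txt \<open>
    The sets \<open>\<Lambda> n\<close> are infinite and pairwise disjoint; \<open>a z\<^sub>n a\<close> maps \<open>x k\<close> to \<open>a (x (\<sigma> (\<sigma> k)))\<close> for
    \<open>k \<in> \<Lambda> n\<close> and to \<open>0\<close> for the other \<open>k\<close>, which keeps these operators apart modulo the sum ideal.
  \<close>
  define \<Lambda> where "\<Lambda> n = {k. fst (prod_decode k) = n}" for n
  have "\<exists>R. R \<in> Alg \<and> norm R \<le> 1 / \<eta> \<and> (\<forall>k. R (a (x k)) = (if k \<in> I0 \<inter> \<Lambda> n then x (\<sigma> k) else 0))" for n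
  proof -
    have inj: "inj_on \<sigma> (I0 \<inter> \<Lambda> n)" using \<sigma>(1) by (rule inj_on_subset) simp
    have sh: "x (\<sigma> k) \<in> P \<or> y k \<in> ocomp P" if "k \<in> I0 \<inter> \<Lambda> n" "P \<in> \<N>" for k P using \<sigma>(2) that by blast
    show ?thesis using shift_operator[OF dg \<eta> inj sh] by metis
  qed
  then obtain R where R: "\<And>n. R n \<in> Alg" "\<And>n. norm (R n) \<le> 1 / \<eta>"
    "\<And>n k. R n (a (x k)) = (if k \<in> I0 \<inter> \<Lambda> n then x (\<sigma> k) else 0)" by metis
  \<comment> \<open>\<open>S\<close> and \<open>R n\<close> are only known to lie in the nest
    algebra; the factor \<open>a\<close> puts \<open>z n\<close> into \<open>J\<close>.\<close>
  define z where "z n = S o\<^sub>L (a o\<^sub>L R n)" for n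
  define C where "C = (1 / \<eta>) * (norm a * (1 / \<eta>)) + 1"
  have C: "C > 0" using \<eta> by (simp add: C_def add_nonneg_pos)
  have "\<not> compact_element Quot (coset a)"
  proof (rule not_compact_element_coset[OF a(2) _ _ C, of z "\<eta> / 2"])
    show "z n \<in> J" for n
      unfolding z_def by (intro X_props(5) X_props(6) S(1) R(1) a(2))
    show "norm (z n) \<le> C" for n
    proof -
      have "norm (z n) \<le> norm S * norm (a o\<^sub>L R n)" unfolding z_def by (rule norm_blinfun_compose)
      also have "\<dots> \<le> (1 / \<eta>) * (norm a * norm (R n))"
        using S(2) \<eta> by (intro mult_mono norm_blinfun_compose) auto
      also have "\<dots> \<le> (1 / \<eta>) * (norm a * (1 / \<eta>))"
        using R(2) \<eta> by (intro mult_left_mono) auto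
      finally show ?thesis by (simp add: C_def)
    qed
    show "\<eta> / 2 > 0" using \<eta> by simp
    show "\<eta> / 2 \<le> infdist ((a o\<^sub>L z m o\<^sub>L a) - (a o\<^sub>L z n o\<^sub>L a)) ?I" if mn: "m \<noteq> n" for m n
    proof -
      let ?t = "(a o\<^sub>L z m o\<^sub>L a) - (a o\<^sub>L z n o\<^sub>L a)"
      have ne: "?I \<noteq> {}" using I_props(2) by blast
      show ?thesis
        unfolding infdist_notempty[OF ne]
      proof (rule cINF_greatest[OF ne])
        fix q assume "q \<in> ?I"
        then have q: "q \<in> sum_ideal" by blast
        obtain K where K: "\<And>i j. i \<ge> K \<Longrightarrow> j \<ge> K \<Longrightarrow> cmod (cinner (q (x i)) (y j)) < \<eta> / 2"
          using sum_ideal_entries_small[OF dg q, of "\<eta> / 2"] \<eta> by auto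
        \<comment> \<open>An index in \<open>\<Lambda> m\<close> that is at least
          \<open>K + 2\<close>: two shifts lower it by at most 2, so
          \<open>\<sigma> (\<sigma> k)\<close> is still at least \<open>K\<close>, and both
          \<open>k\<close> and \<open>\<sigma> k\<close> are at least 1 and hence in
          \<open>I0\<close>.\<close>
        define k where "k = prod_encode (m, K + 2)"
        have k: "k \<ge> K + 2" "k \<in> \<Lambda> m" "k \<notin> \<Lambda> n"
          using le_prod_encode_2[of "K + 2" m] mn by (auto simp: k_def \<Lambda>_def)
        have kI: "k \<in> I0" "\<sigma> k \<in> I0" "\<sigma> (\<sigma> k) \<ge> K"
          using k(1) \<sigma>(3)[of k] \<sigma>(3)[of "\<sigma> k"] \<sigma>(4)[of k] \<sigma>(4)[of "\<sigma> k"] by simp_all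
        let ?j = "\<sigma> (\<sigma> k)"
        have t: "?t (x k) = a (x ?j)"
          using k(2,3) kI(1,2) by (simp add: z_def R(3) S(3) blinfun.diff_left)
        have "\<eta> \<le> cmod (cinner (?t (x k)) (y ?j))" unfolding t by (rule d(3))
        also have "\<dots> \<le> cmod (cinner ((?t - q) (x k)) (y ?j)) + cmod (cinner (q (x k)) (y ?j))"
          using norm_triangle_ineq[of "cinner ((?t - q) (x k)) (y ?j)" "cinner (q (x k)) (y ?j)"]
          by (simp add: blinfun.diff_left cinner.diff_left)
        also have "cmod (cinner ((?t - q) (x k)) (y ?j)) \<le> norm (?t - q)"
          using order_trans[OF norm_cinner_le mult_right_mono[OF norm_blinfun[of "?t - q" "x k"] norm_ge_zero[of "y ?j"]]] d
          by simp
        finally have "\<eta> \<le> norm (?t - q) + cmod (cinner (q (x k)) (y ?j))" by simp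
        then show "\<eta> / 2 \<le> dist ?t q" using K[of k ?j] k(1) kI(3) by (simp add: dist_norm)
      qed
    qed
  qed
  then show False using \<alpha>(1) a(1) by simp
qed

lemma is_hypocompact_radical_sum_ideal: "is_hypocompact_radical (nest_algebra \<N>) sum_ideal"
  unfolding is_hypocompact_radical_def
  using closed_ideal_sum_ideal hypocompact_sum_ideal hypocompact_ideal_subset by blast

end

theorem theorem2p4:
  fixes \<N> :: "'h::complex_hilbert_space set set"
  assumes "is_nest \<N>"
  shows "is_hypocompact_radical (nest_algebra \<N>)
           {k + r | k r. k \<in> nest_compacts \<N> \<and> r \<in> jacobson_radical (nest_algebra \<N>)} \<and>
         hypocompact_radical (nest_algebra \<N>) =
           {k + r | k r. k \<in> nest_compacts \<N> \<and> r \<in> jacobson_radical (nest_algebra \<N>)}"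
proof -
  interpret nest \<N> by unfold_locales (rule assms)
  note rad = is_hypocompact_radical_sum_ideal[unfolded sum_ideal_def]
  show ?thesis using rad hypocompact_radical_eq[OF rad] by blast
qed

end
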